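(* Let $T>0$, $f\in C^3([0,T],C^\infty_c(\mathbb{R}))$ and $g_0,g_1,g_2\in C^\infty_c(\mathbb{R})$. Consider, for $(t,x)\in[0,T]\times\mathbb{R}$, the Cauchy problem \[ \begin{aligned} \partial_t^3u-a(x)\partial_t\partial^2_{x} u+b_1(x)\partial_{x}^2u+b_2(x)\partial_t\partial_{x}u+b_3(x)\partial^2_tu&=f(t,x),\\ u(0,x)&=g_0(x),\\ \partial_tu(0,x)&=g_1(x),\\ \partial_t^2u(0,x)&=g_2(x). \end{aligned} \] Suppose that $a\ge 0$, that all the coefficients $a,b_1,b_2,b_3$ are real-valued and belong to $B^\infty(\mathbb{R})$, and that \[ |b_1|\prec a,\quad |b_2|\prec \sqrt{a},\quad |b'_1|\prec \sqrt{a}. \] Then the Cauchy problem is $C^\infty$ well-posed.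
   Context: All functions are real-valued. $B^\infty(\mathbb{R})$ is the space of smooth functions on $\mathbb{R}$ that are bounded together with their derivatives of every order. For functions $f=f(y)$, $g=g(y)$, the notation $f\prec g$ means that there exists a constant $C>0$ such that $f(y)\le Cg(y)$ for all $y$. The Cauchy problem is called $C^\infty$ well-posed if, for initial data in $C^\infty_c(\mathbb{R})$ (and right-hand side $f$ as given), it has a unique global solution on $[0,T]\times\mathbb{R}$ that is smooth in $x$, namely a unique solution $u\in C^3([0,T],C^\infty(\mathbb{R}))$. *)

theory Defs
  imports "HOL-Analysis.Analysis"
begin

definition smooth :: "(real \<Rightarrow> real) \<Rightarrow> bool" where
  "smooth \<phi> \<longleftrightarrow> (\<forall>n x. (deriv ^^ n) \<phi> differentiable (at x))"

definition Binf :: "(real \<Rightarrow> real) set" where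
  "Binf = {\<phi>. smooth \<phi> \<and> (\<forall>n. bounded (range ((deriv ^^ n) \<phi>)))}"

definition Cinf_c :: "(real \<Rightarrow> real) set" where
  "Cinf_c = {\<phi>. smooth \<phi> \<and> compact (closure {x. \<phi> x \<noteq> 0})}"

definition dominated :: "(real \<Rightarrow> real) \<Rightarrow> (real \<Rightarrow> real) \<Rightarrow> bool"  (infix \<open>\<lessapprox>\<close> 50) where
  "p \<lessapprox> q \<longleftrightarrow> (\<exists>C>0. \<forall>y. p y \<le> C * q y)"

text \<open>
  Convergence in the Frechet space of smooth functions on the real line: derivatives of every
  order converge uniformly on every compact set.
\<close>

definition Cinf_tendsto :: "('s \<Rightarrow> real \<Rightarrow> real) \<Rightarrow> (real \<Rightarrow> real) \<Rightarrow> 's filter \<Rightarrow> bool" where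
  "Cinf_tendsto v \<phi> F \<longleftrightarrow>
     (\<forall>n K. compact K \<longrightarrow> uniform_limit K (\<lambda>s. (deriv ^^ n) (v s)) ((deriv ^^ n) \<phi>) F)"

text \<open>
  A function of time \<open>t\<close> and space \<open>x\<close> is curried, with \<open>t\<close> first. Only its values for \<open>t\<close> in
  \<open>[0,T]\<close> matter, so time derivatives are taken within this interval (one-sided at the endpoints).
\<close>

definition dt :: "real \<Rightarrow> (real \<Rightarrow> real \<Rightarrow> real) \<Rightarrow> real \<Rightarrow> real \<Rightarrow> real" where
  "dt T u = (\<lambda>t x. vector_derivative (\<lambda>s. u s x) (at t within {0..T}))"

definition dx :: "(real \<Rightarrow> real \<Rightarrow> real) \<Rightarrow> real \<Rightarrow> real \<Rightarrow> real" where
  "dx u = (\<lambda>t. deriv (u t))"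

text \<open>
  \<open>Ck_Cinf T k\<close> is the space of \<open>k\<close> times continuously differentiable maps from \<open>[0,T]\<close> to the
  Frechet space of smooth functions. Since convergence there implies pointwise convergence, the
  derivative of such a map, when it exists, can only be the pointwise one, \<open>dt T v\<close>.
\<close>

primrec Ck_Cinf :: "real \<Rightarrow> nat \<Rightarrow> (real \<Rightarrow> real \<Rightarrow> real) \<Rightarrow> bool" where
  "Ck_Cinf T 0 v \<longleftrightarrow>
     (\<forall>t\<in>{0..T}. smooth (v t) \<and> Cinf_tendsto v (v t) (at t within {0..T}))"
| "Ck_Cinf T (Suc k) v \<longleftrightarrow>
     (\<forall>t\<in>{0..T}. smooth (v t) \<and>
        Cinf_tendsto (\<lambda>s x. (v s x - v t x) / (s - t)) (dt T v t) (at t within {0..T})) \<and>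
     Ck_Cinf T k (dt T v)"

text \<open>
  Compactly supported functions carry the usual inductive limit topology. A continuous map from
  the compact interval \<open>[0,T]\<close> into that space has bounded image, that is, all its values are
  supported in one compact set, and on such functions the topology is that of \<open>Cinf_tendsto\<close>.
\<close>

definition Ck_Cinf_c :: "real \<Rightarrow> nat \<Rightarrow> (real \<Rightarrow> real \<Rightarrow> real) \<Rightarrow> bool" where
  "Ck_Cinf_c T k v \<longleftrightarrow> Ck_Cinf T k v \<and>
     (\<exists>K. compact K \<and> (\<forall>t\<in>{0..T}. \<forall>x. x \<notin> K \<longrightarrow> v t x = 0))"

definition solves_cauchy ::
  "real \<Rightarrow> (real \<Rightarrow> real) \<Rightarrow> (real \<Rightarrow> real) \<Rightarrow> (real \<Rightarrow> real) \<Rightarrow> (real \<Rightarrow> real) \<Rightarrow>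
   (real \<Rightarrow> real \<Rightarrow> real) \<Rightarrow> (real \<Rightarrow> real) \<Rightarrow> (real \<Rightarrow> real) \<Rightarrow> (real \<Rightarrow> real) \<Rightarrow>
   (real \<Rightarrow> real \<Rightarrow> real) \<Rightarrow> bool" where
  "solves_cauchy T a b1 b2 b3 f g0 g1 g2 u \<longleftrightarrow>
     Ck_Cinf T 3 u \<and>
     (\<forall>t\<in>{0..T}. \<forall>x.
        dt T (dt T (dt T u)) t x - a x * dt T (dx (dx u)) t x
        + b1 x * dx (dx u) t x + b2 x * dt T (dx u) t x + b3 x * dt T (dt T u) t x
        = f t x) \<and>
     (\<forall>x. u 0 x = g0 x \<and> dt T u 0 x = g1 x \<and> dt T (dt T u) 0 x = g2 x)"

text \<open>Uniqueness is uniqueness on the strip \<open>[0,T] \<times> \<real>\<close>, where the problem is posed.\<close>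

definition Cinf_well_posed ::
  "real \<Rightarrow> (real \<Rightarrow> real) \<Rightarrow> (real \<Rightarrow> real) \<Rightarrow> (real \<Rightarrow> real) \<Rightarrow> (real \<Rightarrow> real) \<Rightarrow>
   (real \<Rightarrow> real \<Rightarrow> real) \<Rightarrow> bool" where
  "Cinf_well_posed T a b1 b2 b3 f \<longleftrightarrow>
     (\<forall>g0\<in>Cinf_c. \<forall>g1\<in>Cinf_c. \<forall>g2\<in>Cinf_c.
        \<exists>u. solves_cauchy T a b1 b2 b3 f g0 g1 g2 u \<and>
            (\<forall>v. solves_cauchy T a b1 b2 b3 f g0 g1 g2 v \<longrightarrow>
                 (\<forall>t\<in>{0..T}. \<forall>x. v t x = u t x)))"

end

theory Submission
  imports Defs
begin

text \<open>
  Write \<open>u_t\<close>, \<open>u_x\<close> and so on for partial derivatives. The principal symbol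
  \<open>\<tau> (\<tau>\<^sup>2 - a \<xi>\<^sup>2)\<close> has a triple root wherever \<open>a\<close> vanishes, so the problem is
  only weakly hyperbolic, and the hypotheses on \<open>b1\<close> and \<open>b2\<close> are exactly what an energy of the
  right degenerate shape can absorb. With \<open>z = u_tt - a u_xx\<close> that energy is
  \<open>E = \<integral> (z\<^sup>2 + u_tt\<^sup>2 + a u_tx\<^sup>2 + a u_x\<^sup>2 + u_t\<^sup>2 + u\<^sup>2) dx\<close>.
  The equation says that \<open>z_t\<close> equals \<open>f\<close> minus the terms with \<open>b1\<close>, \<open>b2\<close>, \<open>b3\<close>, and each of
  these is bounded in the mean square by a multiple of \<open>\<surd>E\<close>: \<open>|b2 u_tx|\<close> and \<open>|b3 u_tt|\<close> are clear, and
  \<open>|b1 u_xx| \<le> C a |u_xx| = C |u_tt - z|\<close>. The pair \<open>(u_tt, \<surd>a u_tx)\<close> is treated as for the wave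
  equation; its integration by parts produces \<open>a' u_tt u_tx\<close>, which is harmless because a
  nonnegative function with bounded second derivative satisfies \<open>|a'| \<le> C \<surd>a\<close>
  (\<open>glaeser_inequality\<close>). So \<open>E' \<le> C E + \<integral> f\<^sup>2\<close>.

  Differentiating the equation in \<open>x\<close> gives an equation of the same kind for \<open>u_x\<close>: the new terms are
  \<open>- a' u_txx\<close>, which changes \<open>b2\<close> by \<open>- a'\<close>, and \<open>b1' u_xx\<close>, which is a term \<open>b1' (u_x)_x\<close> controlled by
  \<open>\<surd>a (u_x)_x\<close>; here the hypothesis on \<open>b1'\<close> enters. The class of equations that carries the lower order terms
  \<open>c4 u_x + c5 u_t + c6 u\<close> with \<open>|c4| \<le> C \<surd>a\<close> is closed under this operation, and induction gives
  energy estimates of every order without loss of derivatives (\<open>higher_energy_estimate\<close>).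

  The energies are weighted by a function of \<open>(t, x)\<close> that is supported in a backward cone in space-time and decreases in
  time fast enough to absorb the flux through its slope (\<open>weight_flux\<close>). The estimates are therefore local,
  they hold for solutions of arbitrary growth, and they yield uniqueness at once.

  For existence, \<open>a\<close> is replaced by \<open>a + \<epsilon>\<close>. This keeps all hypotheses, with the same constants, and makes the
  problem strictly hyperbolic. In the coordinate \<open>y\<close> with \<open>dy = dx / \<surd>(a + \<epsilon>)\<close> the characteristic speeds are
  \<open>1\<close>, \<open>-1\<close> and \<open>0\<close>, and the equation becomes a diagonal transport system with
  zero-order coupling, solved by Picard iteration (\<open>transport_system_existence\<close>,
  \<open>strictly_hyperbolic_existence\<close>). The difference of the solutions for \<open>\<epsilon>\<close> and \<open>\<delta>\<close> solves the
  problem for \<open>\<epsilon>\<close> with zero data and right-hand side \<open>(\<epsilon> - \<delta>) v_txx\<close>, where \<open>v\<close> is the solution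
  for \<open>\<delta>\<close>. As the estimates lose nothing and are uniform in \<open>\<epsilon>\<close>, all derivatives of the difference are
  \<open>O(\<epsilon> - \<delta>)\<close> locally uniformly (\<open>stability\<close>): the solutions converge as \<open>\<epsilon>\<close> tends to \<open>0\<close>, and the
  limit solves the degenerate problem. The case \<open>\<epsilon> = \<delta> = 0\<close> of the same estimate is uniqueness.
\<close>

section \<open>Smooth functions on a space-time strip\<close>

text \<open>
  The flag \<open>B\<close> asks in addition for a global bound. Boundedness is needed for the Picard iteration,
  whose constants must be uniform in space, whereas the solutions themselves are only used locally; both versions
  of the calculus have the same proofs.
\<close>

definition strip_cont :: "bool \<Rightarrow> real \<Rightarrow> (real \<Rightarrow> real \<Rightarrow> real) \<Rightarrow> bool" where
  "strip_cont B T v \<longleftrightarrow> continuous_on ({0..T} \<times> UNIV) (\<lambda>(t, x). v t x) \<and>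
     (B \<longrightarrow> (\<exists>M. \<forall>t\<in>{0..T}. \<forall>x. \<bar>v t x\<bar> \<le> M))"

text \<open>
  Only space derivatives are counted, up to order \<open>n\<close>. The recursion over the order makes closure
  properties provable by induction, in contrast to the derivatives \<open>deriv ^^ n\<close>, for which the product and
  chain rules have no usable closed form.
\<close>

primrec strip_Cn :: "bool \<Rightarrow> real \<Rightarrow> nat \<Rightarrow> (real \<Rightarrow> real \<Rightarrow> real) \<Rightarrow> bool" where
  "strip_Cn B T 0 v \<longleftrightarrow> strip_cont B T v"
| "strip_Cn B T (Suc n) v \<longleftrightarrow> strip_cont B T v \<and>
     (\<forall>t\<in>{0..T}. \<forall>x. v t differentiable (at x)) \<and> strip_Cn B T n (dx v)"

definition strip_smooth :: "bool \<Rightarrow> real \<Rightarrow> (real \<Rightarrow> real \<Rightarrow> real) \<Rightarrow> bool" where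
  "strip_smooth B T v \<longleftrightarrow> (\<forall>n. strip_Cn B T n v)"

text \<open>
  As a relation, in contrast to the operator \<open>dt\<close>, this asserts differentiability, and it passes to limits.
\<close>

definition has_dt :: "real \<Rightarrow> (real \<Rightarrow> real \<Rightarrow> real) \<Rightarrow> (real \<Rightarrow> real \<Rightarrow> real) \<Rightarrow> bool" where
  "has_dt T v w \<longleftrightarrow>
     (\<forall>t\<in>{0..T}. \<forall>x. ((\<lambda>s. v s x) has_real_derivative w t x) (at t within {0..T}))"

lemma funpow_dx: "(dx ^^ n) v t = (deriv ^^ n) (v t)"
  by (induction n) (auto simp: dx_def)

lemma smooth_iff: "smooth \<phi> \<longleftrightarrow> (\<forall>x. \<phi> differentiable (at x)) \<and> smooth (deriv \<phi>)"
proof -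
  have *: "(deriv ^^ n) (deriv \<phi>) = (deriv ^^ Suc n) \<phi>" for n
    by (simp only: funpow_Suc_right comp_apply)
  show ?thesis
    unfolding smooth_def * by (metis funpow_0 not0_implies_Suc)
qed

lemma strip_cont_cong:
  assumes "\<And>t. t \<in> {0..T} \<Longrightarrow> v t = w t"
  shows "strip_cont B T v \<longleftrightarrow> strip_cont B T w"
proof -
  have "continuous_on ({0..T} \<times> UNIV) (\<lambda>(t, x). v t x) = continuous_on ({0..T} \<times> UNIV) (\<lambda>(t, x). w t x)"
    using assms by (intro continuous_on_cong) auto
  then show ?thesis using assms unfolding strip_cont_def by auto
qed

lemma strip_Cn_cong:
  assumes "\<And>t. t \<in> {0..T} \<Longrightarrow> v t = w t"
  shows "strip_Cn B T n v \<longleftrightarrow> strip_Cn B T n w"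
  using assms
proof (induction n arbitrary: v w)
  case 0 show ?case unfolding strip_Cn.simps by (rule strip_cont_cong) (rule 0)
next
  case (Suc n)
  have "strip_Cn B T n (dx v) = strip_Cn B T n (dx w)"
    by (rule Suc.IH) (simp add: dx_def Suc.prems)
  then show ?case using Suc.prems strip_cont_cong[of T v w B] by auto
qed

lemma strip_Cn_imp_cont: "strip_Cn B T n v \<Longrightarrow> strip_cont B T v"
  by (cases n) auto

lemma strip_Cn_SucD: "strip_Cn B T (Suc n) v \<Longrightarrow> strip_Cn B T n v"
proof (induction n arbitrary: v)
  case (Suc n)
  then show ?case by (metis strip_Cn.simps(2))
qed simp

lemma strip_Cn_SucI:
  assumes "strip_cont B T v"
    and d: "\<And>t x. t \<in> {0..T} \<Longrightarrow> (v t has_real_derivative w t x) (at x)"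
    and w: "strip_Cn B T n w"
  shows "strip_Cn B T (Suc n) v"
proof -
  have "strip_Cn B T n (dx v) = strip_Cn B T n w"
    by (rule strip_Cn_cong) (use d in \<open>auto simp: dx_def fun_eq_iff intro!: DERIV_imp_deriv\<close>)
  then show ?thesis using assms real_differentiable_def by auto blast
qed

lemma strip_Cn_SucE:
  assumes "strip_Cn B T (Suc n) v"
  shows "strip_cont B T v"
    and "\<And>t x. t \<in> {0..T} \<Longrightarrow> (v t has_real_derivative dx v t x) (at x)"
    and "strip_Cn B T n (dx v)"
  using assms DERIV_deriv_iff_real_differentiable by (auto simp: dx_def)

lemma strip_smooth_cont: "strip_smooth B T v \<Longrightarrow> strip_cont B T v"
  unfolding strip_smooth_def using strip_Cn_imp_cont by blast

lemma strip_smooth_deriv: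
  "strip_smooth B T v \<Longrightarrow> t \<in> {0..T} \<Longrightarrow> (v t has_real_derivative dx v t x) (at x)"
  unfolding strip_smooth_def using strip_Cn_SucE(2) by blast

lemma strip_smooth_dx: "strip_smooth B T v \<Longrightarrow> strip_smooth B T (dx v)"
  unfolding strip_smooth_def using strip_Cn_SucE(3) by blast

lemma strip_smooth_dxn: "strip_smooth B T v \<Longrightarrow> strip_smooth B T ((dx ^^ n) v)"
  by (induction n) (auto intro: strip_smooth_dx)

lemma strip_smooth_from_derivatives:
  assumes "\<And>k. strip_cont B T (g k)"
    and "\<And>k t x. t \<in> {0..T} \<Longrightarrow> (g k t has_real_derivative g (Suc k) t x) (at x)"
  shows "strip_smooth B T (g k)"
proof -
  have "strip_Cn B T n (g k)" for n
    by (induction n arbitrary: k) (auto intro: assms(1) strip_Cn_SucI[OF assms] simp del: strip_Cn.simps(2))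
  then show ?thesis by (simp add: strip_smooth_def)
qed

lemma dx_eqI:
  assumes "\<And>x. (v t has_real_derivative w x) (at x)"
  shows "dx v t = w"
  unfolding dx_def using assms by (auto intro!: DERIV_imp_deriv)

lemma strip_smooth_smooth: "strip_smooth B T v \<Longrightarrow> t \<in> {0..T} \<Longrightarrow> smooth (v t)"
  unfolding smooth_def
  using strip_smooth_deriv[OF strip_smooth_dxn] by (fastforce simp flip: funpow_dx simp: real_differentiable_def)

lemma strip_cont_continuous:
  "strip_cont B T v \<Longrightarrow> continuous_on ({0..T} \<times> UNIV) (\<lambda>(t, x). v t x)"
  by (simp add: strip_cont_def)

lemma strip_cont_unbounded: "strip_cont B T v \<Longrightarrow> strip_cont False T v"
  by (simp add: strip_cont_def)

lemma strip_Cn_unbounded: "strip_Cn B T n v \<Longrightarrow> strip_Cn False T n v"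
  by (induction n arbitrary: v) (auto intro: strip_cont_unbounded)

lemma strip_smooth_unbounded: "strip_smooth B T v \<Longrightarrow> strip_smooth False T v"
  unfolding strip_smooth_def using strip_Cn_unbounded by blast

lemma strip_cont_compose:
  assumes "strip_cont B T v" "continuous_on S f" "continuous_on S g" "\<And>p. p \<in> S \<Longrightarrow> f p \<in> {0..T}"
  shows "continuous_on S (\<lambda>p. v (f p) (g p))"
proof -
  have "continuous_on S (\<lambda>p. (\<lambda>(t, x). v t x) (f p, g p))"
    by (rule continuous_on_compose2[OF strip_cont_continuous[OF assms(1)]])
      (use assms(2-) in \<open>auto intro!: continuous_on_Pair\<close>)
  then show ?thesis by simp
qed

lemma strip_cont_at: "strip_cont B T v \<Longrightarrow> t \<in> {0..T} \<Longrightarrow> continuous_on S (v t)"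
  by (rule strip_cont_compose[of B T v S "\<lambda>_. t" "\<lambda>x. x"]) (auto intro: continuous_intros)

lemma strip_cont_time: "strip_cont B T v \<Longrightarrow> S \<subseteq> {0..T} \<Longrightarrow> continuous_on S (\<lambda>t. v t x)"
  by (rule strip_cont_compose[of B T v S "\<lambda>t. t" "\<lambda>_. x"]) (auto intro: continuous_intros)

lemma strip_cont_const: "strip_cont B T (\<lambda>t x. c)"
  by (auto simp: strip_cont_def intro: exI[of _ "\<bar>c\<bar>"])

lemma strip_cont_add:
  assumes "strip_cont B T v" "strip_cont B T w"
  shows "strip_cont B T (\<lambda>t x. v t x + w t x)"
proof -
  have "\<exists>M. \<forall>t\<in>{0..T}. \<forall>x. \<bar>v t x + w t x\<bar> \<le> M" if B: B
  proof -
    obtain M N where "\<forall>t\<in>{0..T}. \<forall>x. \<bar>v t x\<bar> \<le> M" "\<forall>t\<in>{0..T}. \<forall>x. \<bar>w t x\<bar> \<le> N"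
      using assms B unfolding strip_cont_def by blast
    then have "\<forall>t\<in>{0..T}. \<forall>x. \<bar>v t x + w t x\<bar> \<le> M + N"
      by (meson abs_triangle_ineq add_mono order_trans)
    then show ?thesis by blast
  qed
  then show ?thesis using assms
    by (auto simp: strip_cont_def split_beta intro!: continuous_intros)
qed

lemma strip_cont_mult:
  assumes "strip_cont B T v" "strip_cont B T w"
  shows "strip_cont B T (\<lambda>t x. v t x * w t x)"
proof -
  have "\<exists>M. \<forall>t\<in>{0..T}. \<forall>x. \<bar>v t x * w t x\<bar> \<le> M" if B: B
  proof -
    obtain M N where "\<forall>t\<in>{0..T}. \<forall>x. \<bar>v t x\<bar> \<le> M" "\<forall>t\<in>{0..T}. \<forall>x. \<bar>w t x\<bar> \<le> N"
      using assms B unfolding strip_cont_def by blast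
    then have "\<forall>t\<in>{0..T}. \<forall>x. \<bar>v t x * w t x\<bar> \<le> M * N"
      unfolding abs_mult by (metis abs_ge_zero mult_mono' order_trans)
    then show ?thesis by blast
  qed
  then show ?thesis using assms
    by (auto simp: strip_cont_def split_beta intro!: continuous_intros)
qed

lemma strip_cont_comp:
  assumes "strip_cont B T v" "continuous_on ({0..T} \<times> UNIV) (\<lambda>(t, x). \<phi> t x)"
  shows "strip_cont B T (\<lambda>t x. v t (\<phi> t x))"
  using strip_cont_compose[OF assms(1), of "{0..T} \<times> UNIV" fst "\<lambda>(t, x). \<phi> t x"] assms
    continuous_on_fst[OF continuous_on_id, of "{0..T} \<times> (UNIV :: real set)"]
  by (auto simp: strip_cont_def split_beta)

lemma strip_Cn_const: "strip_Cn B T n (\<lambda>t x. c)"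
proof (induction n arbitrary: c)
  case (Suc n)
  show ?case
    by (rule strip_Cn_SucI[where w = "\<lambda>t x. 0"]) (auto simp: strip_cont_const Suc)
qed (simp add: strip_cont_const)

lemma strip_Cn_add:
  "strip_Cn B T n v \<Longrightarrow> strip_Cn B T n w \<Longrightarrow> strip_Cn B T n (\<lambda>t x. v t x + w t x)"
proof (induction n arbitrary: v w)
  case (Suc n)
  note v = strip_Cn_SucE[OF Suc.prems(1)] and w = strip_Cn_SucE[OF Suc.prems(2)]
  show ?case
    by (rule strip_Cn_SucI[where w = "\<lambda>t x. dx v t x + dx w t x"])
      (auto intro!: strip_cont_add Suc.IH v w derivative_eq_intros)
qed (simp add: strip_cont_add)

lemma strip_Cn_mult:
  "strip_Cn B T n v \<Longrightarrow> strip_Cn B T n w \<Longrightarrow> strip_Cn B T n (\<lambda>t x. v t x * w t x)"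
proof (induction n arbitrary: v w)
  case (Suc n)
  note v = strip_Cn_SucE[OF Suc.prems(1)] and w = strip_Cn_SucE[OF Suc.prems(2)]
  show ?case
    by (rule strip_Cn_SucI[where w = "\<lambda>t x. dx v t x * w t x + v t x * dx w t x"])
      (auto intro!: strip_cont_mult strip_Cn_add Suc.IH v w Suc.prems[THEN strip_Cn_SucD] derivative_eq_intros)
qed (simp add: strip_cont_mult)

lemma strip_smooth_const: "strip_smooth B T (\<lambda>t x. c)"
  by (simp add: strip_smooth_def strip_Cn_const)

lemma strip_smooth_add:
  "strip_smooth B T v \<Longrightarrow> strip_smooth B T w \<Longrightarrow> strip_smooth B T (\<lambda>t x. v t x + w t x)"
  by (simp add: strip_smooth_def strip_Cn_add)

lemma strip_smooth_mult:
  "strip_smooth B T v \<Longrightarrow> strip_smooth B T w \<Longrightarrow> strip_smooth B T (\<lambda>t x. v t x * w t x)"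
  by (simp add: strip_smooth_def strip_Cn_mult)

lemma strip_smooth_uminus: "strip_smooth B T v \<Longrightarrow> strip_smooth B T (\<lambda>t x. - v t x)"
  using strip_smooth_mult[OF strip_smooth_const[of B T "-1"], of v] by simp

lemma strip_smooth_diff:
  "strip_smooth B T v \<Longrightarrow> strip_smooth B T w \<Longrightarrow> strip_smooth B T (\<lambda>t x. v t x - w t x)"
  using strip_smooth_add[OF _ strip_smooth_uminus, of B T v w] by simp

lemma strip_smooth_sum:
  "(\<And>i. i \<in> I \<Longrightarrow> strip_smooth B T (v i)) \<Longrightarrow> strip_smooth B T (\<lambda>t x. \<Sum>i\<in>I. v i t x)"
  by (induction I rule: infinite_finite_induct) (auto intro!: strip_smooth_const strip_smooth_add)

lemma strip_smooth_divide_const: "strip_smooth B T v \<Longrightarrow> strip_smooth B T (\<lambda>t x. v t x / c)"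
  using strip_smooth_mult[OF strip_smooth_const[of B T "1/c"], of v] by simp

lemmas strip_smooth_intros =
  strip_smooth_const strip_smooth_add strip_smooth_mult strip_smooth_uminus strip_smooth_diff
  strip_smooth_sum strip_smooth_divide_const strip_smooth_dx strip_smooth_dxn

lemma smooth_deriv: "smooth \<phi> \<Longrightarrow> ((deriv ^^ n) \<phi> has_real_derivative (deriv ^^ Suc n) \<phi> x) (at x)"
  unfolding smooth_def using DERIV_deriv_iff_real_differentiable by auto

lemma smooth_cont: "smooth \<phi> \<Longrightarrow> continuous_on S ((deriv ^^ n) \<phi>)"
  using smooth_deriv by (meson DERIV_isCont continuous_at_imp_continuous_on)

lemma strip_smooth_timefreeI:
  assumes "smooth \<phi>" "\<And>k. B \<Longrightarrow> bounded (range ((deriv ^^ k) \<phi>))"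
  shows "strip_smooth B T (\<lambda>t. \<phi>)"
proof -
  have "strip_cont B T (\<lambda>t. (deriv ^^ k) \<phi>)" for k
    using assms(2)[of k]
    by (auto simp: strip_cont_def split_beta bounded_iff
        intro!: continuous_on_compose2[OF smooth_cont[OF assms(1), of UNIV k]] continuous_intros)
  from strip_smooth_from_derivatives[of B T "\<lambda>k t. (deriv ^^ k) \<phi>" 0, OF this smooth_deriv[OF assms(1)]]
  show ?thesis by simp
qed

lemma strip_smooth_timefree: "smooth \<phi> \<Longrightarrow> strip_smooth False T (\<lambda>t. \<phi>)"
  by (rule strip_smooth_timefreeI) auto

lemma strip_smooth_Binf: "\<phi> \<in> Binf \<Longrightarrow> strip_smooth True T (\<lambda>t. \<phi>)"
  by (rule strip_smooth_timefreeI) (auto simp: Binf_def)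

lemma Binf_iff: "\<phi> \<in> Binf \<longleftrightarrow> strip_smooth True 1 (\<lambda>t. \<phi>)"
proof
  assume *: "strip_smooth True 1 (\<lambda>t. \<phi>)"
  have "bounded (range ((deriv ^^ n) \<phi>))" for n
    using strip_smooth_dxn[OF *, of n, THEN strip_smooth_cont]
    unfolding strip_cont_def bounded_iff funpow_dx by (auto intro: bexI[of _ 0])
  with strip_smooth_smooth[OF *, of 0] show "\<phi> \<in> Binf" by (auto simp: Binf_def)
qed (rule strip_smooth_Binf)

text \<open>
  The hypothesis has one order less for \<open>\<phi>'\<close> than for \<open>v\<close>. This is what lets the smoothness of a solution of
  \<open>\<psi>' = c \<circ> \<psi>\<close> be bootstrapped from the smoothness of \<open>c\<close>.
\<close>

lemma strip_Cn_comp: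
  assumes "\<And>x. (\<phi> has_real_derivative \<phi>' x) (at x)" "strip_Cn B T n (\<lambda>t. \<phi>')" "strip_Cn B T (Suc n) v"
  shows "strip_Cn B T (Suc n) (\<lambda>t x. v t (\<phi> x))"
proof -
  have cont\<phi>: "continuous_on UNIV \<phi>"
    using assms(1) DERIV_isCont continuous_at_imp_continuous_on by blast
  have c: "strip_cont B T (\<lambda>t x. v t (\<phi> x))" if "strip_cont B T v" for v
    using that by (rule strip_cont_comp)
      (auto simp: split_beta intro!: continuous_on_compose2[OF cont\<phi>] continuous_intros)
  have d: "((\<lambda>x. v t (\<phi> x)) has_real_derivative dx v t (\<phi> x) * \<phi>' x) (at x)"
    if "strip_Cn B T (Suc n) v" "t \<in> {0..T}" for t x n v
    using DERIV_chain2[OF strip_Cn_SucE(2)[OF that] assms(1)] .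
  from assms(2,3) show ?thesis
  proof (induction n arbitrary: v)
  case 0
  show ?case
    by (rule strip_Cn_SucI[where w = "\<lambda>t x. dx v t (\<phi> x) * \<phi>' x"])
      (use c d[OF 0(2)] strip_Cn_SucE[OF 0(2)] 0(1) in \<open>auto intro!: strip_cont_mult\<close>)
  next
  case (Suc n)
  show ?case
    by (rule strip_Cn_SucI[where w = "\<lambda>t x. dx v t (\<phi> x) * \<phi>' x"])
      (use c d[OF Suc.prems(2)] strip_Cn_SucE[OF Suc.prems(2)] Suc.prems(1) Suc.IH[of "dx v"] in
       \<open>auto intro!: strip_Cn_mult simp del: strip_Cn.simps dest: strip_Cn_SucD\<close>)
  qed
qed

lemma strip_smooth_comp:
  assumes "\<And>x. (\<phi> has_real_derivative \<phi>' x) (at x)" "strip_smooth B T (\<lambda>t. \<phi>')" "strip_smooth B T v"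
  shows "strip_smooth B T (\<lambda>t x. v t (\<phi> x))"
  using strip_Cn_comp[OF assms(1), of B T] assms(2,3) strip_Cn_SucD unfolding strip_smooth_def by blast

lemma strip_Cn_shift: "strip_Cn B T n v \<Longrightarrow> strip_Cn B T n (\<lambda>t x. v t (x + l * t))"
proof (induction n arbitrary: v)
  case 0 then show ?case unfolding strip_Cn.simps
    by (rule strip_cont_comp) (auto simp: split_beta intro!: continuous_intros)
next
  case (Suc n)
  show ?case
  proof (rule strip_Cn_SucI[where w = "\<lambda>t x. dx v t (x + l * t)"])
    show "strip_cont B T (\<lambda>t x. v t (x + l * t))"
      by (rule strip_cont_comp[OF strip_Cn_SucE(1)[OF Suc.prems]]) (auto simp: split_beta intro!: continuous_intros)
    show "((\<lambda>x. v t (x + l * t)) has_real_derivative dx v t (x + l * t)) (at x)" if "t \<in> {0..T}" for t x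
      using strip_Cn_SucE(2)[OF Suc.prems that] by (simp flip: DERIV_shift)
    show "strip_Cn B T n (\<lambda>t x. dx v t (x + l * t))"
      by (rule Suc.IH[OF strip_Cn_SucE(3)[OF Suc.prems]])
  qed
qed

lemma strip_smooth_shift: "strip_smooth B T v \<Longrightarrow> strip_smooth B T (\<lambda>t x. v t (x + l * t))"
  by (simp add: strip_smooth_def strip_Cn_shift)

lemma dx_shift:
  assumes "strip_smooth B T v" "t \<in> {0..T}"
  shows "dx (\<lambda>t x. v t (x + l * t)) t = (\<lambda>x. dx v t (x + l * t))"
  using strip_smooth_deriv[OF assms] by (intro dx_eqI) (simp flip: DERIV_shift)

lemma dx_cong: "v t = w t \<Longrightarrow> dx v t = dx w t"
  by (simp add: dx_def)

lemma dxn_cong: "v t = w t \<Longrightarrow> (dx ^^ n) v t = (dx ^^ n) w t"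
  by (simp add: funpow_dx)

lemma dxn_shift:
  assumes "strip_smooth B T v" "t \<in> {0..T}"
  shows "(dx ^^ n) (\<lambda>t x. v t (x + l * t)) t = (\<lambda>x. (dx ^^ n) v t (x + l * t))"
proof (induction n)
  case (Suc n)
  have "dx ((dx ^^ n) (\<lambda>t x. v t (x + l * t))) t = dx (\<lambda>t x. (dx ^^ n) v t (x + l * t)) t"
    by (rule dx_cong) (rule Suc)
  also have "\<dots> = (\<lambda>x. dx ((dx ^^ n) v) t (x + l * t))"
    by (rule dx_shift[OF strip_smooth_dxn assms(2)]) (rule assms)
  finally show ?case by simp
qed simp

lemma dxn_add:
  assumes "strip_smooth B T v" "strip_smooth B T w" "t \<in> {0..T}"
  shows "(dx ^^ n) (\<lambda>t x. v t x + w t x) t = (\<lambda>x. (dx ^^ n) v t x + (dx ^^ n) w t x)"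
proof (induction n)
  case (Suc n)
  have "dx ((dx ^^ n) (\<lambda>t x. v t x + w t x)) t = dx (\<lambda>t x. (dx ^^ n) v t x + (dx ^^ n) w t x) t"
    by (rule dx_cong) (rule Suc)
  also have "\<dots> = (\<lambda>x. dx ((dx ^^ n) v) t x + dx ((dx ^^ n) w) t x)"
    by (rule dx_eqI) (intro DERIV_add strip_smooth_deriv[OF strip_smooth_dxn[OF assms(1)] assms(3)] strip_smooth_deriv[OF strip_smooth_dxn[OF assms(2)] assms(3)])
  finally show ?case by simp
qed simp

lemma dxn_cmult:
  assumes "strip_smooth B T v" "t \<in> {0..T}"
  shows "(dx ^^ n) (\<lambda>t x. c * v t x) t = (\<lambda>x. c * (dx ^^ n) v t x)"
proof (induction n)
  case (Suc n)
  have "dx ((dx ^^ n) (\<lambda>t x. c * v t x)) t = dx (\<lambda>t x. c * (dx ^^ n) v t x) t"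
    by (rule dx_cong) (rule Suc)
  also have "\<dots> = (\<lambda>x. c * dx ((dx ^^ n) v) t x)"
    by (rule dx_eqI) (intro DERIV_cmult strip_smooth_deriv[OF strip_smooth_dxn[OF assms(1)] assms(2)])
  finally show ?case by simp
qed simp

lemma dxn_diff:
  assumes "strip_smooth B T v" "strip_smooth B T w" "t \<in> {0..T}"
  shows "(dx ^^ n) (\<lambda>t x. v t x - w t x) t = (\<lambda>x. (dx ^^ n) v t x - (dx ^^ n) w t x)"
  using dxn_add[OF assms(1) strip_smooth_uminus[OF assms(2)] assms(3), of n]
    dxn_cmult[OF assms(2,3), of n "-1"] by simp

lemma dxn_sum:
  assumes "\<And>i. i \<in> I \<Longrightarrow> strip_smooth B T (v i)" "t \<in> {0..T}"
  shows "(dx ^^ n) (\<lambda>t x. \<Sum>i\<in>I. v i t x) t = (\<lambda>x. \<Sum>i\<in>I. (dx ^^ n) (v i) t x)"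
  using assms(1)
proof (induction I rule: infinite_finite_induct)
  case (insert j F)
  then show ?case using dxn_add[of B T "v j" "\<lambda>t x. \<Sum>i\<in>F. v i t x" t n] assms(2)
    by (simp add: strip_smooth_sum)
qed (use dxn_cmult[OF strip_smooth_const[of B T 0] assms(2), of n 0] in simp_all)

text \<open>
  A pointwise form of the Leibniz rule: only the existence of a constant matters, and it comes from
  \<open>(b v)' = b' v + b v'\<close> by induction. Being pointwise, it serves sup-norm and weighted square-integral
  estimates alike.
\<close>

lemma dxn_mult_bound:
  assumes "strip_smooth True T b"
  shows "\<exists>C\<ge>0. \<forall>B v. strip_smooth B T v \<longrightarrow> (\<forall>t\<in>{0..T}. \<forall>x M. (\<forall>j\<le>k. \<bar>(dx ^^ j) v t x\<bar> \<le> M) \<longrightarrow>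
           \<bar>(dx ^^ k) (\<lambda>t x. b t x * v t x) t x\<bar> \<le> C * M)"
  using assms
proof (induction k arbitrary: b)
  case 0
  then obtain N where N: "\<bar>b t x\<bar> \<le> N" if "t \<in> {0..T}" for t x
    using strip_smooth_cont unfolding strip_cont_def by blast
  have "\<bar>b t x * v t x\<bar> \<le> max N 0 * M" if "t \<in> {0..T}" "\<bar>v t x\<bar> \<le> M" for t x v M
    unfolding abs_mult by (rule mult_mono) (use N[of t x] that in auto)
  then show ?case by (intro exI[of _ "max N 0"]) auto
next
  case (Suc k)
  obtain C where C: "C \<ge> 0" "\<And>B v t x M. strip_smooth B T v \<Longrightarrow> t\<in>{0..T} \<Longrightarrow> (\<forall>j\<le>k. \<bar>(dx ^^ j) v t x\<bar> \<le> M) \<Longrightarrow>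
           \<bar>(dx ^^ k) (\<lambda>t x. b t x * v t x) t x\<bar> \<le> C * M"
    using Suc.IH[OF Suc.prems] by blast
  obtain D where D: "D \<ge> 0" "\<And>B v t x M. strip_smooth B T v \<Longrightarrow> t\<in>{0..T} \<Longrightarrow> (\<forall>j\<le>k. \<bar>(dx ^^ j) v t x\<bar> \<le> M) \<Longrightarrow>
           \<bar>(dx ^^ k) (\<lambda>t x. dx b t x * v t x) t x\<bar> \<le> D * M"
    using Suc.IH[OF strip_smooth_dx[OF Suc.prems]] by blast
  show ?case
  proof (intro exI[of _ "C + D"] conjI allI impI ballI)
    fix B v t x M assume v: "strip_smooth B T v" and t: "t \<in> {0..T}"
      and M: "\<forall>j\<le>Suc k. \<bar>(dx ^^ j) v t x\<bar> \<le> M"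
    have v': "strip_smooth False T v" using v by (rule strip_smooth_unbounded)
    have b': "strip_smooth False T b" using Suc.prems by (rule strip_smooth_unbounded)
    have "dx (\<lambda>t x. b t x * v t x) t = (\<lambda>x. dx b t x * v t x + b t x * dx v t x)"
      by (rule dx_eqI) (auto intro!: derivative_eq_intros strip_smooth_deriv[OF v' t] strip_smooth_deriv[OF b' t])
    then have "(dx ^^ Suc k) (\<lambda>t x. b t x * v t x) t
        = (dx ^^ k) (\<lambda>t x. dx b t x * v t x + b t x * dx v t x) t"
      unfolding funpow_Suc_right comp_apply by (rule dxn_cong)
    also have "\<dots> = (\<lambda>x. (dx ^^ k) (\<lambda>t x. dx b t x * v t x) t x + (dx ^^ k) (\<lambda>t x. b t x * dx v t x) t x)"
      by (rule dxn_add[of False T]) (intro strip_smooth_intros v' b' t)+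
    finally have eq: "(dx ^^ Suc k) (\<lambda>t x. b t x * v t x) t x
      = (dx ^^ k) (\<lambda>t x. dx b t x * v t x) t x + (dx ^^ k) (\<lambda>t x. b t x * dx v t x) t x" by simp
    have 1: "\<bar>(dx ^^ k) (\<lambda>t x. dx b t x * v t x) t x\<bar> \<le> D * M"
      using D(2)[OF v t, of x M] M by auto
    have "\<forall>j\<le>k. \<bar>(dx ^^ j) (dx v) t x\<bar> \<le> M"
      using M by (metis Suc_le_mono comp_apply funpow_Suc_right)
    then have "\<bar>(dx ^^ k) (\<lambda>t x. b t x * dx v t x) t x\<bar> \<le> C * M"
      by (rule C(2)[OF strip_smooth_dx[OF v] t])
    with 1 show "\<bar>(dx ^^ Suc k) (\<lambda>t x. b t x * v t x) t x\<bar> \<le> (C + D) * M"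
      unfolding eq by (simp add: ring_distribs)
  qed (use C D in simp)
qed

section \<open>Time derivatives and time integrals\<close>

definition tint :: "(real \<Rightarrow> real \<Rightarrow> real) \<Rightarrow> real \<Rightarrow> real \<Rightarrow> real" where
  "tint v t x = integral {0..t} (\<lambda>s. v s x)"

lemma tint_has_dt:
  assumes "strip_cont B T v"
  shows "has_dt T (tint v) v"
  unfolding has_dt_def tint_def
  by (auto intro!: integral_has_real_derivative strip_cont_time[OF assms])

text \<open>
  After rescaling, the domain of integration no longer depends on \<open>t\<close>, so continuity in \<open>(t, x)\<close> jointly follows from
  the theorem on parametric integrals.
\<close>

lemma tint_rescale:
  assumes "strip_cont B T v" "t \<in> {0..T}"
  shows "tint v t x = integral {0..1} (\<lambda>\<sigma>. t * v (t * \<sigma>) x)"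
proof -
  have d: "((\<lambda>r. tint v r x) has_real_derivative v s x) (at s within {0..T})" if "s \<in> {0..T}" for s
    using tint_has_dt[OF assms(1)] that unfolding has_dt_def by blast
  have "((\<lambda>\<sigma>. tint v (t * \<sigma>) x) has_vector_derivative (t * v (t * \<sigma>) x)) (at \<sigma> within {0..1})"
    if "\<sigma> \<in> {0..1}" for \<sigma>
  proof -
    have sub: "(\<lambda>\<sigma>. t * \<sigma>) ` {0..1} \<subseteq> {0..T}" using assms(2)
      by (auto intro: order_trans[OF mult_left_le])
    then have "((\<lambda>r. tint v r x) has_real_derivative v (t * \<sigma>) x) (at (t * \<sigma>) within (\<lambda>\<sigma>. t * \<sigma>) ` {0..1})"
      using d[of "t * \<sigma>"] that by (meson DERIV_subset imageI subsetD)
    from DERIV_image_chain[OF this DERIV_cmult_Id] show ?thesis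
      by (simp add: o_def has_real_derivative_iff_has_vector_derivative[symmetric] mult.commute)
  qed
  from fundamental_theorem_of_calculus[OF _ this]
  have "((\<lambda>\<sigma>. t * v (t * \<sigma>) x) has_integral tint v t x - tint v 0 x) {0..1}" by simp
  from integral_unique[OF this] show ?thesis by (simp add: tint_def)
qed

lemma tint_bound:
  assumes "strip_cont B T v" "t \<in> {0..T}" "\<And>s. s \<in> {0..t} \<Longrightarrow> \<bar>v s x\<bar> \<le> g s"
    and "(g has_integral I) {0..t}"
  shows "\<bar>tint v t x\<bar> \<le> I"
proof -
  have "norm (integral {0..t} (\<lambda>s. v s x)) \<le> integral {0..t} g"
    by (rule integral_norm_bound_integral)
      (use assms strip_cont_time[OF assms(1), of "{0..t}"] in \<open>auto intro: integrable_continuous_interval has_integral_integrable\<close>)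
  then show ?thesis using integral_unique[OF assms(4)] by (simp add: tint_def)
qed

lemma tint_cont:
  assumes "strip_cont B T v"
  shows "strip_cont B T (tint v)"
proof -
  have "continuous_on ({0..T} \<times> UNIV) (\<lambda>p. integral (cbox 0 1) (\<lambda>\<sigma>. fst p * v (fst p * \<sigma>) (snd p)))"
  proof (rule integral_continuous_on_param, unfold split_beta)
    have "continuous_on (({0..T} \<times> UNIV) \<times> cbox 0 1) (\<lambda>q. v (fst (fst q) * snd q) (snd (fst q)))"
      by (rule strip_cont_compose[OF assms])
        (auto intro!: continuous_intros intro: order_trans[OF mult_left_le])
    then show "continuous_on (({0..T} \<times> UNIV) \<times> cbox 0 1) (\<lambda>q. fst (fst q) * v (fst (fst q) * snd q) (snd (fst q)))"
      by (intro continuous_intros)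
  qed
  then have c: "continuous_on ({0..T} \<times> UNIV) (\<lambda>(t, x). tint v t x)"
    by (rule continuous_on_eq) (auto simp: tint_rescale[OF assms])
  have "\<exists>M. \<forall>t\<in>{0..T}. \<forall>x. \<bar>tint v t x\<bar> \<le> M" if B: B
  proof -
    obtain M where M: "\<forall>t\<in>{0..T}. \<forall>x. \<bar>v t x\<bar> \<le> M"
      using assms B unfolding strip_cont_def by blast
    have "\<bar>tint v t x\<bar> \<le> M * T" if t: "t \<in> {0..T}" for t x
    proof -
      have "M \<ge> 0" using M t abs_ge_zero order_trans by blast
      have "\<bar>tint v t x\<bar> \<le> M * t"
        by (rule tint_bound[OF assms t]) (use M t has_integral_const_real[of M 0 t] in \<open>auto simp: mult.commute\<close>)
      also have "\<dots> \<le> M * T" using t \<open>M \<ge> 0\<close> by (intro mult_left_mono) auto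
      finally show ?thesis .
    qed
    then show ?thesis by blast
  qed
  with c show ?thesis by (simp add: strip_cont_def)
qed

lemma tint_deriv:
  assumes "strip_Cn B T (Suc 0) v" "t \<in> {0..T}"
  shows "(tint v t has_real_derivative tint (dx v) t x) (at x)"
proof -
  note v = strip_Cn_SucE[OF assms(1)]
  have "((\<lambda>x. integral (cbox 0 t) ((\<lambda>x s. v s x) x)) has_real_derivative
          integral (cbox 0 t) ((\<lambda>x s. dx v s x) x)) (at x within UNIV)"
  proof (rule leibniz_rule_field_derivative)
    show "((\<lambda>x. v s x) has_real_derivative dx v s y) (at y within UNIV)" if "s \<in> cbox 0 t" for y s
      using v(2) that assms(2) by auto
    show "(\<lambda>s. v s y) integrable_on cbox 0 t" for y
      using strip_cont_time[OF v(1)] assms(2) by (auto intro!: integrable_continuous_interval)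
    show "continuous_on (UNIV \<times> cbox 0 t) (\<lambda>(x, s). dx v s x)"
      unfolding split_beta
      by (rule strip_cont_compose[of B T]) (use v(3) assms(2) in \<open>auto intro!: continuous_intros\<close>)
  qed auto
  then show ?thesis by (simp add: tint_def[abs_def])
qed

lemma tint_Cn: "strip_Cn B T n v \<Longrightarrow> strip_Cn B T n (tint v)"
proof (induction n arbitrary: v)
  case (Suc n)
  have "strip_Cn B T (Suc 0) v"
    using Suc.prems by (auto intro: strip_Cn_imp_cont)
  then show ?case
    by (intro strip_Cn_SucI[OF _ tint_deriv] Suc.IH) (use strip_Cn_SucE[OF Suc.prems] tint_cont in auto)
qed (simp add: tint_cont)

lemma tint_smooth: "strip_smooth B T v \<Longrightarrow> strip_smooth B T (tint v)"
  by (simp add: strip_smooth_def tint_Cn)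

lemma dxn_tint:
  assumes "strip_smooth B T v" "t \<in> {0..T}"
  shows "(dx ^^ n) (tint v) t = tint ((dx ^^ n) v) t"
proof (induction n)
  case (Suc n)
  have "dx ((dx ^^ n) (tint v)) t = dx (tint ((dx ^^ n) v)) t"
    by (rule dx_cong) (rule Suc)
  also have "\<dots> = tint (dx ((dx ^^ n) v)) t"
    by (rule dx_eqI, rule tint_deriv[of B T, OF _ assms(2)])
      (use strip_smooth_dxn[OF assms(1), of n] in \<open>simp add: strip_smooth_def del: strip_Cn.simps\<close>)
  finally show ?case by simp
qed simp

lemma has_dt_unique:
  assumes "has_dt T v w" "has_dt T v' w" "\<And>x. v 0 x = v' 0 x" "t \<in> {0..T}"
  shows "v t x = v' t x"
proof -
  have "\<exists>c. \<forall>t\<in>{0..T}. v t x - v' t x = c"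
  proof (rule has_field_derivative_zero_constant)
    show "((\<lambda>t. v t x - v' t x) has_real_derivative 0) (at s within {0..T})" if "s \<in> {0..T}" for s
      using DERIV_diff[of "\<lambda>s. v s x" "w s x" s "{0..T}" "\<lambda>s. v' s x" "w s x"] assms(1,2) that
      by (auto simp: has_dt_def)
  qed simp
  then obtain c where "\<forall>t\<in>{0..T}. v t x - v' t x = c" by blast
  moreover from this assms(3)[of x] assms(4) have "c = 0" by force
  ultimately show ?thesis using assms(4) by force
qed

lemma has_dt_integral:
  assumes "has_dt T v w" "strip_cont B T w" "t \<in> {0..T}"
  shows "v t x = v 0 x + tint w t x"
proof -
  have "has_dt T (\<lambda>t x. v 0 x + tint w t x) w"
    using tint_has_dt[OF assms(2)] by (auto simp: has_dt_def intro!: derivative_eq_intros)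
  from has_dt_unique[OF assms(1) this _ assms(3)] show ?thesis
    by (simp add: tint_def)
qed

lemma has_dt_cong:
  assumes "\<And>t. t \<in> {0..T} \<Longrightarrow> v t = v' t" "\<And>t. t \<in> {0..T} \<Longrightarrow> w t = w' t"
  shows "has_dt T v w \<longleftrightarrow> has_dt T v' w'"
proof -
  have *: "has_dt T v' w'" if "has_dt T v w" "\<And>t. t \<in> {0..T} \<Longrightarrow> v t = v' t" "\<And>t. t \<in> {0..T} \<Longrightarrow> w t = w' t"
    for v v' w w'
    unfolding has_dt_def
  proof (intro ballI allI)
    fix t x assume t: "t \<in> {0..T}"
    show "((\<lambda>s. v' s x) has_real_derivative w' t x) (at t within {0..T})"
      by (rule has_field_derivative_transform_within[of "\<lambda>s. v s x" _ _ _ 1])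
        (use that t in \<open>auto simp: has_dt_def\<close>)
  qed
  show ?thesis using *[of v w v' w'] *[of v' w' v w] assms by metis
qed

text \<open>
  Time and space derivatives commute. Writing \<open>v\<close> as its initial value plus the time integral of \<open>w\<close>
  reduces this to differentiation under the integral sign.
\<close>

lemma has_dt_dx:
  assumes "has_dt T v w" "strip_smooth B T v" "strip_smooth B T w"
  shows "has_dt T (dx v) (dx w)"
proof (cases "0 \<le> T")
  case True
  have *: "dx v t = (\<lambda>x. dx v 0 x + tint (dx w) t x)" if t: "t \<in> {0..T}" for t
  proof -
    have eq: "v t = (\<lambda>x. v 0 x + tint w t x)"
      using has_dt_integral[OF assms(1) strip_smooth_cont[OF assms(3)] t] by blast
    have "dx v t = dx (\<lambda>t x. v 0 x + tint w t x) t"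
      by (rule dx_cong) (rule eq)
    also have "\<dots> = (\<lambda>x. dx v 0 x + tint (dx w) t x)"
    proof (rule dx_eqI, rule DERIV_add)
      show "(v 0 has_real_derivative dx v 0 x) (at x)" for x
        using strip_smooth_deriv[OF assms(2)] True by simp
      have "strip_Cn B T (Suc 0) w" using assms(3) by (simp add: strip_smooth_def del: strip_Cn.simps)
      from tint_deriv[OF this t] show "(tint w t has_real_derivative tint (dx w) t x) (at x)" for x .
    qed
    finally show ?thesis .
  qed
  have "has_dt T (\<lambda>t x. dx v 0 x + tint (dx w) t x) (dx w)"
    using tint_has_dt[OF strip_smooth_cont[OF strip_smooth_dx[OF assms(3)]]]
    by (auto simp: has_dt_def intro!: derivative_eq_intros)
  moreover have "has_dt T (dx v) (dx w) = has_dt T (\<lambda>t x. dx v 0 x + tint (dx w) t x) (dx w)"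
    by (rule has_dt_cong) (use * in blast)+
  ultimately show ?thesis by blast
qed (simp add: has_dt_def)

lemma has_dt_dxn:
  assumes "has_dt T v w" "strip_smooth B T v" "strip_smooth B T w"
  shows "has_dt T ((dx ^^ n) v) ((dx ^^ n) w)"
  by (induction n) (auto intro: has_dt_dx strip_smooth_dxn assms)

lemma has_dt_add: "has_dt T v w \<Longrightarrow> has_dt T v' w' \<Longrightarrow> has_dt T (\<lambda>t x. v t x + v' t x) (\<lambda>t x. w t x + w' t x)"
  by (auto simp: has_dt_def intro!: derivative_intros)

lemma has_dt_diff: "has_dt T v w \<Longrightarrow> has_dt T v' w' \<Longrightarrow> has_dt T (\<lambda>t x. v t x - v' t x) (\<lambda>t x. w t x - w' t x)"
  by (auto simp: has_dt_def intro!: derivative_intros)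

lemma has_dt_divide: "has_dt T v w \<Longrightarrow> has_dt T (\<lambda>t x. v t x / c) (\<lambda>t x. w t x / c)"
  by (auto simp: has_dt_def intro!: DERIV_cdivide)

lemma has_dt_timefree: "has_dt T (\<lambda>t. \<phi>) (\<lambda>t x. 0)"
  by (simp add: has_dt_def)

lemma has_dt_comp: "has_dt T v w \<Longrightarrow> has_dt T (\<lambda>t x. v t (\<phi> x)) (\<lambda>t x. w t (\<phi> x))"
  by (simp add: has_dt_def)

text \<open>
  The total derivative along the line \<open>x + l t\<close>; the equation \<open>v_t = l v_x + G\<close> is integrated in this moving frame.
\<close>

lemma has_dt_shift:
  assumes v: "has_dt T v w" "strip_smooth B T v" "strip_smooth B T w"
  shows "has_dt T (\<lambda>t x. v t (x + l * t)) (\<lambda>t x. w t (x + l * t) + l * dx v t (x + l * t))"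
  unfolding has_dt_def
proof (intro ballI allI)
  fix t x assume t: "t \<in> {0..T}"
  have "((\<lambda>(s, y). v s y) has_derivative (\<lambda>(h, k). (*) (w t (x + l * t)) h + blinfun_mult_right (dx v t (x + l * t)) k))
     (at (t, x + l * t) within {0..T} \<times> UNIV)"
  proof (rule has_derivative_partialsI[where fy = "\<lambda>t x. blinfun_mult_right (dx v t x)"])
    show "((\<lambda>s. v s (x + l * t)) has_derivative (*) (w t (x + l * t))) (at t within {0..T})"
      using v(1) t by (simp add: has_dt_def has_field_derivative_def)
    show "((\<lambda>y. v s y) has_derivative blinfun_apply (blinfun_mult_right (dx v s y))) (at y within UNIV)"
      if "s \<in> {0..T}" for s y
      using strip_smooth_deriv[OF v(2) that, of y] by (simp add: has_field_derivative_def)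
    have "continuous_on ({0..T} \<times> UNIV) (\<lambda>(s, y). blinfun_mult_right (dx v s y))"
      using strip_cont_continuous[OF strip_smooth_cont[OF strip_smooth_dx[OF v(2)]]]
      unfolding split_beta by (rule bounded_linear.continuous_on[OF bounded_linear_blinfun_mult_right])
    then show "continuous (at (t, x + l * t) within {0..T} \<times> UNIV) (\<lambda>(s, y). blinfun_mult_right (dx v s y))"
      using t unfolding continuous_on_eq_continuous_within by blast
  qed auto
  then have D: "((\<lambda>(s, y). v s y) has_derivative (\<lambda>(h, k). w t (x + l * t) * h + dx v t (x + l * t) * k))
     (at (t, x + l * t) within {0..T} \<times> UNIV)" by simp
  have g: "((\<lambda>s. (s, x + l * s)) has_derivative (\<lambda>h. (h, l * h))) (at t within {0..T})"
    by (auto intro!: derivative_eq_intros)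
  have "((\<lambda>s. (\<lambda>(s, y). v s y) (s, x + l * s)) has_derivative
      (\<lambda>h. (\<lambda>(h, k). w t (x + l * t) * h + dx v t (x + l * t) * k) (h, l * h))) (at t within {0..T})"
    by (rule has_derivative_in_compose[OF g], rule has_derivative_subset[OF D]) auto
  moreover have "(\<lambda>h. (\<lambda>(h, k). w t (x + l * t) * h + dx v t (x + l * t) * k) (h, l * h)) =
      (*) (w t (x + l * t) + l * dx v t (x + l * t))"
    by (auto simp: algebra_simps)
  ultimately show "((\<lambda>s. v s (x + l * s)) has_real_derivative w t (x + l * t) + l * dx v t (x + l * t)) (at t within {0..T})"
    unfolding has_field_derivative_def by (simp only: split_conv)
qed

section \<open>Locally uniform limits with all space derivatives\<close>

lemma real_deriv_limit:
  fixes f :: "nat \<Rightarrow> real \<Rightarrow> real"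
  assumes "convex S"
    and f': "\<And>n x. x \<in> S \<Longrightarrow> (f n has_real_derivative f' n x) (at x within S)"
    and lim': "uniform_limit S f' g' sequentially"
    and lim: "\<And>x. x \<in> S \<Longrightarrow> (\<lambda>n. f n x) \<longlonglongrightarrow> g x"
    and x: "x \<in> S"
  shows "(g has_real_derivative g' x) (at x within S)"
proof -
  have "\<exists>h. \<forall>x\<in>S. (\<lambda>n. f n x) \<longlonglongrightarrow> h x \<and> (h has_derivative (*) (g' x)) (at x within S)"
  proof (rule has_derivative_sequence[OF \<open>convex S\<close>, where f' = "\<lambda>n x. (*) (f' n x)"])
    show "(f n has_derivative (*) (f' n x)) (at x within S)" if "x \<in> S" for n x
      using f'[OF that] by (simp add: has_field_derivative_def)
    show "\<forall>\<^sub>F n in sequentially. \<forall>x\<in>S. \<forall>h. norm (f' n x * h - g' x * h) \<le> e * norm h" if "e > 0" for e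
      using uniform_limitD[OF lim' that]
      by (rule eventually_mono)
        (auto simp: dist_norm simp flip: left_diff_distrib simp: abs_mult intro!: mult_right_mono intro: less_imp_le)
    show "x \<in> S" "(\<lambda>n. f n x) \<longlonglongrightarrow> g x" using x lim by auto
  qed
  then obtain h where h: "\<And>x. x \<in> S \<Longrightarrow> (\<lambda>n. f n x) \<longlonglongrightarrow> h x"
    "\<And>x. x \<in> S \<Longrightarrow> (h has_derivative (*) (g' x)) (at x within S)" by blast
  have "h y = g y" if "y \<in> S" for y
    using LIMSEQ_unique[OF h(1)[OF that] lim[OF that]] .
  then have "(g has_derivative (*) (g' x)) (at x within S)"
    using has_derivative_transform[OF x _ h(2)[OF x]] by metis
  then show ?thesis by (simp add: has_field_derivative_def)
qed

lemma uniform_limit_slice: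
  assumes "uniform_limit (A \<times> B) (\<lambda>m (t, x). f m t x) (\<lambda>(t, x). g t x) F" "t \<in> A" "S \<subseteq> B"
  shows "uniform_limit S (\<lambda>m. f m t) (g t) F"
  unfolding uniform_limit_iff
proof (intro allI impI)
  fix e :: real assume "e > 0"
  from uniform_limitD[OF assms(1) this] show "\<forall>\<^sub>F m in F. \<forall>x\<in>S. dist (f m t x) (g t x) < e"
    by (rule eventually_mono) (use assms(2,3) in auto)
qed

lemma continuous_on_strip_exhaust:
  fixes f :: "real \<times> real \<Rightarrow> real"
  assumes "\<And>R. continuous_on ({0..T} \<times> {-R..R}) f"
  shows "continuous_on ({0..T} \<times> UNIV) f"
  unfolding continuous_on_eq_continuous_within
proof
  fix p assume p: "p \<in> {0..T} \<times> (UNIV :: real set)"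
  define R where "R = \<bar>snd p\<bar> + 1"
  have eq: "at p within {0..T} \<times> UNIV = at p within {0..T} \<times> {-R..R}"
    by (rule at_within_nhd[where S = "UNIV \<times> {-R<..<R}"])
      (auto simp: R_def mem_Times_iff open_Times)
  have "p \<in> {0..T} \<times> {-R..R}" using p by (auto simp: R_def)
  with assms[of R] have "continuous (at p within {0..T} \<times> {-R..R}) f"
    unfolding continuous_on_eq_continuous_within by blast
  then show "continuous (at p within {0..T} \<times> UNIV) f"
    by (simp add: continuous_within eq)
qed

text \<open>
  Convergence of all space derivatives, uniformly on the compact pieces \<open>[0,T] \<times> [-R,R]\<close> of the strip.
\<close>

definition strip_lim :: "real \<Rightarrow> (nat \<Rightarrow> real \<Rightarrow> real \<Rightarrow> real) \<Rightarrow> (real \<Rightarrow> real \<Rightarrow> real) \<Rightarrow> bool" where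
  "strip_lim T V v \<longleftrightarrow> (\<forall>k R. uniform_limit ({0..T} \<times> {-R..R})
      (\<lambda>m (t, x). (dx ^^ k) (V m) t x) (\<lambda>(t, x). (dx ^^ k) v t x) sequentially)"

lemma strip_lim_pointwise:
  assumes "strip_lim T V v" "t \<in> {0..T}"
  shows "(\<lambda>m. (dx ^^ k) (V m) t x) \<longlonglongrightarrow> (dx ^^ k) v t x"
proof -
  have "uniform_limit ({0..T} \<times> {-\<bar>x\<bar>..\<bar>x\<bar>})
      (\<lambda>m (t, x). (dx ^^ k) (V m) t x) (\<lambda>(t, x). (dx ^^ k) v t x) sequentially"
    using assms(1) by (auto simp: strip_lim_def)
  moreover have "(t, x) \<in> {0..T} \<times> {-\<bar>x\<bar>..\<bar>x\<bar>}"
    using assms(2) abs_ge_self[of x] abs_ge_minus_self[of x] by (simp add: minus_le_iff)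
  ultimately have "(\<lambda>m. (\<lambda>(t, x). (dx ^^ k) (V m) t x) (t, x)) \<longlonglongrightarrow> (\<lambda>(t, x). (dx ^^ k) v t x) (t, x)"
    by (rule tendsto_uniform_limitI)
  then show ?thesis by simp
qed

lemma strip_lim_has_dt:
  assumes "strip_lim T V v"
    and W: "\<And>R. uniform_limit ({0..T} \<times> {-R..R}) (\<lambda>m (t, x). W m t x) (\<lambda>(t, x). w t x) sequentially"
    and V: "\<And>m. has_dt T (V m) (W m)"
  shows "has_dt T v w"
  unfolding has_dt_def
proof (intro ballI allI)
  fix t x assume t: "t \<in> {0..T}"
  show "((\<lambda>s. v s x) has_real_derivative w t x) (at t within {0..T})"
  proof (rule real_deriv_limit[where f = "\<lambda>m s. V m s x" and f' = "\<lambda>m s. W m s x"])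
    show "uniform_limit {0..T} (\<lambda>m s. W m s x) (\<lambda>s. w s x) sequentially"
      unfolding uniform_limit_iff
    proof (intro allI impI)
      fix e :: real assume "e > 0"
      from uniform_limitD[OF W[of "\<bar>x\<bar>"] this]
      show "\<forall>\<^sub>F m in sequentially. \<forall>s\<in>{0..T}. dist (W m s x) (w s x) < e"
        by (rule eventually_mono) (use abs_ge_self[of x] abs_ge_minus_self[of x] in \<open>auto simp: minus_le_iff\<close>)
    qed
    show "(\<lambda>m. V m s x) \<longlonglongrightarrow> v s x" if "s \<in> {0..T}" for s
      using strip_lim_pointwise[OF assms(1) that, of 0 x] by simp
    show "((\<lambda>s. V m s x) has_real_derivative W m s x) (at s within {0..T})" if "s \<in> {0..T}" for m s
      using V that by (auto simp: has_dt_def)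
  qed (use t in auto)
qed

lemma strip_lim_exists:
  assumes V: "\<And>m. strip_smooth False T (V m)"
    and C: "\<And>k R. uniformly_Cauchy_on ({0..T} \<times> {-R..R}) (\<lambda>m (t, x). (dx ^^ k) (V m) t x)"
  shows "\<exists>v. strip_smooth False T v \<and> strip_lim T V v"
proof -
  define g where "g k t x = lim (\<lambda>m. (dx ^^ k) (V m) t x)" for k t x
  have lim: "uniform_limit ({0..T} \<times> {-R..R}) (\<lambda>m (t, x). (dx ^^ k) (V m) t x) (\<lambda>(t, x). g k t x) sequentially" for k R
    using C[where R = R and k = k] unfolding uniformly_convergent_eq_Cauchy[symmetric] uniformly_convergent_uniform_limit_iff
    unfolding g_def split_beta .
  have lim_pt: "(\<lambda>m. (dx ^^ k) (V m) t x) \<longlonglongrightarrow> g k t x" if "t \<in> {0..T}" for k t x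
  proof -
    have "(t, x) \<in> {0..T} \<times> {-\<bar>x\<bar>..\<bar>x\<bar>}"
      using that abs_ge_self[of x] abs_ge_minus_self[of x] by (simp add: minus_le_iff)
    from tendsto_uniform_limitI[OF lim this] show ?thesis by simp
  qed
  have cont: "strip_cont False T (g k)" for k
    unfolding strip_cont_def
  proof (intro conjI continuous_on_strip_exhaust)
    show "continuous_on ({0..T} \<times> {-R..R}) (\<lambda>(t, x). g k t x)" for R
    proof (rule uniform_limit_theorem[OF _ lim])
      show "\<forall>\<^sub>F m in sequentially. continuous_on ({0..T} \<times> {-R..R}) (\<lambda>(t, x). (dx ^^ k) (V m) t x)"
        using strip_cont_continuous[OF strip_smooth_cont[OF strip_smooth_dxn[OF V]]]
        by (intro always_eventually allI) (auto intro: continuous_on_subset)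
    qed simp
  qed simp
  have deriv: "(g k t has_real_derivative g (Suc k) t x) (at x)" if t: "t \<in> {0..T}" for k t x
  proof -
    define S where "S = {-(\<bar>x\<bar> + 1)<..<\<bar>x\<bar> + 1}"
    have x: "x \<in> S" "open S" "convex S" by (auto simp: S_def)
    have "(g k t has_real_derivative g (Suc k) t x) (at x within S)"
    proof (rule real_deriv_limit[OF x(3), where f = "\<lambda>m. (dx ^^ k) (V m) t" and f' = "\<lambda>m. (dx ^^ Suc k) (V m) t"])
      show "((dx ^^ k) (V m) t has_real_derivative (dx ^^ Suc k) (V m) t y) (at y within S)" for m y
        using strip_smooth_deriv[OF strip_smooth_dxn[OF V] t, of k m y] has_field_derivative_at_within by simp
      show "uniform_limit S (\<lambda>m. (dx ^^ Suc k) (V m) t) (g (Suc k) t) sequentially"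
        by (rule uniform_limit_slice[OF lim[where R = "\<bar>x\<bar> + 1" and k = "Suc k"] t]) (auto simp: S_def)
      show "(\<lambda>m. (dx ^^ k) (V m) t y) \<longlonglongrightarrow> g k t y" for y by (rule lim_pt[OF t])
      show "x \<in> S" by (rule x(1))
    qed
    then show ?thesis by (simp only: at_within_open[OF x(1,2)])
  qed
  have smooth: "strip_smooth False T (g k)" for k
    by (rule strip_smooth_from_derivatives[where g = g, OF cont deriv])
  have eq: "(dx ^^ k) (g 0) t = g k t" if t: "t \<in> {0..T}" for k t
  proof (induction k)
    case (Suc k)
    have "dx ((dx ^^ k) (g 0)) t = dx (g k) t" by (rule dx_cong) (rule Suc)
    also have "\<dots> = g (Suc k) t" by (rule dx_eqI) (rule deriv[OF t])
    finally show ?case by simp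
  qed simp
  have "strip_lim T V (g 0)"
    unfolding strip_lim_def
  proof (intro allI)
    fix k R
    show "uniform_limit ({0..T} \<times> {-R..R}) (\<lambda>m (t, x). (dx ^^ k) (V m) t x) (\<lambda>(t, x). (dx ^^ k) (g 0) t x) sequentially"
      by (rule uniform_limit_cong'[THEN iffD1, OF _ _ lim[where R = R and k = k]]) (auto simp: eq)
  qed
  with smooth show ?thesis by blast
qed

section \<open>Differentiable curves in the space of smooth functions\<close>

lemma has_dt_imp_dt:
  assumes "T > 0" "has_dt T v w" "t \<in> {0..T}"
  shows "dt T v t = w t"
proof
  fix x
  have "((\<lambda>s. v s x) has_vector_derivative w t x) (at t within {0..T})"
    using assms(2,3) by (simp add: has_dt_def has_real_derivative_iff_has_vector_derivative)
  then show "dt T v t x = w t x"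
    unfolding dt_def by (rule vector_derivative_within_closed_interval[OF assms(1,3)])
qed

lemma dt_cong:
  assumes "\<And>t. t \<in> {0..T} \<Longrightarrow> v t = w t" "t \<in> {0..T}"
  shows "dt T v t = dt T w t"
proof
  fix x
  have "((\<lambda>s. v s x) has_vector_derivative D) (at t within {0..T}) \<longleftrightarrow>
        ((\<lambda>s. w s x) has_vector_derivative D) (at t within {0..T})" for D
    by (rule has_vector_derivative_cong_ev) 
      (use assms in \<open>auto intro!: always_eventually\<close>)
  then show "dt T v t x = dt T w t x"
    by (simp add: dt_def vector_derivative_def)
qed

lemma Cinf_tendsto_cong:
  assumes "\<forall>\<^sub>F s in F. v s = w s"
  shows "Cinf_tendsto v \<phi> F \<longleftrightarrow> Cinf_tendsto w \<phi> F"
proof -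
  have "uniform_limit K (\<lambda>s. (deriv ^^ n) (v s)) l F \<longleftrightarrow> uniform_limit K (\<lambda>s. (deriv ^^ n) (w s)) l F" for K n l
    by (rule uniform_limit_cong) (use assms in \<open>auto elim: eventually_mono\<close>)
  then show ?thesis by (simp add: Cinf_tendsto_def)
qed

lemma eventually_in_within: "\<forall>\<^sub>F s in at t within S. s \<in> S"
  by (simp add: eventually_at_filter)

lemma Ck_Cinf_cong:
  assumes "\<And>t. t \<in> {0..T} \<Longrightarrow> v t = w t"
  shows "Ck_Cinf T k v \<longleftrightarrow> Ck_Cinf T k w"
  using assms
proof (induction k arbitrary: v w)
  case 0
  have "Cinf_tendsto v (v t) (at t within {0..T}) \<longleftrightarrow> Cinf_tendsto w (v t) (at t within {0..T})" for t
    by (rule Cinf_tendsto_cong) (rule eventually_mono[OF eventually_in_within], use 0 in auto)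
  then show ?case unfolding Ck_Cinf.simps using 0 by metis
next
  case (Suc k)
  have dt: "dt T v t = dt T w t" if "t \<in> {0..T}" for t
    using dt_cong[OF Suc.prems that] .
  have "Cinf_tendsto (\<lambda>s x. (v s x - v t x) / (s - t)) (dt T v t) (at t within {0..T}) \<longleftrightarrow>
        Cinf_tendsto (\<lambda>s x. (w s x - w t x) / (s - t)) (dt T w t) (at t within {0..T})"
    if t: "t \<in> {0..T}" for t
    unfolding dt[OF t] Suc.prems[OF t]
    by (rule Cinf_tendsto_cong) (rule eventually_mono[OF eventually_in_within], use Suc.prems in auto)
  then have "(\<forall>t\<in>{0..T}. smooth (v t) \<and>
        Cinf_tendsto (\<lambda>s x. (v s x - v t x) / (s - t)) (dt T v t) (at t within {0..T})) \<longleftrightarrow>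
      (\<forall>t\<in>{0..T}. smooth (w t) \<and>
        Cinf_tendsto (\<lambda>s x. (w s x - w t x) / (s - t)) (dt T w t) (at t within {0..T}))"
    using Suc.prems by (intro ball_cong) auto
  moreover have "Ck_Cinf T k (dt T v) = Ck_Cinf T k (dt T w)"
    by (rule Suc.IH) (rule dt)
  ultimately show ?case unfolding Ck_Cinf.simps by blast
qed

lemma strip_uniform_time:
  assumes "strip_cont B T v" "compact K" "t \<in> {0..T}" "e > 0"
  shows "\<exists>d>0. \<forall>s\<in>{0..T}. \<bar>s - t\<bar> < d \<longrightarrow> (\<forall>x\<in>K. \<bar>v s x - v t x\<bar> < e)"
proof -
  have "continuous_on ({0..T} \<times> K) (\<lambda>(t, x). v t x)"
    using strip_cont_continuous[OF assms(1)] by (rule continuous_on_subset) auto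
  then have "uniformly_continuous_on ({0..T} \<times> K) (\<lambda>(t, x). v t x)"
    by (rule compact_uniformly_continuous) (intro compact_Times assms(2) compact_Icc)
  from this[unfolded uniformly_continuous_on_def, rule_format, OF \<open>e > 0\<close>]
  obtain d where d: "d > 0" "\<forall>p\<in>{0..T} \<times> K. \<forall>q\<in>{0..T} \<times> K. dist q p < d \<longrightarrow>
      dist (case q of (t, x) \<Rightarrow> v t x) (case p of (t, x) \<Rightarrow> v t x) < e" by blast
  have "\<bar>v s x - v t x\<bar> < e" if "s \<in> {0..T}" "\<bar>s - t\<bar> < d" "x \<in> K" for s x
    using d(2)[THEN bspec, of "(t, x)", THEN bspec, of "(s, x)"] that assms(3)
    by (simp add: dist_Pair_Pair dist_real_def)
  with d(1) show ?thesis by blast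
qed

lemma strip_smooth_imp_Ck0:
  assumes "strip_smooth B T v"
  shows "Ck_Cinf T 0 v"
  unfolding Ck_Cinf.simps
proof (intro ballI conjI)
  fix t assume t: "t \<in> {0..T}"
  show "smooth (v t)" using strip_smooth_smooth[OF assms t] .
  show "Cinf_tendsto v (v t) (at t within {0..T})"
    unfolding Cinf_tendsto_def
  proof (intro allI impI uniform_limitI)
    fix n and K :: "real set" and e :: real assume "compact K" "e > 0"
    from strip_uniform_time[OF strip_smooth_cont[OF strip_smooth_dxn[OF assms]] this(1) t this(2), of n]
    obtain d where "d > 0" "\<forall>s\<in>{0..T}. \<bar>s - t\<bar> < d \<longrightarrow> (\<forall>x\<in>K. \<bar>(dx ^^ n) v s x - (dx ^^ n) v t x\<bar> < e)"
      by blast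
    then show "\<forall>\<^sub>F s in at t within {0..T}. \<forall>x\<in>K. dist ((deriv ^^ n) (v s) x) ((deriv ^^ n) (v t) x) < e"
      unfolding eventually_at by (auto simp: funpow_dx dist_real_def intro!: exI[of _ d])
  qed
qed

lemma deriv_n_quotient:
  assumes "smooth \<phi>" "smooth \<psi>"
  shows "(deriv ^^ n) (\<lambda>x. (\<phi> x - \<psi> x) / c) x = ((deriv ^^ n) \<phi> x - (deriv ^^ n) \<psi> x) / c"
proof -
  note s = strip_smooth_timefree[OF assms(1), of 0] strip_smooth_timefree[OF assms(2), of 0]
  have "(dx ^^ n) (\<lambda>_ x. inverse c * (\<phi> x - \<psi> x)) 0 = (\<lambda>x. inverse c * (dx ^^ n) (\<lambda>_ x. \<phi> x - \<psi> x) 0 x)"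
    by (rule dxn_cmult[OF strip_smooth_diff[OF s]]) simp
  also have "(dx ^^ n) (\<lambda>_ x. \<phi> x - \<psi> x) 0 = (\<lambda>x. (dx ^^ n) (\<lambda>_. \<phi>) 0 x - (dx ^^ n) (\<lambda>_. \<psi>) 0 x)"
    by (rule dxn_diff[OF s]) simp
  finally show ?thesis by (simp add: funpow_dx divide_inverse mult.commute)
qed

text \<open>
  The difference quotient of a space derivative differs from the time derivative by the oscillation of the latter over a
  short time interval, by the mean value theorem, and this oscillation is small uniformly on compact sets.
\<close>

lemma Ck_Cinf_SucI:
  assumes T: "T > 0" and vw: "has_dt T v w" "strip_smooth B T v" "strip_smooth B T w" and "Ck_Cinf T k w"
  shows "Ck_Cinf T (Suc k) v"
  unfolding Ck_Cinf.simps
proof (intro ballI conjI)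
  have dt: "dt T v t = w t" if "t \<in> {0..T}" for t using has_dt_imp_dt[OF T vw(1) that] .
  show "Ck_Cinf T k (dt T v)"
    using Ck_Cinf_cong[of T "dt T v" w k] dt assms(5) by blast
  fix t assume t: "t \<in> {0..T}"
  show "smooth (v t)" using strip_smooth_smooth[OF vw(2) t] .
  show "Cinf_tendsto (\<lambda>s x. (v s x - v t x) / (s - t)) (dt T v t) (at t within {0..T})"
    unfolding Cinf_tendsto_def
  proof (intro allI impI uniform_limitI)
    fix n and K :: "real set" and e :: real assume "compact K" "e > 0"
    then have "e / 2 > 0" by simp
    from strip_uniform_time[OF strip_smooth_cont[OF strip_smooth_dxn[OF vw(3)]] \<open>compact K\<close> t this, of n]
    obtain d where d: "d > 0" "\<And>s x. s\<in>{0..T} \<Longrightarrow> \<bar>s - t\<bar> < d \<Longrightarrow> x \<in> K \<Longrightarrow>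
       \<bar>(dx ^^ n) w s x - (dx ^^ n) w t x\<bar> < e / 2"
      by blast
    have quot: "(deriv ^^ n) (\<lambda>x. (v s x - v t x) / (s - t)) x = ((dx ^^ n) v s x - (dx ^^ n) v t x) / (s - t)"
      if "s \<in> {0..T}" for s x
      unfolding funpow_dx by (rule deriv_n_quotient[OF strip_smooth_smooth[OF vw(2) that] strip_smooth_smooth[OF vw(2) t]])
    have "\<bar>((dx ^^ n) v s x - (dx ^^ n) v t x) / (s - t) - (dx ^^ n) w t x\<bar> < e"
      if s: "s \<in> {0..T}" "s \<noteq> t" "\<bar>s - t\<bar> < d" "x \<in> K" for s x
    proof -
      define S where "S = {0..T} \<inter> ball t d"
      have "norm (((dx ^^ n) v s x - s * (dx ^^ n) w t x) - ((dx ^^ n) v t x - t * (dx ^^ n) w t x))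
          \<le> e / 2 * norm (s - t)"
      proof (rule field_differentiable_bound[where S = S and f' = "\<lambda>r. (dx ^^ n) w r x - (dx ^^ n) w t x"])
        show "convex S" by (simp add: S_def convex_Int)
        show "((\<lambda>r. (dx ^^ n) v r x - r * (dx ^^ n) w t x) has_real_derivative
            (dx ^^ n) w r x - (dx ^^ n) w t x) (at r within S)" if "r \<in> S" for r
        proof -
          have "((\<lambda>r. (dx ^^ n) v r x) has_real_derivative (dx ^^ n) w r x) (at r within {0..T})"
            using has_dt_dxn[OF vw, of n] that unfolding has_dt_def S_def by blast
          then have "((\<lambda>r. (dx ^^ n) v r x) has_real_derivative (dx ^^ n) w r x) (at r within S)"
            by (rule DERIV_subset) (simp add: S_def)
          then show ?thesis by (auto intro!: derivative_eq_intros)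
        qed
        show "norm ((dx ^^ n) w r x - (dx ^^ n) w t x) \<le> e / 2" if "r \<in> S" for r
          using d(2)[of r x] that s by (auto simp: S_def dist_real_def abs_minus_commute)
        show "s \<in> S" "t \<in> S" using s t d(1) by (simp_all add: S_def dist_real_def abs_minus_commute)
      qed
      also have "\<dots> < e * norm (s - t)" using s \<open>e > 0\<close> by (intro mult_strict_right_mono) auto
      finally have *: "\<bar>((dx ^^ n) v s x - (dx ^^ n) v t x) - (s - t) * (dx ^^ n) w t x\<bar> < e * \<bar>s - t\<bar>"
        by (simp add: algebra_simps)
      have "((dx ^^ n) v s x - (dx ^^ n) v t x) / (s - t) - (dx ^^ n) w t x =
          (((dx ^^ n) v s x - (dx ^^ n) v t x) - (s - t) * (dx ^^ n) w t x) / (s - t)"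
        using s by (simp add: field_simps)
      then show ?thesis using * s by (simp add: abs_divide pos_divide_less_eq)
    qed
    then show "\<forall>\<^sub>F s in at t within {0..T}. \<forall>x\<in>K.
        dist ((deriv ^^ n) (\<lambda>x. (v s x - v t x) / (s - t)) x) ((deriv ^^ n) (dt T v t) x) < e"
      unfolding eventually_at dt[OF t] using d(1) quot
      by (auto simp: dist_real_def simp flip: funpow_dx intro!: exI[of _ d])
  qed
qed

lemma Ck_Cinf_smooth: "Ck_Cinf T k v \<Longrightarrow> t \<in> {0..T} \<Longrightarrow> smooth (v t)"
  by (cases k) auto

text \<open>
  Continuity in time that is locally uniform in space, together with continuity in space, gives joint continuity.
\<close>

lemma Ck0_imp_strip_smooth:
  assumes "Ck_Cinf T 0 v"
  shows "strip_smooth False T v"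
proof -
  have sm: "smooth (v t)" if "t \<in> {0..T}" for t using assms that by simp
  have cont: "strip_cont False T ((dx ^^ n) v)" for n
    unfolding strip_cont_def
  proof (intro conjI)
    show "continuous_on ({0..T} \<times> UNIV) (\<lambda>(t, x). (dx ^^ n) v t x)"
      unfolding continuous_on_iff
    proof (intro ballI allI impI)
      fix p and e :: real assume p: "p \<in> {0..T} \<times> (UNIV :: real set)" and e: "e > 0"
      obtain t x where tx: "p = (t, x)" "t \<in> {0..T}" using p by auto
      have "uniform_limit {x-1..x+1} (\<lambda>s. (deriv ^^ n) (v s)) ((deriv ^^ n) (v t)) (at t within {0..T})"
        using assms tx(2) by (auto simp: Cinf_tendsto_def)
      from uniform_limitD[OF this, of "e/2"] e
      obtain d where d: "d > 0" "\<And>s y. s \<in> {0..T} \<Longrightarrow> s \<noteq> t \<Longrightarrow> dist s t < d \<Longrightarrow> y \<in> {x-1..x+1} \<Longrightarrow>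
          dist ((deriv ^^ n) (v s) y) ((deriv ^^ n) (v t) y) < e/2"
        unfolding eventually_at by auto
      have d': "dist ((deriv ^^ n) (v s) y) ((deriv ^^ n) (v t) y) < e/2"
        if "s \<in> {0..T}" "dist s t < d" "y \<in> {x-1..x+1}" for s y
        using d(2)[OF that(1) _ that(2,3)] e by (cases "s = t") auto
      have "continuous_on UNIV ((deriv ^^ n) (v t))" using smooth_cont[OF sm[OF tx(2)]] .
      then obtain d2 where d2: "d2 > 0" "\<And>y. dist y x < d2 \<Longrightarrow> dist ((deriv ^^ n) (v t) y) ((deriv ^^ n) (v t) x) < e/2"
        unfolding continuous_on_iff using e by (metis UNIV_I half_gt_zero)
      show "\<exists>d>0. \<forall>q\<in>{0..T} \<times> UNIV. dist q p < d \<longrightarrow>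
          dist (case q of (t, x) \<Rightarrow> (dx ^^ n) v t x) (case p of (t, x) \<Rightarrow> (dx ^^ n) v t x) < e"
      proof (intro exI[of _ "min 1 (min d d2)"] conjI ballI impI)
        fix q assume q: "q \<in> {0..T} \<times> (UNIV :: real set)" "dist q p < min 1 (min d d2)"
        obtain s y where sy: "q = (s, y)" by fastforce
        have "dist s t \<le> dist q p" "dist y x \<le> dist q p"
          unfolding sy tx by (metis dist_fst_le fst_conv) (metis dist_snd_le snd_conv sy tx(1))
        then have *: "dist s t < d" "dist y x < 1" "dist y x < d2" using q(2) by auto
        have "y \<in> {x-1..x+1}" using *(2) by (auto simp: dist_real_def)
        then have "dist ((deriv ^^ n) (v s) y) ((deriv ^^ n) (v t) y) < e/2"
            "dist ((deriv ^^ n) (v t) y) ((deriv ^^ n) (v t) x) < e/2"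
          using q(1) sy * by (auto intro!: d' d2(2) simp del: less_divide_eq_numeral1)
        then show "dist (case q of (t, x) \<Rightarrow> (dx ^^ n) v t x) (case p of (t, x) \<Rightarrow> (dx ^^ n) v t x) < e"
          unfolding sy tx funpow_dx split_conv by (metis dist_commute dist_triangle_half_l)
      qed (use d d2 in auto)
    qed
  qed simp
  have "strip_smooth False T ((dx ^^ 0) v)"
    by (rule strip_smooth_from_derivatives[of False T "\<lambda>n. (dx ^^ n) v", OF cont])
      (unfold funpow_dx, rule smooth_deriv[OF sm])
  then show ?thesis by simp
qed

text \<open>
  A differentiable curve is continuous: the difference quotients stay bounded on a compact set, and
  \<open>v s - v t\<close> is \<open>s - t\<close> times such a quotient.
\<close>

lemma Ck_Cinf_imp_strip_smooth: "Ck_Cinf T k v \<Longrightarrow> strip_smooth False T v"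
proof (cases k)
  case (Suc j)
  assume v: "Ck_Cinf T k v"
  have sm: "smooth (v t)" "smooth (dt T v t)" if "t \<in> {0..T}" for t
    using v that Ck_Cinf_smooth[of T j "dt T v" t] by (auto simp: Suc)
  have "Cinf_tendsto v (v t) (at t within {0..T})" if t: "t \<in> {0..T}" for t
    unfolding Cinf_tendsto_def
  proof (intro allI impI)
    fix n and K :: "real set" assume K: "compact K"
    let ?F = "at t within {0..T}"
    let ?Q = "\<lambda>s. (deriv ^^ n) (\<lambda>x. (v s x - v t x) / (s - t))"
    have Q: "uniform_limit K ?Q ((deriv ^^ n) (dt T v t)) ?F"
      using v t K by (auto simp: Suc Cinf_tendsto_def)
    have "uniform_limit K (\<lambda>s x. (s - t) * ?Q s x + (deriv ^^ n) (v t) x)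
        (\<lambda>x. 0 * (deriv ^^ n) (dt T v t) x + (deriv ^^ n) (v t) x) ?F"
    proof (rule uniform_limit_add[OF uniform_lim_mult[OF _ Q] uniform_limit_const])
      show "uniform_limit K (\<lambda>s x. s - t) (\<lambda>x. 0) ?F"
        unfolding uniform_limit_iff eventually_at by (auto simp: dist_real_def)
      show "bounded ((deriv ^^ n) (dt T v t) ` K)"
        using compact_imp_bounded[OF compact_continuous_image[OF smooth_cont[OF sm(2)[OF t]] K]] .
      show "bounded ((\<lambda>x. 0 :: real) ` K)" by (rule finite_imp_bounded) (auto intro: finite_subset[of _ "{0}"])
    qed
    moreover have "(s - t) * ?Q s x + (deriv ^^ n) (v t) x = (deriv ^^ n) (v s) x" if "s \<in> {0..T}" "s \<noteq> t" for s x
      unfolding deriv_n_quotient[OF sm(1)[OF that(1)] sm(1)[OF t]] using that(2) by simp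
    ultimately show "uniform_limit K (\<lambda>s. (deriv ^^ n) (v s)) ((deriv ^^ n) (v t)) ?F"
      by (subst (asm) uniform_limit_cong[where g = "\<lambda>s. (deriv ^^ n) (v s)" and i = "(deriv ^^ n) (v t)"])
        (auto simp: eventually_at_filter)
  qed
  then show ?thesis using Ck0_imp_strip_smooth sm(1) by auto
qed (simp add: Ck0_imp_strip_smooth del: Ck_Cinf.simps)

lemma Ck_Cinf_SucD:
  assumes "Ck_Cinf T (Suc k) v"
  shows "has_dt T v (dt T v)" "Ck_Cinf T k (dt T v)"
  unfolding has_dt_def
proof (intro ballI allI)
  fix t x assume t: "t \<in> {0..T}"
  have "Cinf_tendsto (\<lambda>s x. (v s x - v t x) / (s - t)) (dt T v t) (at t within {0..T})"
    using assms t by simp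
  from this[unfolded Cinf_tendsto_def, THEN spec, of 0, THEN spec, of "{x}"]
  have "((\<lambda>s. (v s x - v t x) / (s - t)) \<longlongrightarrow> dt T v t x) (at t within {0..T})"
    by simp
  then show "((\<lambda>s. v s x) has_real_derivative dt T v t x) (at t within {0..T})"
    by (simp add: has_field_derivative_iff)
qed (use assms in simp)

text \<open>
  Outside the support all space derivatives vanish, since the complement is open; on the support continuity gives the bound.
\<close>

lemma strip_smooth_compact_support:
  assumes "strip_smooth False T v" "compact K" "\<And>t x. t \<in> {0..T} \<Longrightarrow> x \<notin> K \<Longrightarrow> v t x = 0"
  shows "strip_smooth True T v"
proof -
  have zero: "(dx ^^ n) v t x = 0" if t: "t \<in> {0..T}" and x: "x \<notin> K" for n t x
    using x
  proof (induction n arbitrary: x)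
    case (Suc n)
    have "((\<lambda>x. 0) has_real_derivative 0) (at x)" by simp
    then have "((dx ^^ n) v t has_real_derivative 0) (at x)"
      by (rule has_field_derivative_transform_within_open[where S = "- K"])
        (use Suc assms(2) in \<open>auto simp: compact_imp_closed\<close>)
    from DERIV_imp_deriv[OF this] show ?case by (simp add: dx_def[of "(dx ^^ n) v"])
  qed (use assms t in auto)
  have cont: "strip_cont True T ((dx ^^ n) v)" for n
  proof -
    have c: "continuous_on ({0..T} \<times> UNIV) (\<lambda>(t, x). (dx ^^ n) v t x)"
      using strip_cont_continuous[OF strip_smooth_cont[OF strip_smooth_dxn[OF assms(1)]]] .
    have "bounded ((\<lambda>(t, x). (dx ^^ n) v t x) ` ({0..T} \<times> K))"
      by (intro compact_imp_bounded compact_continuous_image continuous_on_subset[OF c] compact_Times assms) auto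
    then obtain M where "\<And>t x. t \<in> {0..T} \<Longrightarrow> x \<in> K \<Longrightarrow> \<bar>(dx ^^ n) v t x\<bar> \<le> M"
      unfolding bounded_iff by (auto simp del: atLeastAtMost_iff)
    then have "\<bar>(dx ^^ n) v t x\<bar> \<le> max M 0" if "t \<in> {0..T}" for t x
      using zero[OF that, of x n] that by (cases "x \<in> K") (auto intro: le_max_iff_disj[THEN iffD2])
    with c show ?thesis unfolding strip_cont_def by blast
  qed
  have "strip_smooth True T ((dx ^^ 0) v)"
    by (rule strip_smooth_from_derivatives[of True T "\<lambda>n. (dx ^^ n) v", OF cont])
      (use strip_smooth_deriv[OF strip_smooth_dxn[OF assms(1)]] in simp)
  then show ?thesis by simp
qed

lemma Cinf_c_subset_Binf: "Cinf_c \<subseteq> Binf"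
proof
  fix \<phi> assume "\<phi> \<in> Cinf_c"
  then have "strip_smooth True 1 (\<lambda>t. \<phi>)"
    by (intro strip_smooth_compact_support[OF strip_smooth_timefree, of _ "closure {x. \<phi> x \<noteq> 0}"])
      (use closure_subset[of "{x. \<phi> x \<noteq> 0}"] in \<open>auto simp: Cinf_c_def\<close>)
  then show "\<phi> \<in> Binf" by (simp add: Binf_iff)
qed

section \<open>Transport systems with zero-order coupling\<close>

text \<open>
  The solution of \<open>v_t = l v_x + G\<close> with initial value \<open>g\<close>: the data \<open>g\<close> and the source \<open>G\<close> are transported along the
  lines on which \<open>x + l t\<close> is constant.
\<close>

definition duhamel :: "real \<Rightarrow> (real \<Rightarrow> real) \<Rightarrow> (real \<Rightarrow> real \<Rightarrow> real) \<Rightarrow> real \<Rightarrow> real \<Rightarrow> real" where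
  "duhamel l g G t x = g (x + l * t) + tint (\<lambda>s y. G s (y + (- l) * s)) t (x + l * t)"

lemma duhamel_smooth:
  assumes g: "strip_smooth B T (\<lambda>t. g)" and G: "strip_smooth B T G"
  shows "strip_smooth B T (duhamel l g G)"
    and "has_dt T (duhamel l g G) (\<lambda>t x. G t x + l * dx (duhamel l g G) t x)"
proof -
  define A where "A = (\<lambda>s y. G s (y + (- l) * s))"
  define V where "V = (\<lambda>t x. g x + tint A t x)"
  have A: "strip_smooth B T A" unfolding A_def by (rule strip_smooth_shift[OF G])
  have V: "strip_smooth B T V" unfolding V_def by (intro strip_smooth_add g tint_smooth A)
  have eq: "duhamel l g G = (\<lambda>t x. V t (x + l * t))"
    by (simp add: fun_eq_iff duhamel_def V_def A_def)
  show "strip_smooth B T (duhamel l g G)" unfolding eq by (rule strip_smooth_shift[OF V])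
  have "has_dt T V A"
    using has_dt_add[OF has_dt_timefree[of T g] tint_has_dt[OF strip_smooth_cont[OF A]]] by (simp add: V_def)
  from has_dt_shift[OF this V A, of l]
  have "has_dt T (duhamel l g G) (\<lambda>t x. A t (x + l * t) + l * dx V t (x + l * t))" by (simp only: eq)
  moreover have "(\<lambda>x. A t (x + l * t) + l * dx V t (x + l * t)) = (\<lambda>x. G t x + l * dx (duhamel l g G) t x)"
    if "t \<in> {0..T}" for t
    unfolding eq dx_shift[OF V that] by (simp add: A_def)
  ultimately show "has_dt T (duhamel l g G) (\<lambda>t x. G t x + l * dx (duhamel l g G) t x)"
    by (subst has_dt_cong[of T _ "duhamel l g G" _ "\<lambda>t x. A t (x + l * t) + l * dx V t (x + l * t)"]) auto
qed

lemma duhamel_0: "duhamel l g G 0 = g"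
  by (simp add: fun_eq_iff duhamel_def tint_def)

lemma duhamel_diff:
  assumes "strip_smooth B T G" "strip_smooth B T H" "t \<in> {0..T}"
  shows "duhamel l g G t x - duhamel l g H t x = duhamel l (\<lambda>_. 0) (\<lambda>t x. G t x - H t x) t x"
proof -
  have i: "(\<lambda>s. v s (y + (- l) * s)) integrable_on {0..t}" if "strip_smooth B T v" for v y
    using strip_cont_time[OF strip_smooth_cont[OF strip_smooth_shift[OF that]], of "{0..t}" y "- l"] assms(3)
    by (auto intro: integrable_continuous_interval)
  show ?thesis
    unfolding duhamel_def tint_def by (simp only: integral_diff[OF i[OF assms(1)] i[OF assms(2)]])
qed

lemma duhamel_bound:
  assumes G: "strip_smooth B T G" and t: "t \<in> {0..T}"
    and b: "\<And>s y. s \<in> {0..t} \<Longrightarrow> \<bar>(dx ^^ n) G s y\<bar> \<le> h s" and h: "(h has_integral I) {0..t}"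
  shows "\<bar>(dx ^^ n) (duhamel l (\<lambda>_. 0) G) t x\<bar> \<le> I"
proof -
  define A where "A = (\<lambda>s y. G s (y + (- l) * s))"
  have A: "strip_smooth B T A" unfolding A_def by (rule strip_smooth_shift[OF G])
  have "duhamel l (\<lambda>_. 0) G = (\<lambda>t x. tint A t (x + l * t))"
    by (simp add: fun_eq_iff duhamel_def A_def)
  then have "(dx ^^ n) (duhamel l (\<lambda>_. 0) G) t x = tint ((dx ^^ n) A) t (x + l * t)"
    by (simp add: dxn_shift[OF tint_smooth[OF A] t] dxn_tint[OF A t])
  also have "\<bar>\<dots>\<bar> \<le> I"
  proof (rule tint_bound[OF strip_smooth_cont[OF strip_smooth_dxn[OF A]] t _ h])
    show "\<bar>(dx ^^ n) A s (x + l * t)\<bar> \<le> h s" if "s \<in> {0..t}" for s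
      using b[OF that] dxn_shift[OF G, of s n "- l"] that t by (simp add: A_def)
  qed
  finally show ?thesis .
qed

text \<open>
  Estimates are obtained for one index at a time; this lemma provides a common constant.
\<close>

lemma finite_uniform_constant:
  fixes P :: "'a \<Rightarrow> real \<Rightarrow> bool"
  assumes "finite I" "\<And>i. i \<in> I \<Longrightarrow> \<exists>C. P i C" "\<And>i C D. P i C \<Longrightarrow> C \<le> D \<Longrightarrow> P i D"
  shows "\<exists>C\<ge>0. \<forall>i\<in>I. P i C"
  using assms(1,2)
proof (induction I rule: finite_induct)
  case (insert i I)
  then obtain C where "0 \<le> C" "\<forall>i\<in>I. P i C" by auto
  moreover obtain D where "P i D" using insert.prems by blast
  ultimately have "0 \<le> max C D" "\<forall>j\<in>insert i I. P j (max C D)"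
    using assms(3)[of _ C "max C D"] assms(3)[of i D "max C D"] by auto
  then show ?case by blast
qed auto

lemma geometric_uniformly_Cauchy:
  fixes f :: "nat \<Rightarrow> 'a \<Rightarrow> real"
  assumes "\<And>m x. x \<in> S \<Longrightarrow> \<bar>f (Suc m) x - f m x\<bar> \<le> M * (1/2) ^ m"
  shows "uniformly_Cauchy_on S f"
proof -
  have "summable (\<lambda>m. M * (1/2) ^ m)" by (intro summable_mult summable_geometric) simp
  then have "uniform_limit S (\<lambda>n x. \<Sum>i<n. f (Suc i) x - f i x) (\<lambda>x. \<Sum>i. f (Suc i) x - f i x) sequentially"
    by (intro Weierstrass_m_test[where M = "\<lambda>m. M * (1/2) ^ m"]) (use assms in auto)
  from uniform_limit_add[OF this uniform_limit_const[where S = S and c = "f 0"]]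
  have "uniform_limit S (\<lambda>n x. (\<Sum>i<n. f (Suc i) x - f i x) + f 0 x)
      (\<lambda>x. (\<Sum>i. f (Suc i) x - f i x) + f 0 x) sequentially" .
  also have "(\<lambda>n x. (\<Sum>i<n. f (Suc i) x - f i x) + f 0 x) = f"
    by (intro ext) (simp add: sum_lessThan_telescope[of "\<lambda>i. f i x" for x])
  finally have "uniform_limit S f (\<lambda>x. (\<Sum>i. f (Suc i) x - f i x) + f 0 x) sequentially" .
  then show ?thesis
    by (auto simp: uniformly_convergent_eq_Cauchy[symmetric] uniformly_convergent_on_def)
qed

lemma uniform_limit_mult_bounded:
  fixes f :: "'b \<Rightarrow> 'a \<Rightarrow> real"
  assumes f: "uniform_limit S f g F" and K: "\<And>p. p \<in> S \<Longrightarrow> \<bar>K p\<bar> \<le> B"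
  shows "uniform_limit S (\<lambda>m p. K p * f m p) (\<lambda>p. K p * g p) F"
proof (rule uniform_limitI)
  fix e :: real assume "e > 0"
  define b where "b = \<bar>B\<bar> + 1"
  have "b > 0" by (simp add: b_def)
  from uniform_limitD[OF f, of "e / b"] \<open>e > 0\<close> \<open>b > 0\<close>
  have "\<forall>\<^sub>F m in F. \<forall>p\<in>S. dist (f m p) (g p) < e / b" by simp
  then show "\<forall>\<^sub>F m in F. \<forall>p\<in>S. dist (K p * f m p) (K p * g p) < e"
  proof (rule eventually_mono, intro ballI)
    fix m p assume "\<forall>p\<in>S. dist (f m p) (g p) < e / b" and p: "p \<in> S"
    then have d: "\<bar>f m p - g p\<bar> * b < e" using \<open>b > 0\<close> by (auto simp: dist_real_def field_simps)
    have "\<bar>K p * f m p - K p * g p\<bar> = \<bar>f m p - g p\<bar> * \<bar>K p\<bar>"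
      by (simp add: abs_mult mult.commute flip: right_diff_distrib)
    also have "\<dots> \<le> \<bar>f m p - g p\<bar> * b"
      using K[OF p] by (intro mult_left_mono) (auto simp: b_def)
    finally show "dist (K p * f m p) (K p * g p) < e" using d by (simp add: dist_real_def)
  qed
qed

lemma uniform_limit_sum_real:
  fixes f :: "'c \<Rightarrow> 'b \<Rightarrow> 'a \<Rightarrow> real"
  assumes "\<And>i. i \<in> I \<Longrightarrow> uniform_limit S (f i) (g i) F"
  shows "uniform_limit S (\<lambda>m p. \<Sum>i\<in>I. f i m p) (\<lambda>p. \<Sum>i\<in>I. g i p) F"
  using assms
  by (induction I rule: infinite_finite_induct) (auto intro!: uniform_limit_const uniform_limit_add)

text \<open>
  Picard iteration. All space derivatives up to order \<open>n\<close> of the difference of two consecutive iterates are at most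
  \<open>M 2^{-m} e^{2 C t}\<close>, because \<open>C\<close> times the time integral of \<open>e^{2 C t}\<close> is at most half of \<open>e^{2 C t}\<close>: the exponential weight
  turns the Volterra operator into a contraction on the whole interval \<open>[0,T]\<close>. The constant \<open>C\<close> depends on \<open>n\<close>, but
  the iterates do not, so the one sequence converges with all its derivatives.
\<close>

lemma transport_system_existence:
  fixes l :: "nat \<Rightarrow> real" and K :: "nat \<Rightarrow> nat \<Rightarrow> real \<Rightarrow> real"
  assumes K: "\<And>i j. i < N \<Longrightarrow> j < N \<Longrightarrow> strip_smooth True T (\<lambda>t. K i j)"
    and F: "\<And>i. i < N \<Longrightarrow> strip_smooth True T (F i)"
    and g: "\<And>i. i < N \<Longrightarrow> strip_smooth True T (\<lambda>t. g i)"
    and T: "0 \<le> T"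
  shows "\<exists>W. \<forall>i<N. strip_smooth False T (W i) \<and> W i 0 = g i \<and>
     has_dt T (W i) (\<lambda>t x. (\<Sum>j<N. K i j x * W j t x) + F i t x + l i * dx (W i) t x)"
proof -
  define W where "W = rec_nat (\<lambda>i t. g i) (\<lambda>_ w i. duhamel (l i) (g i) (\<lambda>t x. (\<Sum>j<N. K i j x * w j t x) + F i t x))"
  have W0: "W 0 i = (\<lambda>t. g i)" and WS: "W (Suc m) i = duhamel (l i) (g i) (\<lambda>t x. (\<Sum>j<N. K i j x * W m j t x) + F i t x)" for m i
    by (simp_all add: W_def)
  have RHS: "strip_smooth True T (\<lambda>t x. (\<Sum>j<N. K i j x * w j t x) + F i t x)"
    if "i < N" "\<And>j. j < N \<Longrightarrow> strip_smooth True T (w j)" for i w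
    using that K F by (intro strip_smooth_intros) auto
  have smW: "strip_smooth True T (W m i)" if "i < N" for m i
    using that
  proof (induction m arbitrary: i)
    case (Suc m) show ?case unfolding WS
      by (intro duhamel_smooth(1) g RHS Suc)
  qed (simp add: W0 g)
  define D where "D m i = (\<lambda>t x. W (Suc m) i t x - W m i t x)" for m i
  have smD: "strip_smooth True T (D m i)" if "i < N" for m i
    unfolding D_def using smW[OF that] by (intro strip_smooth_diff)
  have DS: "D (Suc m) i t = duhamel (l i) (\<lambda>_. 0) (\<lambda>t x. \<Sum>j<N. K i j x * D m j t x) t"
    if i: "i < N" and t: "t \<in> {0..T}" for m i t
  proof
    fix x
    have "D (Suc m) i t x = duhamel (l i) (\<lambda>_. 0) (\<lambda>t x. ((\<Sum>j<N. K i j x * W (Suc m) j t x) + F i t x)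
        - ((\<Sum>j<N. K i j x * W m j t x) + F i t x)) t x"
      unfolding D_def WS[of "Suc m"] WS[of m i] by (rule duhamel_diff[OF RHS RHS t]) (use i smW in auto)
    also have "(\<lambda>t x. ((\<Sum>j<N. K i j x * W (Suc m) j t x) + F i t x) - ((\<Sum>j<N. K i j x * W m j t x) + F i t x))
        = (\<lambda>t x. \<Sum>j<N. K i j x * D m j t x)"
      by (simp add: D_def right_diff_distrib sum_subtractf)
    finally show "D (Suc m) i t x = duhamel (l i) (\<lambda>_. 0) (\<lambda>t x. \<Sum>j<N. K i j x * D m j t x) t x" .
  qed
  have bound: "\<exists>M. \<forall>m. \<forall>i<N. \<forall>k\<le>n. \<forall>t\<in>{0..T}. \<forall>x. \<bar>(dx ^^ k) (D m i) t x\<bar> \<le> M * (1/2) ^ m" for n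
  proof -
    define Q where "Q i j k C \<longleftrightarrow> (\<forall>B v. strip_smooth B T v \<longrightarrow> (\<forall>t\<in>{0..T}. \<forall>x M.
        (\<forall>j\<le>k. \<bar>(dx ^^ j) v t x\<bar> \<le> M) \<longrightarrow> \<bar>(dx ^^ k) (\<lambda>t x. K i j x * v t x) t x\<bar> \<le> C * M))"
      for i j k C
    have "\<exists>c\<ge>0. \<forall>p\<in>{..<N} \<times> {..<N} \<times> {..n}. (\<lambda>(i, j, k). Q i j k) p c"
    proof (rule finite_uniform_constant)
      show "\<exists>c. (\<lambda>(i, j, k). Q i j k) p c" if p: "p \<in> {..<N} \<times> {..<N} \<times> {..n}" for p
      proof -
        obtain i j k where ijk: "p = (i, j, k)" "i < N" "j < N" using p by auto
        show ?thesis using dxn_mult_bound[OF K[OF ijk(2,3)], of k] by (auto simp: Q_def ijk(1))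
      qed
      fix p c d assume Q: "(\<lambda>(i, j, k). Q i j k) p c" and cd: "c \<le> (d :: real)"
      obtain i j k where p: "p = (i, j, k)" by (cases p)
      have "c * M \<le> d * M" if "\<forall>q\<le>k. \<bar>(dx ^^ q) v t x\<bar> \<le> M" for v t x M
        using that[rule_format, of 0] cd by (intro mult_right_mono) auto
      then show "(\<lambda>(i, j, k). Q i j k) p d" using Q unfolding p Q_def split_conv by (meson order_trans)
    qed simp
    then obtain c where c: "0 \<le> c" "\<And>i j k. i < N \<Longrightarrow> j < N \<Longrightarrow> k \<le> n \<Longrightarrow> Q i j k c" by force
    \<comment> \<open>The summand 1 keeps \<open>C\<close> positive, so that \<open>e^{2 C t}\<close> has the antiderivative used below.\<close>
    define C where "C = 1 + N * c"
    have C0: "C > 0" unfolding C_def using c(1) by (intro add_pos_nonneg) auto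
    have "\<exists>M\<ge>0. \<forall>p\<in>{..<N} \<times> {..n}. \<forall>t\<in>{0..T}. \<forall>x. \<bar>(dx ^^ snd p) (D 0 (fst p)) t x\<bar> \<le> M"
    proof (rule finite_uniform_constant)
      show "\<exists>M. \<forall>t\<in>{0..T}. \<forall>x. \<bar>(dx ^^ snd p) (D 0 (fst p)) t x\<bar> \<le> M" if "p \<in> {..<N} \<times> {..n}" for p
        using strip_smooth_cont[OF strip_smooth_dxn[OF smD[of "fst p"]]] that by (auto simp: strip_cont_def)
    qed (auto intro: order_trans)
    then obtain M where M0: "0 \<le> M" and M: "\<And>i k t x. i < N \<Longrightarrow> k \<le> n \<Longrightarrow> t \<in> {0..T} \<Longrightarrow> \<bar>(dx ^^ k) (D 0 i) t x\<bar> \<le> M"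
      by force
    have main: "\<bar>(dx ^^ k) (D m i) t x\<bar> \<le> M * (1/2) ^ m * exp (2 * C * t)"
      if "i < N" "k \<le> n" "t \<in> {0..T}" for m i k t x
      using that
    proof (induction m arbitrary: i k t x)
      case 0
      have "\<bar>(dx ^^ k) (D 0 i) t x\<bar> \<le> M * 1" using M[OF 0] by simp
      also have "\<dots> \<le> M * exp (2 * C * t)"
        using 0 C0 M0 by (intro mult_left_mono) (auto simp: one_le_exp_iff)
      finally show ?case by simp
    next
      case (Suc m)
      define h where "h s = C * (M * (1/2) ^ m * exp (2 * C * s))" for s
      have "(h has_integral (M * (1/2) ^ Suc m * exp (2 * C * t) - M * (1/2) ^ Suc m * exp (2 * C * 0))) {0..t}"
        by (rule fundamental_theorem_of_calculus)
          (use Suc.prems in \<open>auto simp: h_def simp flip: has_real_derivative_iff_has_vector_derivative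
             intro!: derivative_eq_intros\<close>)
      moreover have "\<bar>(dx ^^ k) (\<lambda>t x. \<Sum>j<N. K i j x * D m j t x) s y\<bar> \<le> h s" if s: "s \<in> {0..t}" for s y
      proof -
        have s': "s \<in> {0..T}" using s Suc.prems by auto
        have eq: "(dx ^^ k) (\<lambda>t x. \<Sum>j<N. K i j x * D m j t x) s = (\<lambda>y. \<Sum>j<N. (dx ^^ k) (\<lambda>t x. K i j x * D m j t x) s y)"
          by (rule dxn_sum[OF _ s']) (use K smD Suc.prems in \<open>auto intro!: strip_smooth_mult\<close>)
        have "\<bar>(dx ^^ k) (\<lambda>t x. \<Sum>j<N. K i j x * D m j t x) s y\<bar> \<le> (\<Sum>j<N. \<bar>(dx ^^ k) (\<lambda>t x. K i j x * D m j t x) s y\<bar>)"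
          unfolding eq by (rule sum_abs)
        also have "\<dots> \<le> (\<Sum>j<N. c * (M * (1/2) ^ m * exp (2 * C * s)))"
        proof (rule sum_mono)
          fix j assume "j \<in> {..<N}"
          then have j: "j < N" by simp
          have "\<forall>q\<le>k. \<bar>(dx ^^ q) (D m j) s y\<bar> \<le> M * (1/2) ^ m * exp (2 * C * s)"
            using Suc.IH[OF j _ s'] Suc.prems(2) by (meson order_trans)
          then show "\<bar>(dx ^^ k) (\<lambda>t x. K i j x * D m j t x) s y\<bar> \<le> c * (M * (1/2) ^ m * exp (2 * C * s))"
            using c(2)[OF Suc.prems(1) j Suc.prems(2)] smD[OF j] s' unfolding Q_def by blast
        qed
        also have "\<dots> \<le> h s" unfolding h_def C_def using M0 by (simp add: ring_distribs)
        finally show ?thesis .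
      qed
      moreover have "strip_smooth True T (\<lambda>t x. \<Sum>j<N. K i j x * D m j t x)"
        using K smD Suc.prems by (auto intro!: strip_smooth_sum strip_smooth_mult)
      ultimately have "\<bar>(dx ^^ k) (duhamel (l i) (\<lambda>_. 0) (\<lambda>t x. \<Sum>j<N. K i j x * D m j t x)) t x\<bar>
          \<le> M * (1/2) ^ Suc m * exp (2 * C * t) - M * (1/2) ^ Suc m * exp (2 * C * 0)"
        using duhamel_bound[OF _ Suc.prems(3)] by blast
      also have "\<dots> \<le> M * (1/2) ^ Suc m * exp (2 * C * t)" using M0 by simp
      also have "(dx ^^ k) (duhamel (l i) (\<lambda>_. 0) (\<lambda>t x. \<Sum>j<N. K i j x * D m j t x)) t = (dx ^^ k) (D (Suc m) i) t"
        by (rule dxn_cong) (rule DS[OF Suc.prems(1,3), symmetric])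
      finally show ?case .
    qed
    have "\<bar>(dx ^^ k) (D m i) t x\<bar> \<le> (M * exp (2 * C * T)) * (1/2) ^ m" if "i < N" "k \<le> n" "t \<in> {0..T}" for m i k t x
    proof -
      have "exp (2 * C * t) \<le> exp (2 * C * T)" using that C0 by auto
      then have "(M * (1/2) ^ m) * exp (2 * C * t) \<le> (M * (1/2) ^ m) * exp (2 * C * T)"
        using M0 by (intro mult_left_mono) auto
      with main[OF that, of m x] show ?thesis by (simp add: mult_ac)
    qed
    then show ?thesis by blast
  qed
  have "\<exists>w. strip_smooth False T w \<and> strip_lim T (\<lambda>m. W m i) w" if i: "i < N" for i
  proof (rule strip_lim_exists)
    show "strip_smooth False T (W m i)" for m using smW[OF i] by (rule strip_smooth_unbounded)
    fix k R
    obtain M where M: "\<forall>m. \<forall>i<N. \<forall>k'\<le>k. \<forall>t\<in>{0..T}. \<forall>x. \<bar>(dx ^^ k') (D m i) t x\<bar> \<le> M * (1/2) ^ m"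
      using bound by blast
    show "uniformly_Cauchy_on ({0..T} \<times> {-R..R}) (\<lambda>m (t, x). (dx ^^ k) (W m i) t x)"
    proof (rule geometric_uniformly_Cauchy)
      fix m p assume "p \<in> {0..T} \<times> {-R..R}"
      then obtain t x where p: "p = (t, x)" "t \<in> {0..T}" by auto
      have "(dx ^^ k) (D m i) t = (\<lambda>x. (dx ^^ k) (W (Suc m) i) t x - (dx ^^ k) (W m i) t x)"
        unfolding D_def by (rule dxn_diff[OF smW[OF i] smW[OF i] p(2)])
      then show "\<bar>(case p of (t, x) \<Rightarrow> (dx ^^ k) (W (Suc m) i) t x) - (case p of (t, x) \<Rightarrow> (dx ^^ k) (W m i) t x)\<bar>
          \<le> M * (1/2) ^ m"
        using M i p by (metis (no_types, lifting) order_refl split_conv)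
    qed
  qed
  then obtain w where w: "\<And>i. i < N \<Longrightarrow> strip_smooth False T (w i)"
      "\<And>i. i < N \<Longrightarrow> strip_lim T (\<lambda>m. W m i) (w i)" by metis
  have limS: "strip_lim T (\<lambda>m. W (Suc m) i) (w i)" if "i < N" for i
    using w(2)[OF that] unfolding strip_lim_def
    by (auto intro: filterlim_compose[OF _ filterlim_Suc])
  have unif: "uniform_limit ({0..T} \<times> {-R..R}) (\<lambda>m p. (dx ^^ k) (V m) (fst p) (snd p)) (\<lambda>p. (dx ^^ k) v (fst p) (snd p)) sequentially"
    if "strip_lim T V v" for V v R k
    using that unfolding strip_lim_def split_beta by blast
  show ?thesis
  proof (intro exI[of _ w] allI impI conjI)
    fix i assume i: "i < N"
    show "strip_smooth False T (w i)" by (rule w(1)[OF i])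
    show "w i 0 = g i"
    proof
      fix x
      have "W (Suc m) i 0 x = g i x" for m by (simp add: WS duhamel_0)
      then have "(\<lambda>m. g i x) \<longlonglongrightarrow> w i 0 x"
        using strip_lim_pointwise[OF limS[OF i], of 0 0 x] T by simp
      then show "w i 0 x = g i x" using LIMSEQ_unique tendsto_const by blast
    qed
    show "has_dt T (w i) (\<lambda>t x. (\<Sum>j<N. K i j x * w j t x) + F i t x + l i * dx (w i) t x)"
    proof (rule strip_lim_has_dt[OF limS[OF i]])
      show "has_dt T (W (Suc m) i) (\<lambda>t x. (\<Sum>j<N. K i j x * W m j t x) + F i t x + l i * dx (W (Suc m) i) t x)" for m
        using duhamel_smooth(2)[OF g[OF i] RHS[OF i smW]] by (simp add: WS)
      fix R
      show "uniform_limit ({0..T} \<times> {-R..R})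
         (\<lambda>m (t, x). (\<Sum>j<N. K i j x * W m j t x) + F i t x + l i * dx (W (Suc m) i) t x)
         (\<lambda>(t, x). (\<Sum>j<N. K i j x * w j t x) + F i t x + l i * dx (w i) t x) sequentially"
        unfolding split_beta
      proof (intro uniform_limit_add uniform_limit_sum_real uniform_limit_const)
        fix j assume "j \<in> {..<N}"
        then have j: "j < N" by simp
        obtain B where "\<And>x. \<bar>K i j x\<bar> \<le> B"
          using strip_smooth_cont[OF K[OF i j]] T by (auto simp: strip_cont_def)
        then show "uniform_limit ({0..T} \<times> {-R..R}) (\<lambda>m p. K i j (snd p) * W m j (fst p) (snd p))
            (\<lambda>p. K i j (snd p) * w j (fst p) (snd p)) sequentially"
          using unif[OF w(2)[OF j], where k = 0 and R = R] by (intro uniform_limit_mult_bounded) auto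
      next
        show "uniform_limit ({0..T} \<times> {-R..R}) (\<lambda>m p. l i * dx (W (Suc m) i) (fst p) (snd p))
            (\<lambda>p. l i * dx (w i) (fst p) (snd p)) sequentially"
          using unif[OF limS[OF i], where k = "Suc 0" and R = R] by (intro uniform_limit_mult_bounded[where B = "\<bar>l i\<bar>"]) auto
      qed
    qed
  qed
qed

section \<open>Strictly hyperbolic equations\<close>

text \<open>
  For a constant speed the unknowns \<open>p = w_tt\<close>, \<open>q = w_tx\<close>, \<open>s = w_xx - w_tt\<close>, \<open>m = w_x\<close> form a closed
  first-order system. The combinations \<open>p + q\<close> and \<open>p - q\<close> travel with speeds \<open>-1\<close> and \<open>1\<close>, while \<open>s\<close> and \<open>m\<close> obey
  ordinary differential equations, so the system is diagonal with zero-order coupling. Conversely, \<open>w\<close> is recovered from \<open>p\<close> by two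
  time integrations, and the identities that define \<open>q\<close>, \<open>s\<close>, \<open>m\<close> persist because both sides have
  the same time derivative and the same initial value.
\<close>

lemma wave_existence:
  assumes T: "0 \<le> T"
    and B: "strip_smooth True T (\<lambda>t. B1)" "strip_smooth True T (\<lambda>t. B2)" "strip_smooth True T (\<lambda>t. B3)" "strip_smooth True T (\<lambda>t. B4)"
    and G: "strip_smooth True T (\<lambda>t. G0)" "strip_smooth True T (\<lambda>t. G1)" "strip_smooth True T (\<lambda>t. G2)"
    and h: "strip_smooth True T h"
  obtains w0 w1 w2 w3 where
    "strip_smooth False T w0" "strip_smooth False T w1" "strip_smooth False T w2" "strip_smooth False T w3"
    "has_dt T w0 w1" "has_dt T w1 w2" "has_dt T w2 w3" "w0 0 = G0" "w1 0 = G1" "w2 0 = G2"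
    "\<And>t x. t \<in> {0..T} \<Longrightarrow> w3 t x - dx (dx w1) t x + B1 x * dx (dx w0) t x + B2 x * dx w1 t x
        + B3 x * w2 t x + B4 x * dx w0 t x = h t x"
proof -
  define C where "C j x = (if j = 0 then - (B1 x + B2 x + B3 x) / 2 else if j = 1 then - (B1 x - B2 x + B3 x) / 2
      else if j = 2 then - B1 x else - B4 x)" for j :: nat and x
  \<comment> \<open>Components 0 to 3 of the system are \<open>p + q\<close>, \<open>p - q\<close>, \<open>s\<close>, \<open>m\<close>; the rows of \<open>K\<close> express
    \<open>G\<close>, \<open>G\<close>, \<open>- G\<close> and \<open>q\<close>, where \<open>G = p_t - q_x\<close>.\<close>
  define K where "K i j x = (if i < 2 then C j x else if i = 2 then - C j x
      else if j = 0 then 1/2 else if j = 1 then -1/2 else 0)" for i j :: nat and x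
  define F where "F i t x = (if i < 2 then h t x else if i = 2 then - h t x else 0)" for i :: nat and t x
  define l where "l i = (if i = 0 then 1 else if i = 1 then -1 else 0 :: real)" for i :: nat
  define g where "g i x = (if i = 0 then G2 x + deriv G1 x else if i = 1 then G2 x - deriv G1 x
      else if i = 2 then deriv (deriv G0) x - G2 x else deriv G0 x)" for i :: nat and x
  have dG: "strip_smooth True T (\<lambda>t. deriv G1)" "strip_smooth True T (\<lambda>t. deriv G0)" "strip_smooth True T (\<lambda>t. deriv (deriv G0))"
    using strip_smooth_dx[OF G(2)] strip_smooth_dx[OF G(1)] strip_smooth_dx[OF strip_smooth_dx[OF G(1)]]
    by (simp_all add: dx_def)
  have C: "strip_smooth True T (\<lambda>t. C j)" for j
    unfolding C_def by (cases "j = 0"; cases "j = 1"; cases "j = 2") (auto intro!: strip_smooth_intros B)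
  have sK: "strip_smooth True T (\<lambda>t. K i j)" for i j
    unfolding K_def using C[of j] by (cases "i < 2"; cases "i = 2"; cases "j = 0"; cases "j = 1") (auto intro!: strip_smooth_intros)
  have sF: "strip_smooth True T (F i)" for i
    unfolding F_def using h by (cases "i < 2"; cases "i = 2") (auto intro!: strip_smooth_intros)
  have sg: "strip_smooth True T (\<lambda>t. g i)" for i
    unfolding g_def by (cases "i = 0"; cases "i = 1"; cases "i = 2") (auto intro!: strip_smooth_intros G dG)
  from transport_system_existence[of 4 T K F g l, OF sK sF sg T]
  obtain W where W4: "\<forall>i<4. strip_smooth False T (W i) \<and> W i 0 = g i \<and>
     has_dt T (W i) (\<lambda>t x. (\<Sum>j<4. K i j x * W j t x) + F i t x + l i * dx (W i) t x)" ..
  have W: "strip_smooth False T (W i)" "W i 0 = g i"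
     "has_dt T (W i) (\<lambda>t x. (\<Sum>j<4. K i j x * W j t x) + F i t x + l i * dx (W i) t x)" if "i < 4" for i
    using W4[rule_format, OF that] by blast+
  define p where "p = (\<lambda>t x. (W 0 t x + W 1 t x) / 2)"
  define q where "q = (\<lambda>t x. (W 0 t x - W 1 t x) / 2)"
  define H where "H = (\<lambda>t x. h t x - B1 x * (W 2 t x + p t x) - B2 x * q t x - B3 x * p t x - B4 x * W 3 t x)"
  have s4: "(\<Sum>j<4. f j) = f 0 + f 1 + f 2 + f (3::nat)" for f :: "nat \<Rightarrow> real"
    by (simp add: eval_nat_numeral)
  have RH: "(\<Sum>j<4. K 0 j x * W j t x) + F 0 t x = H t x" "(\<Sum>j<4. K 1 j x * W j t x) + F 1 t x = H t x"
    "(\<Sum>j<4. K 2 j x * W j t x) + F 2 t x = - H t x" "(\<Sum>j<4. K 3 j x * W j t x) + F 3 t x = q t x" for t x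
    unfolding s4 by (simp_all add: K_def C_def F_def H_def p_def q_def field_simps)
  have d0: "has_dt T (W 0) (\<lambda>t x. H t x + dx (W 0) t x)"
    and d1: "has_dt T (W 1) (\<lambda>t x. H t x - dx (W 1) t x)"
    and d2: "has_dt T (W 2) (\<lambda>t x. - H t x)" and d3: "has_dt T (W 3) q"
    using W(3)[of 0] W(3)[of 1] W(3)[of 2] W(3)[of 3] unfolding RH by (simp_all add: l_def)
  have sW: "strip_smooth False T (W 0)" "strip_smooth False T (W 1)" "strip_smooth False T (W 2)" "strip_smooth False T (W 3)"
    using W(1) by auto
  have sp: "strip_smooth False T p" and sq: "strip_smooth False T q"
    unfolding p_def q_def by (intro strip_smooth_intros sW)+
  have sB: "strip_smooth False T (\<lambda>t. B1)" "strip_smooth False T (\<lambda>t. B2)" "strip_smooth False T (\<lambda>t. B3)" "strip_smooth False T (\<lambda>t. B4)"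
    "strip_smooth False T h" "strip_smooth False T (\<lambda>t. G0)" "strip_smooth False T (\<lambda>t. G1)"
    using B h G strip_smooth_unbounded by blast+
  have sH: "strip_smooth False T H" unfolding H_def by (intro strip_smooth_intros sW sp sq sB)
  have dxp: "dx p t = (\<lambda>x. (dx (W 0) t x + dx (W 1) t x) / 2)"
   and dxq: "dx q t = (\<lambda>x. (dx (W 0) t x - dx (W 1) t x) / 2)" if t: "t \<in> {0..T}" for t
    unfolding p_def q_def using strip_smooth_deriv[OF sW(1) t] strip_smooth_deriv[OF sW(2) t]
    by (auto intro!: dx_eqI DERIV_cdivide DERIV_add DERIV_diff)
  have dp: "has_dt T p (\<lambda>t x. dx q t x + H t x)"
  proof -
    have "has_dt T p (\<lambda>t x. ((H t x + dx (W 0) t x) + (H t x - dx (W 1) t x)) / 2)"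
      unfolding p_def by (intro has_dt_divide has_dt_add d0 d1)
    then show ?thesis
      by (rule has_dt_cong[THEN iffD1, rotated 2]) (auto simp: dxq field_simps)
  qed
  have dq: "has_dt T q (dx p)"
  proof -
    have "has_dt T q (\<lambda>t x. ((H t x + dx (W 0) t x) - (H t x - dx (W 1) t x)) / 2)"
      unfolding q_def by (intro has_dt_divide has_dt_diff d0 d1)
    then show ?thesis
      by (rule has_dt_cong[THEN iffD1, rotated 2]) (auto simp: dxp field_simps)
  qed
  define w1 where "w1 = (\<lambda>t x. G1 x + tint p t x)"
  \<comment> \<open>\<open>p\<close> is integrated twice in time.\<close>
  define w0 where "w0 = (\<lambda>t x. G0 x + tint w1 t x)"
  define w3 where "w3 = (\<lambda>t x. dx q t x + H t x)"
  have sw1: "strip_smooth False T w1" unfolding w1_def by (intro strip_smooth_intros tint_smooth sp sB)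
  have sw0: "strip_smooth False T w0" unfolding w0_def by (intro strip_smooth_intros tint_smooth sw1 sB)
  have sw3: "strip_smooth False T w3" unfolding w3_def by (intro strip_smooth_intros sq sH)
  have dw1: "has_dt T w1 p"
    using has_dt_add[OF has_dt_timefree[of T G1] tint_has_dt[OF strip_smooth_cont[OF sp]]] by (simp add: w1_def)
  have dw0: "has_dt T w0 w1"
    using has_dt_add[OF has_dt_timefree[of T G0] tint_has_dt[OF strip_smooth_cont[OF sw1]]] by (simp add: w0_def)
  have i0: "w0 0 = G0" "w1 0 = G1" "p 0 = G2" 
    using W(2)[of 0] W(2)[of 1] by (auto simp: w0_def w1_def tint_def p_def g_def fun_eq_iff)
  have q0: "q 0 = deriv G1" "W 3 0 = deriv G0" "\<And>x. W 2 0 x + p 0 x = deriv (deriv G0) x"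
    using W(2)[of 0] W(2)[of 1] W(2)[of 2] W(2)[of 3] by (auto simp: q_def p_def g_def fun_eq_iff)
  have e1: "dx w1 t = q t" if t: "t \<in> {0..T}" for t
    using has_dt_unique[OF has_dt_dx[OF dw1 sw1 sp] dq _ t] q0(1) by (auto simp: dx_def i0)
  have e2: "dx w0 t = W 3 t" if t: "t \<in> {0..T}" for t
  proof -
    have "has_dt T (dx w0) q"
      using has_dt_dx[OF dw0 sw0 sw1] by (rule has_dt_cong[THEN iffD1, rotated 2]) (auto simp: e1)
    from has_dt_unique[OF this d3 _ t] show ?thesis using q0(2) by (auto simp: dx_def i0)
  qed
  have e3: "dx (dx w0) t x = W 2 t x + p t x" if t: "t \<in> {0..T}" for t x
  proof -
    have "has_dt T (dx (dx w0)) (dx (dx w1))"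
      by (intro has_dt_dx[of _ _ _ False] strip_smooth_dx dw0 sw0 sw1)
    then have "has_dt T (dx (dx w0)) (dx q)"
      by (rule has_dt_cong[THEN iffD1, rotated 2]) (auto intro!: dx_cong simp: e1)
    moreover have "has_dt T (\<lambda>t x. W 2 t x + p t x) (dx q)"
      using has_dt_add[OF d2 dp] by simp
    ultimately show ?thesis
      by (rule has_dt_unique[OF _ _ _ t]) (use q0(3) i0 in \<open>auto simp: dx_def\<close>)
  qed
  have pde: "w3 t x - dx (dx w1) t x + B1 x * dx (dx w0) t x + B2 x * dx w1 t x
        + B3 x * p t x + B4 x * dx w0 t x = h t x" if t: "t \<in> {0..T}" for t x
  proof -
    have "dx (dx w1) t = dx q t" by (rule dx_cong) (rule e1[OF t])
    then show ?thesis using e1[OF t] e2[OF t] e3[OF t] by (simp add: w3_def H_def algebra_simps)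
  qed
  show thesis
    by (rule that[OF sw0 sw1 sp sw3 dw0 dw1 _ i0 pde]) (use dp in \<open>simp_all add: w3_def\<close>)
qed

lemma antiderivative_on_reals:
  fixes q :: "real \<Rightarrow> real"
  assumes "continuous_on UNIV q"
  obtains \<phi> where "\<And>x. (\<phi> has_real_derivative q x) (at x)"
proof -
  define \<phi> where "\<phi> x = integral {0..x} q - integral {x..0} q" for x
  have int: "q integrable_on {a..b}" for a b
    using assms by (intro integrable_continuous_interval) (rule continuous_on_subset, auto)
  have "(\<phi> has_real_derivative q x) (at x)" for x
  proof -
    define R where "R = \<bar>x\<bar> + 1"
    have eq: "integral {-R..y} q - integral {-R..0} q = \<phi> y" if "y \<in> {-R<..<R}" for y
    proof (cases "0 \<le> y")
      case True
      have "integral {-R..0} q + integral {0..y} q = integral {-R..y} q"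
        by (rule Henstock_Kurzweil_Integration.integral_combine[OF _ True int]) (simp add: R_def)
      moreover have "integral {y..0} q = 0" using True by (cases "y = 0") auto
      ultimately show ?thesis by (simp add: \<phi>_def)
    next
      case False
      have "integral {-R..y} q + integral {y..0} q = integral {-R..0} q"
        by (rule Henstock_Kurzweil_Integration.integral_combine[OF _ _ int]) (use that False in auto)
      moreover have "integral {0..y} q = 0" using False by auto
      ultimately show ?thesis by (simp add: \<phi>_def)
    qed
    have x: "x \<in> {-R<..<R}" by (auto simp: R_def)
    have "((\<lambda>y. integral {-R..y} q) has_real_derivative q x) (at x within {-R..R})"
      by (rule integral_has_real_derivative) (use assms x in \<open>auto intro: continuous_on_subset\<close>)
    then have "((\<lambda>y. integral {-R..y} q) has_real_derivative q x) (at x within {-R<..<R})"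
      by (rule DERIV_subset) auto
    then have "((\<lambda>y. integral {-R..y} q) has_real_derivative q x) (at x)"
      by (simp only: at_within_open[OF x open_greaterThanLessThan])
    then have "((\<lambda>y. integral {-R..y} q - integral {-R..0} q) has_real_derivative q x) (at x)"
      by (auto intro!: derivative_eq_intros)
    then show ?thesis
      by (rule has_field_derivative_transform_within_open[OF _ open_greaterThanLessThan x]) (rule eq)
  qed
  then show thesis by (rule that)
qed

text \<open>
  The lower bound on the derivative makes the map onto, not only injective.
\<close>

lemma diffeomorphism_inverse:
  fixes \<phi> q :: "real \<Rightarrow> real"
  assumes \<phi>: "\<And>x. (\<phi> has_real_derivative q x) (at x)" and q: "\<And>x. q x \<ge> k" "k > 0"
  obtains \<psi> where "\<And>x. \<psi> (\<phi> x) = x" "\<And>y. \<phi> (\<psi> y) = y"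
    "\<And>y. (\<psi> has_real_derivative inverse (q (\<psi> y))) (at y)"
proof -
  have qpos: "q x > 0" for x using q(1)[of x] q(2) by simp
  have mono: "\<phi> x < \<phi> y" if "x < y" for x y
    by (rule DERIV_pos_imp_increasing[OF that]) (use \<phi> qpos in blast)
  have cont: "isCont \<phi> x" for x using \<phi> DERIV_isCont by blast
  have grow: "\<phi> y - \<phi> x \<ge> k * (y - x)" if "x \<le> y" for x y
  proof -
    have "\<phi> x - k * x \<le> \<phi> y - k * y"
      by (rule DERIV_nonneg_imp_nondecreasing[OF that])
        (use \<phi> q(1) in \<open>auto intro!: exI[of _ "q _ - k"] derivative_eq_intros\<close>)
    then show ?thesis by (simp add: algebra_simps)
  qed
  have "\<exists>x. \<phi> x = y" for y
  proof -
    \<comment> \<open>At distance \<open>r\<close> from the origin the function has moved by at least \<open>\<bar>y - \<phi> 0\<bar>\<close>.\<close>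
    define r where "r = \<bar>y - \<phi> 0\<bar> / k"
    have r: "r \<ge> 0" "k * r = \<bar>y - \<phi> 0\<bar>" using q(2) by (auto simp: r_def)
    have "\<phi> (- r) \<le> y" "y \<le> \<phi> r" using grow[of "- r" 0] grow[of 0 r] r by auto
    then show ?thesis using IVT[where f = \<phi> and a = "- r" and b = r and y = y] cont r(1) by auto
  qed
  then obtain \<psi> where right: "\<And>y. \<phi> (\<psi> y) = y" by metis
  have left: "\<psi> (\<phi> x) = x" for x
    using right[of "\<phi> x"] mono by (metis linorder_neq_iff)
  have "(\<psi> has_real_derivative inverse (q (\<psi> y))) (at y)" for y
  proof (rule DERIV_inverse_function[where a = "y - 1" and b = "y + 1"])
    show "(\<phi> has_real_derivative q (\<psi> y)) (at (\<psi> y))" by (rule \<phi>)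
    show "q (\<psi> y) \<noteq> 0" using qpos[of "\<psi> y"] by simp
    have "isCont \<psi> (\<phi> (\<psi> y))"
      by (rule isCont_inverse_function[where d = 1]) (auto simp: left cont)
    then show "isCont \<psi> y" by (simp add: right)
  qed (auto simp: right)
  with left right show thesis by (rule that)
qed

text \<open>
  The derivative of \<open>q = A^{-1/2}\<close> is \<open>- A' q\<^sup>3 / 2\<close>, a polynomial in \<open>q\<close> and \<open>A'\<close>. Bounds for \<open>q\<close> of one order therefore
  give bounds of the next.
\<close>

lemma strip_smooth_inverse_sqrt:
  assumes A: "strip_smooth True T (\<lambda>t. A)" and d: "\<And>x. A x \<ge> d" "d > 0"
    and dA: "\<And>x. (A has_real_derivative A' x) (at x)" "strip_smooth True T (\<lambda>t. A')"
  shows "strip_smooth True T (\<lambda>t x. inverse (sqrt (A x)))"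
    and "\<And>x. ((\<lambda>x. inverse (sqrt (A x))) has_real_derivative - (A' x * inverse (sqrt (A x)) ^ 3) / 2) (at x)"
proof -
  have pos: "A x > 0" for x using d(1)[of x] d(2) by simp
  show der: "((\<lambda>x. inverse (sqrt (A x))) has_real_derivative - (A' x * inverse (sqrt (A x)) ^ 3) / 2) (at x)" for x
    using pos[of x]
    by (auto intro!: derivative_eq_intros dA(1) simp: field_simps power2_eq_square power3_eq_cube)
  have cont: "continuous_on UNIV (\<lambda>x. inverse (sqrt (A x)))"
    by (intro continuous_at_imp_continuous_on ballI DERIV_isCont[OF der])
  have "continuous_on ({0..T} \<times> UNIV) (\<lambda>p. (\<lambda>x. inverse (sqrt (A x))) (snd p))"
    by (rule continuous_on_compose2[OF cont]) (auto intro!: continuous_intros)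
  moreover have "\<bar>inverse (sqrt (A x))\<bar> \<le> inverse (sqrt d)" for x
    using d(1)[of x] d(2) pos[of x] by (auto intro!: le_imp_inverse_le)
  ultimately have c: "strip_cont True T (\<lambda>t x. inverse (sqrt (A x)))"
    unfolding strip_cont_def split_beta by blast
  have "strip_Cn True T n (\<lambda>t x. inverse (sqrt (A x)))" for n
  proof (induction n)
    case (Suc n)
    have h: "strip_Cn True T n (\<lambda>t x. - 1 / 2)" by (rule strip_Cn_const)
    have "strip_Cn True T n (\<lambda>t x. (- 1 / 2) * (A' x * (inverse (sqrt (A x)) * (inverse (sqrt (A x)) * inverse (sqrt (A x))))))"
      using dA(2) by (intro strip_Cn_mult h Suc) (auto simp: strip_smooth_def)
    then show ?case
      by (rule strip_Cn_SucI[OF c, rotated]) (rule der[THEN DERIV_cong], simp add: power3_eq_cube)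
  qed (simp add: c)
  then show "strip_smooth True T (\<lambda>t x. inverse (sqrt (A x)))" by (simp add: strip_smooth_def)
qed

text \<open>
  With \<open>q = A^{-1/2}\<close> and \<open>y = \<phi>(x)\<close>, \<open>\<phi>' = q\<close>, a function \<open>u(t, x) = w(t, \<phi>(x))\<close> has \<open>u_x = q w_y\<close> and
  \<open>u_xx = q\<^sup>2 w_yy + q' w_y\<close>. Since \<open>A q\<^sup>2 = 1\<close>, the term \<open>A u_txx\<close> becomes \<open>w_tyy\<close> plus a term of first order in \<open>y\<close>, and the
  equation for \<open>w\<close> is of the kind with unit speed.
\<close>

lemma strictly_hyperbolic_existence:
  assumes T: "0 \<le> T" and A: "A \<in> Binf" "\<And>x. A x \<ge> d" "d > 0"
    and b: "b1 \<in> Binf" "b2 \<in> Binf" "b3 \<in> Binf" and g: "g0 \<in> Binf" "g1 \<in> Binf" "g2 \<in> Binf"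
    and f: "strip_smooth True T f"
  obtains u0 u1 u2 u3 where
    "strip_smooth False T u0" "strip_smooth False T u1" "strip_smooth False T u2" "strip_smooth False T u3"
    "has_dt T u0 u1" "has_dt T u1 u2" "has_dt T u2 u3" "u0 0 = g0" "u1 0 = g1" "u2 0 = g2"
    "\<And>t x. t \<in> {0..T} \<Longrightarrow> u3 t x - A x * dx (dx u1) t x + b1 x * dx (dx u0) t x + b2 x * dx u1 t x
        + b3 x * u2 t x = f t x"
proof -
  note sA = strip_smooth_Binf[OF A(1), of T] and sb = b[THEN strip_smooth_Binf, of T] and sg = g[THEN strip_smooth_Binf, of T]
  define A' where "A' = deriv A"
  have sA': "strip_smooth True T (\<lambda>t. A')" using strip_smooth_dx[OF sA] by (simp add: A'_def dx_def)
  have dA: "(A has_real_derivative A' x) (at x)" for x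
    using strip_smooth_deriv[OF sA, of 0] T by (simp add: A'_def dx_def)
  define q where "q x = inverse (sqrt (A x))" for x
  define q' where "q' x = - (A' x * q x ^ 3) / 2" for x
  have sq: "strip_smooth True T (\<lambda>t. q)" and dq: "\<And>x. (q has_real_derivative q' x) (at x)"
    using strip_smooth_inverse_sqrt[OF sA A(2,3) dA sA'] by (simp_all add: q_def[abs_def] q'_def)
  have Apos: "A x > 0" for x using A(2)[of x] A(3) by simp
  have Aq: "A x * q x * q x = 1" for x
    using Apos[of x] real_sqrt_mult_self[of "A x"] by (simp add: q_def field_simps)
  define c where "c x = A x * q x" for x
  have cq: "c x = inverse (q x)" for x
    using Apos[of x] real_sqrt_mult_self[of "A x"] by (simp add: q_def c_def field_simps)
  have sc: "strip_smooth True T (\<lambda>t. c)" unfolding c_def by (intro strip_smooth_mult sA sq)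
  obtain M where M: "\<bar>A x\<bar> \<le> M" for x
    using strip_smooth_cont[OF sA] T by (auto simp: strip_cont_def)
  have qM: "q x \<ge> inverse (sqrt M)" for x
    using M[of x] Apos[of x] by (auto simp: q_def intro!: le_imp_inverse_le)
  have M0: "inverse (sqrt M) > 0" using M[of 0] Apos[of 0] by auto
  have "continuous_on UNIV q"
    by (intro continuous_at_imp_continuous_on ballI DERIV_isCont[OF dq])
  then obtain \<phi> where \<phi>: "\<And>x. (\<phi> has_real_derivative q x) (at x)"
    by (rule antiderivative_on_reals) blast
  obtain \<psi> where \<psi>: "\<And>x. \<psi> (\<phi> x) = x" "\<And>y. \<phi> (\<psi> y) = y"
      "\<And>y. (\<psi> has_real_derivative c (\<psi> y)) (at y)"
    by (rule diffeomorphism_inverse[OF \<phi> qM M0]) (auto simp: cq)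
  have "strip_Cn True T n (\<lambda>t y. c (\<psi> y))" for n
  proof (induction n)
    case 0
    have "continuous_on UNIV \<psi>" by (intro continuous_at_imp_continuous_on ballI DERIV_isCont[OF \<psi>(3)])
    then have "continuous_on ({0..T} \<times> UNIV) (\<lambda>p. \<psi> (snd p))"
      by (rule continuous_on_compose2) (auto intro!: continuous_intros)
    then show ?case
      unfolding strip_Cn.simps by (intro strip_cont_comp[OF strip_smooth_cont[OF sc]]) (simp add: split_beta)
  next
    case (Suc n)
    show ?case
      by (rule strip_Cn_comp[OF \<psi>(3) Suc]) (use sc in \<open>auto simp: strip_smooth_def simp del: strip_Cn.simps\<close>)
  qed
  then have s\<psi>': "strip_smooth True T (\<lambda>t y. c (\<psi> y))" by (simp add: strip_smooth_def)
  have comp: "strip_smooth True T (\<lambda>t y. v t (\<psi> y))" if "strip_smooth True T v" for v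
    by (rule strip_smooth_comp[OF \<psi>(3) s\<psi>' that])
  have "strip_smooth True T (\<lambda>t. q')"
    unfolding q'_def power3_eq_cube by (intro strip_smooth_intros sA' sq)
  then have h4: "strip_smooth True T (\<lambda>t y. b1 (\<psi> y) * q' (\<psi> y))"
    by (intro comp[of "\<lambda>t x. b1 x * q' x"] strip_smooth_intros sb)
  have h1: "strip_smooth True T (\<lambda>t y. b1 (\<psi> y) * (q (\<psi> y) * q (\<psi> y)))"
    by (intro comp[of "\<lambda>t x. b1 x * (q x * q x)"] strip_smooth_intros sb sq)
  have h2: "strip_smooth True T (\<lambda>t y. b2 (\<psi> y) * q (\<psi> y) + A' (\<psi> y) * q (\<psi> y) / 2)"
    by (intro comp[of "\<lambda>t x. b2 x * q x + A' x * q x / 2"] strip_smooth_intros sb sq sA')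
  have h3: "strip_smooth True T (\<lambda>t y. b3 (\<psi> y))" by (intro comp[of "\<lambda>t. b3"] sb)
  have g0: "strip_smooth True T (\<lambda>t y. g0 (\<psi> y))" by (intro comp[of "\<lambda>t. g0"] sg)
  have g1: "strip_smooth True T (\<lambda>t y. g1 (\<psi> y))" by (intro comp[of "\<lambda>t. g1"] sg)
  have g2: "strip_smooth True T (\<lambda>t y. g2 (\<psi> y))" by (intro comp[of "\<lambda>t. g2"] sg)
  have hf: "strip_smooth True T (\<lambda>t y. f t (\<psi> y))" by (rule comp[OF f])
  obtain w0 w1 w2 w3 where w: 
    "strip_smooth False T w0" "strip_smooth False T w1" "strip_smooth False T w2" "strip_smooth False T w3"
    "has_dt T w0 w1" "has_dt T w1 w2" "has_dt T w2 w3" 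
    "w0 0 = (\<lambda>y. g0 (\<psi> y))" "w1 0 = (\<lambda>y. g1 (\<psi> y))" "w2 0 = (\<lambda>y. g2 (\<psi> y))"
    and pde: "\<And>t y. t \<in> {0..T} \<Longrightarrow> w3 t y - dx (dx w1) t y + b1 (\<psi> y) * (q (\<psi> y) * q (\<psi> y)) * dx (dx w0) t y
        + (b2 (\<psi> y) * q (\<psi> y) + A' (\<psi> y) * q (\<psi> y) / 2) * dx w1 t y
        + b3 (\<psi> y) * w2 t y + b1 (\<psi> y) * q' (\<psi> y) * dx w0 t y = f t (\<psi> y)"
    by (rule wave_existence[OF T h1 h2 h3 h4 g0 g1 g2 hf]) (rule that; assumption)
  have cs: "strip_smooth False T (\<lambda>t x. v t (\<phi> x))" if "strip_smooth False T v" for v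
    by (rule strip_smooth_comp[OF \<phi> strip_smooth_unbounded[OF sq] that])
  have d1: "dx (\<lambda>t x. v t (\<phi> x)) t = (\<lambda>x. dx v t (\<phi> x) * q x)" if "strip_smooth False T v" "t \<in> {0..T}" for v t
    by (rule dx_eqI) (rule DERIV_chain2[OF strip_smooth_deriv[OF that] \<phi>])
  have d2: "dx (dx (\<lambda>t x. v t (\<phi> x))) t x = dx (dx v) t (\<phi> x) * (q x * q x) + dx v t (\<phi> x) * q' x"
    if v: "strip_smooth False T v" "t \<in> {0..T}" for v t x
  proof -
    have "dx (dx (\<lambda>t x. v t (\<phi> x))) t = dx (\<lambda>t x. dx v t (\<phi> x) * q x) t"
      by (rule dx_cong) (rule d1[OF v])
    also have "\<dots> = (\<lambda>x. (dx (dx v) t (\<phi> x) * q x) * q x + q' x * dx v t (\<phi> x))"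
      by (rule dx_eqI)
        (rule DERIV_mult[OF DERIV_chain2[OF strip_smooth_deriv[OF strip_smooth_dx[OF v(1)] v(2)] \<phi>] dq])
    finally show ?thesis by (simp add: mult_ac)
  qed
  show thesis
  proof (rule that[of "\<lambda>t x. w0 t (\<phi> x)" "\<lambda>t x. w1 t (\<phi> x)" "\<lambda>t x. w2 t (\<phi> x)" "\<lambda>t x. w3 t (\<phi> x)"])
    fix t x assume t: "t \<in> {0..T}"
    have Aq': "A x * q' x = - (A' x * q x) / 2"
    proof -
      have "A x * q' x = - (A' x * q x) / 2 * (A x * q x * q x)" by (simp add: q'_def power3_eq_cube)
      then show ?thesis by (simp add: Aq)
    qed
    have "A x * (X * (q x * q x) + Y * q' x) = X - (A' x * q x) / 2 * Y" for X Y
    proof -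
      have "A x * (X * (q x * q x) + Y * q' x) = X * (A x * q x * q x) + Y * (A x * q' x)"
        by (simp add: algebra_simps)
      then show ?thesis by (simp add: Aq Aq')
    qed
    then have "w3 t (\<phi> x) - A x * dx (dx (\<lambda>t x. w1 t (\<phi> x))) t x + b1 x * dx (dx (\<lambda>t x. w0 t (\<phi> x))) t x
        + b2 x * dx (\<lambda>t x. w1 t (\<phi> x)) t x + b3 x * w2 t (\<phi> x)
      = w3 t (\<phi> x) - (dx (dx w1) t (\<phi> x) - (A' x * q x) / 2 * dx w1 t (\<phi> x))
        + b1 x * (dx (dx w0) t (\<phi> x) * (q x * q x) + dx w0 t (\<phi> x) * q' x)
        + b2 x * (dx w1 t (\<phi> x) * q x) + b3 x * w2 t (\<phi> x)"
      unfolding d2[OF w(1) t] d2[OF w(2) t] d1[OF w(2) t] by simp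
    also have "\<dots> = f t x" using pde[OF t, of "\<phi> x"] by (simp add: \<psi> algebra_simps)
    finally show "w3 t (\<phi> x) - A x * dx (dx (\<lambda>t x. w1 t (\<phi> x))) t x + b1 x * dx (dx (\<lambda>t x. w0 t (\<phi> x))) t x
        + b2 x * dx (\<lambda>t x. w1 t (\<phi> x)) t x + b3 x * w2 t (\<phi> x) = f t x" .
  qed (use w in \<open>auto intro!: cs has_dt_comp simp: \<psi>\<close>)
qed

section \<open>The weighted energy inequality\<close>

lemma strip_smooth_power: "strip_smooth B T v \<Longrightarrow> strip_smooth B T (\<lambda>t x. v t x ^ n)"
  by (induction n) (auto intro: strip_smooth_const strip_smooth_mult)

text \<open>
  The support is contained in a backward cone whose cross-section shrinks with speed \<open>l\<close>. Squaring the positive part makes the function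
  continuously differentiable, and \<open>sqrt (1 + x\<^sup>2)\<close> replaces \<open>\<bar>x\<bar>\<close> for the same reason.
\<close>

definition weight :: "real \<Rightarrow> real \<Rightarrow> real \<Rightarrow> real \<Rightarrow> real" where
  "weight \<rho> l t x = (max 0 (\<rho> - l * t - sqrt (1 + x\<^sup>2)))\<^sup>2"

definition weight_t :: "real \<Rightarrow> real \<Rightarrow> real \<Rightarrow> real \<Rightarrow> real" where
  "weight_t \<rho> l t x = - 2 * l * max 0 (\<rho> - l * t - sqrt (1 + x\<^sup>2))"

definition weight_x :: "real \<Rightarrow> real \<Rightarrow> real \<Rightarrow> real \<Rightarrow> real" where
  "weight_x \<rho> l t x = - 2 * max 0 (\<rho> - l * t - sqrt (1 + x\<^sup>2)) * (x / sqrt (1 + x\<^sup>2))"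

lemma has_derivative_max_sq: "((\<lambda>y. (max 0 y)\<^sup>2) has_real_derivative 2 * max 0 y) (at (y::real))"
proof -
  consider "y > 0" | "y < 0" | "y = 0" by linarith
  then show ?thesis
  proof cases
    case 1
    have "((\<lambda>y. y\<^sup>2) has_real_derivative 2 * max 0 y) (at y)"
      using 1 by (auto intro!: derivative_eq_intros)
    then show ?thesis
      by (rule has_field_derivative_transform_within_open[where S = "{0<..}"]) (use 1 in auto)
  next
    case 2
    have "((\<lambda>y. 0) has_real_derivative 2 * max 0 y) (at y)"
      using 2 by (auto intro!: derivative_eq_intros)
    then show ?thesis
      by (rule has_field_derivative_transform_within_open[where S = "{..<0}"]) (use 2 in auto)
  next
    case 3
    have "((\<lambda>h. ((max 0 h)\<^sup>2 - (max 0 0)\<^sup>2) / (h - 0)) \<longlongrightarrow> 0) (at (0::real))"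
    proof (rule Lim_null_comparison[where g = "\<lambda>h. \<bar>h\<bar>"])
      show "\<forall>\<^sub>F h in at (0::real). norm (((max 0 h)\<^sup>2 - (max 0 0)\<^sup>2) / (h - 0)) \<le> \<bar>h\<bar>"
        by (rule always_eventually) (auto simp: max_def power2_eq_square)
      show "((\<lambda>h::real. \<bar>h\<bar>) \<longlongrightarrow> 0) (at 0)" by (rule tendsto_rabs_zero) (rule tendsto_ident_at)
    qed
    with 3 show ?thesis by (simp add: has_field_derivative_iff)
  qed
qed

lemma weight_has_deriv_t: "((\<lambda>t. weight \<rho> l t x) has_real_derivative weight_t \<rho> l t x) (at t within S)"
proof -
  have "((\<lambda>t. \<rho> - l * t - sqrt (1 + x\<^sup>2)) has_real_derivative - l) (at t within S)"
    by (auto intro!: derivative_eq_intros)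
  from DERIV_chain2[OF has_derivative_max_sq this] show ?thesis
    unfolding weight_def weight_t_def by (simp add: mult_ac)
qed

lemma weight_has_deriv_x: "((\<lambda>x. weight \<rho> l t x) has_real_derivative weight_x \<rho> l t x) (at x)"
proof -
  have "1 + x\<^sup>2 > 0" by (simp add: add_pos_nonneg)
  then have "((\<lambda>x. \<rho> - l * t - sqrt (1 + x\<^sup>2)) has_real_derivative - (x / sqrt (1 + x\<^sup>2))) (at x)"
    by (auto intro!: derivative_eq_intros simp: field_simps)
  from DERIV_chain2[OF has_derivative_max_sq this] show ?thesis
    unfolding weight_def weight_x_def by (simp add: mult_ac)
qed

lemma weight_nonneg: "weight \<rho> l t x \<ge> 0"
  by (simp add: weight_def)

lemma weight_zero:
  assumes "0 \<le> t" "0 \<le> l" "\<bar>x\<bar> \<ge> \<rho>"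
  shows "weight \<rho> l t x = 0"
proof -
  have "\<bar>x\<bar> \<le> sqrt (1 + x\<^sup>2)" by (rule real_le_rsqrt) simp
  moreover have "0 \<le> l * t" using assms by simp
  ultimately have "\<rho> - l * t - sqrt (1 + x\<^sup>2) \<le> 0" using assms(3) by linarith
  then show ?thesis by (simp add: weight_def max_def)
qed

text \<open>
  The weight loses mass in time at least as fast as energy, travelling with speed at most \<open>l\<close>, can flow across its slope.
\<close>

lemma weight_flux: "\<bar>weight_x \<rho> l t x\<bar> * l \<le> - weight_t \<rho> l t x" if "0 \<le> l"
proof -
  have "\<bar>x\<bar> \<le> sqrt (1 + x\<^sup>2)" by (rule real_le_rsqrt) simp
  moreover have "sqrt (1 + x\<^sup>2) > 0" by (simp add: add_pos_nonneg)
  ultimately have "\<bar>x / sqrt (1 + x\<^sup>2)\<bar> \<le> 1" by (simp add: field_simps)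
  then have "2 * max 0 (\<rho> - l * t - sqrt (1 + x\<^sup>2)) * l * \<bar>x / sqrt (1 + x\<^sup>2)\<bar>
      \<le> 2 * max 0 (\<rho> - l * t - sqrt (1 + x\<^sup>2)) * l * 1"
    using that by (intro mult_left_mono) auto
  then show ?thesis by (simp add: weight_x_def weight_t_def abs_mult mult_ac)
qed

lemma weight_cont:
  "strip_cont False T (weight \<rho> l)" "strip_cont False T (weight_t \<rho> l)" "strip_cont False T (weight_x \<rho> l)"
proof -
  have p: "sqrt (1 + x\<^sup>2) \<noteq> 0" for x :: real
    by (metis add_pos_nonneg less_irrefl real_sqrt_eq_0_iff zero_le_power2 zero_less_one)
  show "strip_cont False T (weight \<rho> l)" "strip_cont False T (weight_t \<rho> l)" "strip_cont False T (weight_x \<rho> l)"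
    unfolding strip_cont_def split_beta weight_def[abs_def] weight_t_def[abs_def] weight_x_def[abs_def]
    using p by (auto intro!: continuous_intros)
qed

lemma weight_ge_1:
  assumes "0 \<le> l" "t \<in> {0..T}" "\<bar>x\<bar> \<le> R" "\<rho> = l * T + sqrt (1 + R\<^sup>2) + 1"
  shows "weight \<rho> l t x \<ge> 1"
proof -
  have "x\<^sup>2 \<le> R\<^sup>2" using power_mono[OF assms(3), of 2] by simp
  then have "sqrt (1 + x\<^sup>2) \<le> sqrt (1 + R\<^sup>2)" by simp
  moreover have "l * t \<le> l * T" using assms by (intro mult_left_mono) auto
  ultimately have "1 \<le> max 0 (\<rho> - l * t - sqrt (1 + x\<^sup>2))" using assms(4) by linarith
  then show ?thesis unfolding weight_def by (rule one_le_power)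
qed

text \<open>
  \<open>U1\<close>, \<open>U2\<close>, \<open>U3\<close> stand for the time derivatives of \<open>U0\<close>. The lower order terms with \<open>c4\<close>, \<open>c5\<close>, \<open>c6\<close> arise when the
  equation is differentiated in \<open>x\<close>.
\<close>

definition third_order_eq where
  "third_order_eq T A b1 c2 b3 c4 c5 c6 U0 U1 U2 U3 F \<longleftrightarrow>
     strip_smooth False T U0 \<and> strip_smooth False T U1 \<and> strip_smooth False T U2 \<and>
     strip_smooth False T U3 \<and> strip_smooth False T F \<and>
     has_dt T U0 U1 \<and> has_dt T U1 U2 \<and> has_dt T U2 U3 \<and>
     (\<forall>t\<in>{0..T}. \<forall>x. U3 t x - A x * dx (dx U1) t x + b1 x * dx (dx U0) t x + c2 x * dx U1 t x
        + b3 x * U2 t x + c4 x * dx U0 t x + c5 x * U1 t x + c6 x * U0 t x = F t x)"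

lemma third_order_eqD:
  assumes "third_order_eq T A b1 c2 b3 c4 c5 c6 U0 U1 U2 U3 F"
  shows "strip_smooth False T U0" "strip_smooth False T U1" "strip_smooth False T U2" "strip_smooth False T U3"
    "strip_smooth False T F" "has_dt T U0 U1" "has_dt T U1 U2" "has_dt T U2 U3"
    "\<And>t x. t \<in> {0..T} \<Longrightarrow> U3 t x - A x * dx (dx U1) t x + b1 x * dx (dx U0) t x + c2 x * dx U1 t x
        + b3 x * U2 t x + c4 x * dx U0 t x + c5 x * U1 t x + c6 x * U0 t x = F t x"
  using assms by (auto simp: third_order_eq_def)

text \<open>
  Besides the energy \<open>U2\<^sup>2 + A (U1_x)\<^sup>2\<close> of the wave operator, the density contains the square of \<open>U2 - A U0_xx\<close>, whose time
  derivative, by the equation, involves no derivative of order three. It gives control of \<open>A U0_xx\<close>, hence of \<open>b1 U0_xx\<close>.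
\<close>

definition energy_density :: "(real \<Rightarrow> real) \<Rightarrow> (real \<Rightarrow> real \<Rightarrow> real) \<Rightarrow> (real \<Rightarrow> real \<Rightarrow> real) \<Rightarrow> (real \<Rightarrow> real \<Rightarrow> real) \<Rightarrow> real \<Rightarrow> real \<Rightarrow> real" where
  "energy_density A U0 U1 U2 t x = (U2 t x - A x * dx (dx U0) t x)\<^sup>2 + (U2 t x)\<^sup>2 + A x * (dx U1 t x)\<^sup>2
     + A x * (dx U0 t x)\<^sup>2 + (U1 t x)\<^sup>2 + (U0 t x)\<^sup>2"

definition energy where
  "energy \<rho> l A U0 U1 U2 t = integral {-\<rho>..\<rho>} (\<lambda>x. weight \<rho> l t x * energy_density A U0 U1 U2 t x)"

abbreviation energy_n where
  "energy_n \<rho> l a \<epsilon> k U0 U1 U2 \<equiv> energy \<rho> l (\<lambda>x. a x + \<epsilon>) ((dx ^^ k) U0) ((dx ^^ k) U1) ((dx ^^ k) U2)"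

text \<open>
  This is the square of a weighted norm.
\<close>

definition wnorm where
  "wnorm \<rho> l v t = integral {-\<rho>..\<rho>} (\<lambda>x. weight \<rho> l t x * (v t x)\<^sup>2)"

text \<open>
  The pointwise inequality behind the energy estimate, with \<open>s\<close> for \<open>\<surd>A\<close>, \<open>p\<close> for \<open>U1_x\<close>, \<open>r\<close> for \<open>U0_x\<close> and \<open>y\<close> for \<open>U0_xx\<close>. The
  left-hand side is the time derivative of the density after the total \<open>x\<close>-derivative of \<open>2 A U2 U1_x\<close> has been split off.
  Every factor except \<open>y\<close> is at most \<open>\<surd>e\<close> after multiplication by \<open>s\<close> where necessary, and \<open>A y = u2 - z\<close>.
\<close>

lemma energy_rate_bound:
  fixes s z u2 p r u1 u0 y F K :: real
  assumes s: "0 \<le> s" "A = s\<^sup>2" and K: "0 \<le> K" and z: "z = u2 - A * y"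
    and c: "\<bar>b1\<bar> \<le> K * A" "\<bar>c2\<bar> \<le> K * s" "\<bar>b3\<bar> \<le> K" "\<bar>c4\<bar> \<le> K * s" "\<bar>c5\<bar> \<le> K" "\<bar>c6\<bar> \<le> K" "\<bar>A'\<bar> \<le> K * s"
    and e: "e = z\<^sup>2 + u2\<^sup>2 + A * p\<^sup>2 + A * r\<^sup>2 + u1\<^sup>2 + u0\<^sup>2"
  shows "2 * (z + u2) * (F - (b1 * y + c2 * p + b3 * u2 + c4 * r + c5 * u1 + c6 * u0))
     + 2 * A * r * p + 2 * u1 * u2 + 2 * u0 * u1 - 2 * A' * u2 * p \<le> (30 * K + 8) * e + F\<^sup>2"
proof -
  define n where "n = sqrt e"
  have parts: "0 \<le> A * p\<^sup>2" "0 \<le> A * r\<^sup>2" "(s * p)\<^sup>2 = A * p\<^sup>2" "(s * r)\<^sup>2 = A * r\<^sup>2"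
    using s by (auto simp: power_mult_distrib)
  have e0: "0 \<le> e" unfolding e using parts by simp
  have n: "0 \<le> n" "n\<^sup>2 = e" using e0 by (auto simp: n_def)
  have le: "\<bar>v\<bar> \<le> n" if "v\<^sup>2 \<le> e" for v
    unfolding n_def using that by (metis real_le_rsqrt power2_abs)
  have bd: "\<bar>z\<bar> \<le> n" "\<bar>u2\<bar> \<le> n" "\<bar>s * p\<bar> \<le> n" "\<bar>s * r\<bar> \<le> n" "\<bar>u1\<bar> \<le> n" "\<bar>u0\<bar> \<le> n"
    by (rule le, use parts e in \<open>simp add: e\<close>)+
  have t1: "\<bar>b1 * y\<bar> \<le> 2 * (K * n)"
  proof -
    have "\<bar>b1 * y\<bar> \<le> (K * A) * \<bar>y\<bar>" unfolding abs_mult using c(1) by (intro mult_right_mono) auto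
    also have "\<dots> = K * \<bar>u2 - z\<bar>" using z s by (simp add: abs_mult)
    also have "\<dots> \<le> K * (2 * n)" using bd K by (intro mult_left_mono) auto
    finally show ?thesis by simp
  qed
  have ts: "\<bar>g * v\<bar> \<le> K * n" if "\<bar>g\<bar> \<le> K * s" "\<bar>s * v\<bar> \<le> n" for g v
  proof -
    have "\<bar>g * v\<bar> \<le> (K * s) * \<bar>v\<bar>" unfolding abs_mult using that(1) by (intro mult_right_mono) auto
    also have "\<dots> = K * \<bar>s * v\<bar>" using s by (simp add: abs_mult)
    also have "\<dots> \<le> K * n" using that(2) K by (intro mult_left_mono) auto
    finally show ?thesis .
  qed
  have tk: "\<bar>g * v\<bar> \<le> K * n" if "\<bar>g\<bar> \<le> K" "\<bar>v\<bar> \<le> n" for g v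
    unfolding abs_mult using that K by (intro mult_mono) auto
  define R where "R = b1 * y + c2 * p + b3 * u2 + c4 * r + c5 * u1 + c6 * u0"
  have R: "\<bar>R\<bar> \<le> 7 * (K * n)"
    unfolding R_def using t1 ts[OF c(2) bd(3)] tk[OF c(3) bd(2)] ts[OF c(4) bd(4)] tk[OF c(5) bd(5)] tk[OF c(6) bd(6)]
    by linarith
  have "2 * (z + u2) * (F - R) \<le> \<bar>2 * (z + u2)\<bar> * \<bar>F - R\<bar>" using abs_ge_self[of "2 * (z + u2) * (F - R)"] by (simp only: abs_mult)
  also have "\<dots> \<le> (4 * n) * (\<bar>F\<bar> + 7 * (K * n))"
  proof (rule mult_mono)
    have "\<bar>z + u2\<bar> \<le> 2 * n" using bd(1,2) by linarith
    then show "\<bar>2 * (z + u2)\<bar> \<le> 4 * n" unfolding abs_mult by simp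
    show "\<bar>F - R\<bar> \<le> \<bar>F\<bar> + 7 * (K * n)" using R by linarith
  qed (use n in auto)
  also have "\<dots> = 4 * n * \<bar>F\<bar> + 28 * K * e" by (simp add: n(2)[symmetric] power2_eq_square algebra_simps)
  also have "4 * n * \<bar>F\<bar> \<le> 4 * e + F\<^sup>2"
    using zero_le_power2[of "2 * n - \<bar>F\<bar>"] by (simp add: n(2)[symmetric] power2_eq_square algebra_simps)
  finally have 1: "2 * (z + u2) * (F - R) \<le> 4 * e + F\<^sup>2 + 28 * K * e" by simp
  have "2 * A * r * p = 2 * (s * r) * (s * p)" by (simp add: s power2_eq_square)
  also have "\<dots> \<le> (s * r)\<^sup>2 + (s * p)\<^sup>2" by (rule sum_squares_bound)
  finally have 2: "2 * A * r * p \<le> e" using parts zero_le_power2[of z] zero_le_power2[of u2] zero_le_power2[of u1] zero_le_power2[of u0]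
    unfolding e by linarith
  have 3: "2 * u1 * u2 \<le> e" using sum_squares_bound[of u1 u2] parts zero_le_power2[of z] zero_le_power2[of u0]
    unfolding e by linarith
  have 4: "2 * u0 * u1 \<le> e" using sum_squares_bound[of u0 u1] parts zero_le_power2[of z] zero_le_power2[of u2]
    unfolding e by linarith
  have "- 2 * A' * u2 * p \<le> 2 * (\<bar>A' * p\<bar> * \<bar>u2\<bar>)"
    using abs_ge_minus_self[of "A' * p * u2"] by (simp add: abs_mult mult_ac)
  also have "\<dots> \<le> 2 * ((K * n) * n)" using ts[OF c(7) bd(3)] bd(2) K n by (intro mult_left_mono mult_mono) auto
  also have "\<dots> = 2 * K * e" by (simp add: n(2)[symmetric] power2_eq_square)
  finally have 5: "- 2 * A' * u2 * p \<le> 2 * K * e" .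
  have "2 * (z + u2) * (F - R) + 2 * A * r * p + 2 * u1 * u2 + 2 * u0 * u1 - 2 * A' * u2 * p
     \<le> (4 * e + F\<^sup>2 + 28 * K * e) + e + e + e + 2 * K * e" using 1 2 3 4 5 by linarith
  also have "\<dots> \<le> (30 * K + 8) * e + F\<^sup>2" using e0 by (simp add: algebra_simps)
  finally show ?thesis by (simp add: R_def)
qed

lemma gronwall:
  fixes E :: "real \<Rightarrow> real"
  assumes E: "\<And>s. s \<in> {0..T} \<Longrightarrow> (E has_real_derivative E' s) (at s within {0..T})"
    and b: "\<And>s. s \<in> {0..T} \<Longrightarrow> E' s \<le> C * E s + M" and C: "0 \<le> C" and M: "0 \<le> M" "E 0 \<le> M"
    and t: "t \<in> {0..T}"
  shows "E t \<le> exp (C * T) * (1 + T) * M"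
proof -
  \<comment> \<open>An integrating factor; the resulting function is nonincreasing.\<close>
  define h where "h s = exp (- C * s) * E s - M * s" for s
  have h': "(h has_real_derivative - C * exp (- C * s) * E s + exp (- C * s) * E' s - M) (at s within {0..T})"
    if "s \<in> {0..T}" for s
    unfolding h_def by (auto intro!: derivative_eq_intros E[OF that] simp: algebra_simps)
  have neg: "- C * exp (- C * s) * E s + exp (- C * s) * E' s - M \<le> 0" if "s \<in> {0..T}" for s
  proof -
    have "exp (- C * s) * (E' s - C * E s) \<le> exp (- C * s) * M"
      using b[OF that] by (intro mult_left_mono) auto
    also have "\<dots> \<le> 1 * M" using that C M by (intro mult_right_mono) auto
    finally show ?thesis by (simp add: algebra_simps)
  qed
  have "h t \<le> h 0"
  proof (cases "t = 0")
    case False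
    then have t0: "0 < t" using t by simp
    show ?thesis
    proof (rule DERIV_nonpos_imp_decreasing_open[OF less_imp_le[OF t0]])
      show "\<exists>y. (h has_real_derivative y) (at x) \<and> y \<le> 0" if "0 < x" "x < t" for x
        using h'[of x] neg[of x] that t at_within_Icc_at[of 0 x T] by auto
      have "continuous_on {0..T} h"
        unfolding continuous_on_eq_continuous_within using h'[THEN DERIV_continuous] by blast
      then show "continuous_on {0..t} h" by (rule continuous_on_subset) (use t in auto)
    qed
  qed simp
  then have "exp (- C * t) * E t \<le> M + M * t" using M by (simp add: h_def)
  also have "\<dots> \<le> (1 + T) * M" using t M by (simp add: algebra_simps mult_left_mono)
  finally have "exp (C * t) * (exp (- C * t) * E t) \<le> exp (C * t) * ((1 + T) * M)"
    by (intro mult_left_mono) auto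
  then have "E t \<le> exp (C * t) * ((1 + T) * M)" by (simp flip: mult.assoc exp_add)
  also have "\<dots> \<le> exp (C * T) * ((1 + T) * M)"
    using t C M by (intro mult_right_mono) (auto intro: mult_left_mono)
  finally show ?thesis by simp
qed

lemma energy_density_smooth:
  assumes "strip_smooth False T (\<lambda>t. A)" "strip_smooth False T U0" "strip_smooth False T U1" "strip_smooth False T U2"
  shows "strip_smooth False T (energy_density A U0 U1 U2)"
  unfolding energy_density_def[abs_def] by (intro strip_smooth_intros strip_smooth_power assms)

lemma energy_density_nonneg: "0 \<le> A x \<Longrightarrow> 0 \<le> energy_density A U0 U1 U2 t x"
  by (simp add: energy_density_def)

lemma integrable_weighted:
  assumes "strip_cont B T w" "strip_cont B T v" "t \<in> {0..T}"
  shows "(\<lambda>x. w t x * v t x) integrable_on {a..b::real}"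
  by (intro integrable_continuous_interval continuous_on_mult strip_cont_at[OF assms(1,3)] strip_cont_at[OF assms(2,3)])

lemma energy_nonneg:
  assumes "strip_smooth False T (\<lambda>t. A)" "strip_smooth False T U0" "strip_smooth False T U1" "strip_smooth False T U2"
    and "t \<in> {0..T}" "\<And>x. 0 \<le> A x"
  shows "0 \<le> energy \<rho> l A U0 U1 U2 t"
  unfolding energy_def
proof (rule integral_nonneg)
  show "(\<lambda>x. weight \<rho> l t x * energy_density A U0 U1 U2 t x) integrable_on {- \<rho>..\<rho>}"
    by (rule integrable_weighted[OF weight_cont(1) strip_smooth_cont[OF energy_density_smooth[OF assms(1-4)]] assms(5)])
qed (intro mult_nonneg_nonneg weight_nonneg energy_density_nonneg assms(6))

lemma wnorm_le_energy:
  assumes "strip_smooth False T (\<lambda>t. A)" "strip_smooth False T U0" "strip_smooth False T U1" "strip_smooth False T U2"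
    and "t \<in> {0..T}" "\<And>x. 0 \<le> A x"
  shows "wnorm \<rho> l U0 t \<le> energy \<rho> l A U0 U1 U2 t" "wnorm \<rho> l U1 t \<le> energy \<rho> l A U0 U1 U2 t"
    "wnorm \<rho> l U2 t \<le> energy \<rho> l A U0 U1 U2 t"
proof -
  have *: "wnorm \<rho> l v t \<le> energy \<rho> l A U0 U1 U2 t"
    if v: "strip_smooth False T v" "\<And>x. (v t x)\<^sup>2 \<le> energy_density A U0 U1 U2 t x" for v
    unfolding wnorm_def energy_def
  proof (rule integral_le)
    show "(\<lambda>x. weight \<rho> l t x * (v t x)\<^sup>2) integrable_on {- \<rho>..\<rho>}"
      by (rule integrable_weighted[OF weight_cont(1) strip_smooth_cont[OF strip_smooth_power[OF v(1)]] assms(5)])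
    show "(\<lambda>x. weight \<rho> l t x * energy_density A U0 U1 U2 t x) integrable_on {- \<rho>..\<rho>}"
      by (rule integrable_weighted[OF weight_cont(1) strip_smooth_cont[OF energy_density_smooth[OF assms(1-4)]] assms(5)])
  qed (intro mult_left_mono v(2) weight_nonneg)
  show "wnorm \<rho> l U0 t \<le> energy \<rho> l A U0 U1 U2 t" "wnorm \<rho> l U1 t \<le> energy \<rho> l A U0 U1 U2 t"
    "wnorm \<rho> l U2 t \<le> energy \<rho> l A U0 U1 U2 t"
    by (rule *; use assms in \<open>simp add: energy_density_def\<close>)+
qed

text \<open>
  The time derivative of the weighted energy consists of the derivative of the weight, the terms bounded by \<open>energy_rate_bound\<close>,
  and a total derivative in \<open>x\<close> which after integration by parts falls on the weight. The first and the last add up to something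
  nonpositive, by the choice of the weight. The rest is a Gronwall argument.
\<close>

lemma energy_estimate:
  assumes l: "0 \<le> l" and \<rho>: "0 \<le> \<rho>" and K: "0 \<le> K"
    and A: "strip_smooth False T (\<lambda>t. A)" "\<And>x. 0 \<le> A x" "\<And>x. A x \<le> l\<^sup>2"
      "\<And>x. (A has_real_derivative A' x) (at x)" "\<And>x. \<bar>A' x\<bar> \<le> K * sqrt (A x)"
    and c: "\<And>x. \<bar>b1 x\<bar> \<le> K * A x" "\<And>x. \<bar>c2 x\<bar> \<le> K * sqrt (A x)" "\<And>x. \<bar>b3 x\<bar> \<le> K"
      "\<And>x. \<bar>c4 x\<bar> \<le> K * sqrt (A x)" "\<And>x. \<bar>c5 x\<bar> \<le> K" "\<And>x. \<bar>c6 x\<bar> \<le> K"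
    and eq: "third_order_eq T A b1 c2 b3 c4 c5 c6 U0 U1 U2 U3 F"
    and M: "energy \<rho> l A U0 U1 U2 0 \<le> M" "\<And>t. t \<in> {0..T} \<Longrightarrow> wnorm \<rho> l F t \<le> M"
    and t: "t \<in> {0..T}"
  shows "energy \<rho> l A U0 U1 U2 t \<le> exp ((30 * K + 8) * T) * (1 + T) * M"
proof -
  note U = third_order_eqD(1-5)[OF eq] and dU = third_order_eqD(6-8)[OF eq] and pde = third_order_eqD(9)[OF eq]
  have T: "0 \<le> T" using t by simp
  define et where "et t x = 2 * (U2 t x - A x * dx (dx U0) t x) * (U3 t x - A x * dx (dx U1) t x) + 2 * U2 t x * U3 t x
      + 2 * A x * dx U1 t x * dx U2 t x + 2 * A x * dx U0 t x * dx U1 t x + 2 * U1 t x * U2 t x + 2 * U0 t x * U1 t x" for t x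
  define e where "e = energy_density A U0 U1 U2"
  define w where "w = weight \<rho> l"
  define wt where "wt = weight_t \<rho> l"
  define wx where "wx = weight_x \<rho> l"
  have cw: "strip_cont False T w" "strip_cont False T wt" "strip_cont False T wx"
    using weight_cont by (simp_all add: w_def wt_def wx_def)
  have se: "strip_smooth False T e" unfolding e_def by (intro energy_density_smooth A U)
  have ce: "strip_cont False T e" by (rule strip_smooth_cont[OF se])
  have "strip_smooth False T et" unfolding et_def[abs_def] by (intro strip_smooth_intros A U)
  then have cet: "strip_cont False T et" by (rule strip_smooth_cont)
  \<comment> \<open>The energy flux; its space derivative is the part of the rate that contains third derivatives.\<close>
  define J where "J = (\<lambda>t x. 2 * A x * U2 t x * dx U1 t x)"
  define J' where "J' = (\<lambda>t x. 2 * A' x * U2 t x * dx U1 t x + 2 * A x * (dx U2 t x * dx U1 t x + U2 t x * dx (dx U1) t x))"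
  have dJ: "(J s has_real_derivative J' s x) (at x)" if "s \<in> {0..T}" for s x
    unfolding J_def J'_def
    by (auto intro!: derivative_eq_intros A(4) strip_smooth_deriv[OF U(3) that]
        strip_smooth_deriv[OF strip_smooth_dx[OF U(2)] that] simp: algebra_simps)
  have det: "((\<lambda>s. w s x * e s x) has_real_derivative wt s x * e s x + w s x * et s x) (at s within {0..T})"
    if s: "s \<in> {0..T}" for s x
  proof -
    note d = dU(1) dU(2) dU(3) has_dt_dx[OF dU(1) U(1,2)] has_dt_dx[OF dU(2) U(2,3)]
      has_dt_dx[OF has_dt_dx[OF dU(1) U(1,2)] strip_smooth_dx[OF U(1)] strip_smooth_dx[OF U(2)]]
    note d' = d[unfolded has_dt_def, rule_format, OF s]
    have "((\<lambda>s. e s x) has_real_derivative et s x) (at s within {0..T})"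
      unfolding e_def energy_density_def et_def
      by (rule derivative_eq_intros d' refl)+ (simp add: algebra_simps)
    from DERIV_mult[OF weight_has_deriv_t this] show ?thesis
      by (simp add: w_def wt_def mult_ac)
  qed
  have dE: "(energy \<rho> l A U0 U1 U2 has_real_derivative integral {-\<rho>..\<rho>} (\<lambda>x. wt s x * e s x + w s x * et s x)) (at s within {0..T})"
    if s: "s \<in> {0..T}" for s
  proof -
    have "((\<lambda>s. integral (cbox (-\<rho>) \<rho>) (\<lambda>x. w s x * e s x)) has_real_derivative
        integral (cbox (-\<rho>) \<rho>) (\<lambda>x. wt s x * e s x + w s x * et s x)) (at s within {0..T})"
    proof (rule leibniz_rule_field_derivative)
      show "(\<lambda>x. w r x * e r x) integrable_on cbox (-\<rho>) \<rho>" if "r \<in> {0..T}" for r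
        using integrable_weighted[OF cw(1) ce that] by simp
      have "strip_cont False T (\<lambda>s x. wt s x * e s x + w s x * et s x)"
        by (intro strip_cont_add strip_cont_mult cw ce cet)
      then show "continuous_on ({0..T} \<times> cbox (-\<rho>) \<rho>) (\<lambda>(s, x). wt s x * e s x + w s x * et s x)"
        by (intro continuous_on_subset[OF strip_cont_continuous]) auto
    qed (use det s in auto)
    then show ?thesis by (simp add: energy_def[abs_def] w_def e_def)
  qed
  have bound: "integral {-\<rho>..\<rho>} (\<lambda>x. wt s x * e s x + w s x * et s x) \<le> (30 * K + 8) * energy \<rho> l A U0 U1 U2 s + M"
    if s: "s \<in> {0..T}" for s
  proof -
    have "((\<lambda>x. wx s x * J s x + w s x * J' s x) has_integral w s \<rho> * J s \<rho> - w s (-\<rho>) * J s (-\<rho>)) {-\<rho>..\<rho>}"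
    proof (rule fundamental_theorem_of_calculus)
      fix x
      have "((\<lambda>x. w s x * J s x) has_real_derivative wx s x * J s x + w s x * J' s x) (at x within {-\<rho>..\<rho>})"
        using DERIV_mult[OF weight_has_deriv_x[of \<rho> l s x] dJ[OF s, of x]] has_field_derivative_at_within
        by (fastforce simp: w_def wx_def mult_ac)
      then show "((\<lambda>x. w s x * J s x) has_vector_derivative wx s x * J s x + w s x * J' s x) (at x within {-\<rho>..\<rho>})"
        by (simp add: has_real_derivative_iff_has_vector_derivative)
    qed (use \<rho> in simp)
    then have J0: "((\<lambda>x. wx s x * J s x + w s x * J' s x) has_integral 0) {-\<rho>..\<rho>}"
      using s l \<rho> by (simp add: w_def weight_zero)
    have i1: "(\<lambda>x. wt s x * e s x + w s x * et s x) integrable_on {-\<rho>..\<rho>}"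
      by (intro integrable_add integrable_weighted[OF cw(2) ce s] integrable_weighted[OF cw(1) cet s])
    have iE: "((\<lambda>x. w s x * e s x) has_integral energy \<rho> l A U0 U1 U2 s) {-\<rho>..\<rho>}"
      using integrable_integral[OF integrable_weighted[OF cw(1) ce s]] by (simp add: energy_def w_def e_def)
    have "strip_cont False T (\<lambda>t x. (F t x)\<^sup>2)" by (intro strip_smooth_cont strip_smooth_power U)
    from integrable_integral[OF integrable_weighted[OF cw(1) this s]]
    have iF: "((\<lambda>x. w s x * (F s x)\<^sup>2) has_integral wnorm \<rho> l F s) {-\<rho>..\<rho>}"
      by (simp add: wnorm_def w_def)
    have "((\<lambda>x. (wt s x * e s x + w s x * et s x) - (wx s x * J s x + w s x * J' s x))
        has_integral integral {-\<rho>..\<rho>} (\<lambda>x. wt s x * e s x + w s x * et s x) - 0) {-\<rho>..\<rho>}"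
      by (rule has_integral_diff[OF integrable_integral[OF i1] J0])
    moreover have "((\<lambda>x. (30 * K + 8) * (w s x * e s x) + w s x * (F s x)\<^sup>2)
        has_integral (30 * K + 8) * energy \<rho> l A U0 U1 U2 s + wnorm \<rho> l F s) {-\<rho>..\<rho>}"
      by (intro has_integral_add has_integral_mult_right iE iF)
    moreover have "(wt s x * e s x + w s x * et s x) - (wx s x * J s x + w s x * J' s x)
        \<le> (30 * K + 8) * (w s x * e s x) + w s x * (F s x)\<^sup>2" for x
    proof -
      define R where "R = b1 x * dx (dx U0) s x + c2 x * dx U1 s x + b3 x * U2 s x + c4 x * dx U0 s x + c5 x * U1 s x + c6 x * U0 s x"
      have R: "U3 s x = A x * dx (dx U1) s x + (F s x - R)" using pde[OF s, of x] by (simp add: R_def)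
      define P where "P = 2 * ((U2 s x - A x * dx (dx U0) s x) + U2 s x) * (F s x - R)
         + 2 * A x * dx U0 s x * dx U1 s x + 2 * U1 s x * U2 s x + 2 * U0 s x * U1 s x - 2 * A' x * U2 s x * dx U1 s x"
      have split: "et s x - J' s x = P"
        unfolding et_def J'_def P_def R by (simp add: algebra_simps)
      have "P \<le> (30 * K + 8) * e s x + (F s x)\<^sup>2"
        unfolding P_def R_def
        by (rule energy_rate_bound[where s = "sqrt (A x)"]) (use A c K in \<open>auto simp: e_def energy_density_def\<close>)
      then have 1: "w s x * (et s x - J' s x) \<le> w s x * ((30 * K + 8) * e s x + (F s x)\<^sup>2)"
        unfolding split by (intro mult_left_mono) (auto simp: w_def weight_nonneg)
      have "wt s x * e s x - wx s x * J s x \<le> 0"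
      proof -
        define q where "q = sqrt (A x)"
        have q: "0 \<le> q" "q \<le> l" "A x = q\<^sup>2" using A(2,3)[of x] l by (auto simp: q_def real_le_lsqrt)
        have "\<bar>J s x\<bar> = q * (2 * \<bar>U2 s x\<bar> * \<bar>q * dx U1 s x\<bar>)"
          using q by (simp add: J_def abs_mult power2_eq_square)
        also have "\<dots> \<le> q * (\<bar>U2 s x\<bar>\<^sup>2 + \<bar>q * dx U1 s x\<bar>\<^sup>2)"
          by (intro mult_left_mono sum_squares_bound q)
        also have "\<dots> \<le> q * e s x"
          using q A(2)[of x] by (intro mult_left_mono) (auto simp: e_def energy_density_def power_mult_distrib)
        also have "\<dots> \<le> l * e s x"
          using q A(2) by (intro mult_right_mono) (auto simp: e_def energy_density_nonneg)
        finally have J: "\<bar>J s x\<bar> \<le> l * e s x" .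
        have "- wx s x * J s x \<le> \<bar>wx s x\<bar> * \<bar>J s x\<bar>" by (metis abs_ge_self abs_minus_cancel abs_mult)
        also have "\<dots> \<le> \<bar>wx s x\<bar> * (l * e s x)" by (intro mult_left_mono J) auto
        also have "\<dots> = (\<bar>wx s x\<bar> * l) * e s x" by simp
        also have "\<dots> \<le> (- wt s x) * e s x"
          using weight_flux[OF l, of \<rho> s x] A(2) by (intro mult_right_mono) (auto simp: wx_def wt_def e_def energy_density_nonneg)
        finally show ?thesis by simp
      qed
      with 1 show ?thesis by (simp add: algebra_simps)
    qed
    ultimately have "integral {-\<rho>..\<rho>} (\<lambda>x. wt s x * e s x + w s x * et s x) - 0
        \<le> (30 * K + 8) * energy \<rho> l A U0 U1 U2 s + wnorm \<rho> l F s"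
      by (rule has_integral_le)
    with M(2)[OF s] show ?thesis by simp
  qed
  have "0 \<le> energy \<rho> l A U0 U1 U2 0" by (intro energy_nonneg[of T] A U) (use T in auto)
  then have "0 \<le> M" using M(1) by simp
  show ?thesis
    by (rule gronwall[OF dE bound _ \<open>0 \<le> M\<close> M(1) t]) (use K in auto)
qed

section \<open>Energy estimates of every order\<close>

text \<open>
  The class of equations is closed under \<open>d/dx\<close>. The coefficient \<open>c2\<close> changes by \<open>- A'\<close> and \<open>c4\<close> by \<open>b1'\<close>, both of which are bounded by a
  multiple of \<open>\<surd>A\<close> under the hypotheses of the theorem; the terms that cannot be expressed by \<open>dx U0\<close>, \<open>dx U1\<close>, \<open>dx U2\<close> have lower order and
  are moved to the right-hand side.
\<close>

lemma third_order_eq_dx: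
  assumes eq: "third_order_eq T A b1 c2 b3 c4 c5 c6 U0 U1 U2 U3 F"
    and A: "\<And>x. (A has_real_derivative A' x) (at x)"
    and b: "smooth b1" "smooth c2" "smooth b3" "smooth c4" "smooth c5" "smooth c6"
  shows "third_order_eq T A b1 (\<lambda>x. c2 x - A' x) b3 (\<lambda>x. c4 x + deriv b1 x) (\<lambda>x. c5 x + deriv c2 x) (\<lambda>x. c6 x + deriv c4 x)
     (dx U0) (dx U1) (dx U2) (dx U3)
     (\<lambda>t x. dx F t x - (deriv b3 x * U2 t x + deriv c5 x * U1 t x + deriv c6 x * U0 t x))"
proof -
  note U = third_order_eqD(1-5)[OF eq] and dU = third_order_eqD(6-8)[OF eq] and pde = third_order_eqD(9)[OF eq]
  have db: "(\<beta> has_real_derivative deriv \<beta> x) (at x)" "strip_smooth False T (\<lambda>t. deriv \<beta>)" if "smooth \<beta>" for \<beta> x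
    using smooth_deriv[OF that, of 0] strip_smooth_timefree[of "deriv \<beta>" T] smooth_iff[of \<beta>] that by auto
  have "dx U3 t x - A x * dx (dx (dx U1)) t x + b1 x * dx (dx (dx U0)) t x + (c2 x - A' x) * dx (dx U1) t x
        + b3 x * dx U2 t x + (c4 x + deriv b1 x) * dx (dx U0) t x + (c5 x + deriv c2 x) * dx U1 t x + (c6 x + deriv c4 x) * dx U0 t x
      = dx F t x - (deriv b3 x * U2 t x + deriv c5 x * U1 t x + deriv c6 x * U0 t x)" if t: "t \<in> {0..T}" for t x
  proof -
    note d0 = strip_smooth_deriv[OF U(1) t] strip_smooth_deriv[OF strip_smooth_dx[OF U(1)] t] strip_smooth_deriv[OF strip_smooth_dx[OF strip_smooth_dx[OF U(1)]] t]
    note d1 = strip_smooth_deriv[OF U(2) t] strip_smooth_deriv[OF strip_smooth_dx[OF U(2)] t] strip_smooth_deriv[OF strip_smooth_dx[OF strip_smooth_dx[OF U(2)]] t]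
    note d2 = strip_smooth_deriv[OF U(3) t] strip_smooth_deriv[OF U(4) t]
    note DB = b[THEN db(1)]
    have "((\<lambda>x. U3 t x - A x * dx (dx U1) t x + b1 x * dx (dx U0) t x + c2 x * dx U1 t x
        + b3 x * U2 t x + c4 x * dx U0 t x + c5 x * U1 t x + c6 x * U0 t x) has_real_derivative
        dx U3 t x - (A' x * dx (dx U1) t x + dx (dx (dx U1)) t x * A x) + (deriv b1 x * dx (dx U0) t x + dx (dx (dx U0)) t x * b1 x)
        + (deriv c2 x * dx U1 t x + dx (dx U1) t x * c2 x) + (deriv b3 x * U2 t x + dx U2 t x * b3 x)
        + (deriv c4 x * dx U0 t x + dx (dx U0) t x * c4 x) + (deriv c5 x * U1 t x + dx U1 t x * c5 x)
        + (deriv c6 x * U0 t x + dx U0 t x * c6 x)) (at x)"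
      by (intro DERIV_add DERIV_diff DERIV_mult A DB d0 d1 d2)
    then have "(F t has_real_derivative
        dx U3 t x - (A' x * dx (dx U1) t x + dx (dx (dx U1)) t x * A x) + (deriv b1 x * dx (dx U0) t x + dx (dx (dx U0)) t x * b1 x)
        + (deriv c2 x * dx U1 t x + dx (dx U1) t x * c2 x) + (deriv b3 x * U2 t x + dx U2 t x * b3 x)
        + (deriv c4 x * dx U0 t x + dx (dx U0) t x * c4 x) + (deriv c5 x * U1 t x + dx U1 t x * c5 x)
        + (deriv c6 x * U0 t x + dx U0 t x * c6 x)) (at x)"
      by (simp add: pde[OF t])
    from DERIV_unique[OF strip_smooth_deriv[OF U(5) t] this] show ?thesis
      by (simp add: algebra_simps)
  qed
  then show ?thesis
    unfolding third_order_eq_def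
    by (intro conjI ballI allI strip_smooth_intros U b[THEN db(2)] has_dt_dx[OF dU(1) U(1,2)] has_dt_dx[OF dU(2) U(2,3)]
        has_dt_dx[OF dU(3) U(3,4)])
qed

lemma integral_weighted_le:
  assumes "strip_smooth False T v" "strip_smooth False T w" "t \<in> {0..T}" "\<And>x. (v t x)\<^sup>2 \<le> w t x"
  shows "wnorm \<rho> l v t \<le> integral {-\<rho>..\<rho>} (\<lambda>x. weight \<rho> l t x * w t x)"
  unfolding wnorm_def
proof (rule integral_le)
  show "(\<lambda>x. weight \<rho> l t x * (v t x)\<^sup>2) integrable_on {- \<rho>..\<rho>}"
    by (rule integrable_weighted[OF weight_cont(1) strip_smooth_cont[OF strip_smooth_power[OF assms(1)]] assms(3)])
  show "(\<lambda>x. weight \<rho> l t x * w t x) integrable_on {- \<rho>..\<rho>}"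
    by (rule integrable_weighted[OF weight_cont(1) strip_smooth_cont[OF assms(2)] assms(3)])
qed (intro mult_left_mono assms(4) weight_nonneg)

lemma wnorm_integral:
  assumes "strip_smooth False T v" "t \<in> {0..T}"
  shows "((\<lambda>x. weight \<rho> l t x * (v t x)\<^sup>2) has_integral wnorm \<rho> l v t) {-\<rho>..\<rho>}"
  unfolding wnorm_def
  by (rule integrable_integral)
    (rule integrable_weighted[OF weight_cont(1) strip_smooth_cont[OF strip_smooth_power[OF assms(1)]] assms(2)])

lemma wnorm_sum_bound:
  fixes c M :: real
  assumes v: "strip_smooth False T v" and u: "\<And>i. i \<in> I \<Longrightarrow> strip_smooth False T (u i)" and I: "finite I"
    and t: "t \<in> {0..T}" and le: "\<And>x. (v t x)\<^sup>2 \<le> c * (\<Sum>i\<in>I. (u i t x)\<^sup>2)" and c: "0 \<le> c"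
    and M: "\<And>i. i \<in> I \<Longrightarrow> wnorm \<rho> l (u i) t \<le> M"
  shows "wnorm \<rho> l v t \<le> c * (card I * M)"
proof -
  have "strip_smooth False T (\<lambda>t x. c * (\<Sum>i\<in>I. (u i t x)\<^sup>2))"
    by (intro strip_smooth_mult strip_smooth_const strip_smooth_sum strip_smooth_power u)
  from integral_weighted_le[OF v this t le]
  have "wnorm \<rho> l v t \<le> integral {-\<rho>..\<rho>} (\<lambda>x. weight \<rho> l t x * (c * (\<Sum>i\<in>I. (u i t x)\<^sup>2)))" .
  also have "\<dots> = c * (\<Sum>i\<in>I. wnorm \<rho> l (u i) t)"
  proof (rule integral_unique)
    have "((\<lambda>x. c * (\<Sum>i\<in>I. weight \<rho> l t x * (u i t x)\<^sup>2)) has_integral c * (\<Sum>i\<in>I. wnorm \<rho> l (u i) t)) {-\<rho>..\<rho>}"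
      by (intro has_integral_mult_right has_integral_sum I wnorm_integral[OF u t])
    then show "((\<lambda>x. weight \<rho> l t x * (c * (\<Sum>i\<in>I. (u i t x)\<^sup>2))) has_integral c * (\<Sum>i\<in>I. wnorm \<rho> l (u i) t)) {-\<rho>..\<rho>}"
      by (simp add: sum_distrib_left mult_ac)
  qed
  also have "\<dots> \<le> c * (card I * M)"
    using sum_bounded_above[of I "\<lambda>i. wnorm \<rho> l (u i) t" M] M c by (intro mult_left_mono) auto
  finally show ?thesis .
qed

lemma wnorm_dxn_mult_bound:
  assumes b: "strip_smooth True T (\<lambda>t. b)"
  shows "\<exists>C\<ge>0. \<forall>v t M. strip_smooth False T v \<longrightarrow> t \<in> {0..T} \<longrightarrow> (\<forall>j\<le>k. wnorm \<rho> l ((dx ^^ j) v) t \<le> M) \<longrightarrow>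
      wnorm \<rho> l ((dx ^^ k) (\<lambda>t x. b x * v t x)) t \<le> C * M"
proof -
  obtain C where C: "C \<ge> 0" "\<And>v t x M. strip_smooth False T v \<Longrightarrow> t \<in> {0..T} \<Longrightarrow> (\<forall>j\<le>k. \<bar>(dx ^^ j) v t x\<bar> \<le> M) \<Longrightarrow>
      \<bar>(dx ^^ k) (\<lambda>t x. b x * v t x) t x\<bar> \<le> C * M"
    using dxn_mult_bound[OF b, of k] by blast
  show ?thesis
  proof (intro exI[of _ "C\<^sup>2 * card {..k}"] conjI allI impI)
    fix v t M assume v: "strip_smooth False T v" and t: "t \<in> {0..T}" and M: "\<forall>j\<le>k. wnorm \<rho> l ((dx ^^ j) v) t \<le> M"
    have "wnorm \<rho> l ((dx ^^ k) (\<lambda>t x. b x * v t x)) t \<le> C\<^sup>2 * (card {..k} * M)"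
    proof (rule wnorm_sum_bound[OF _ _ _ t])
      show "strip_smooth False T ((dx ^^ k) (\<lambda>t x. b x * v t x))"
        by (intro strip_smooth_intros v strip_smooth_unbounded[OF b])
      show "strip_smooth False T ((dx ^^ j) v)" for j by (intro strip_smooth_dxn v)
      show "((dx ^^ k) (\<lambda>t x. b x * v t x) t x)\<^sup>2 \<le> C\<^sup>2 * (\<Sum>j\<le>k. ((dx ^^ j) v t x)\<^sup>2)" for x
      proof -
        define S where "S = (\<Sum>j\<le>k. ((dx ^^ j) v t x)\<^sup>2)"
        have S: "0 \<le> S" unfolding S_def by (intro sum_nonneg) auto
        have "\<bar>(dx ^^ j) v t x\<bar> \<le> sqrt S" if "j \<le> k" for j
        proof -
          have "((dx ^^ j) v t x)\<^sup>2 \<le> S" unfolding S_def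
            by (rule member_le_sum[of j "{..k}" "\<lambda>j. ((dx ^^ j) v t x)\<^sup>2"]) (use that in auto)
          then show ?thesis by (metis real_le_rsqrt power2_abs)
        qed
        then have "\<bar>(dx ^^ k) (\<lambda>t x. b x * v t x) t x\<bar> \<le> C * sqrt S" using C(2)[OF v t] by blast
        then have "\<bar>(dx ^^ k) (\<lambda>t x. b x * v t x) t x\<bar>\<^sup>2 \<le> (C * sqrt S)\<^sup>2" by (intro power_mono) auto
        then show ?thesis using S by (simp add: power_mult_distrib S_def)
      qed
    qed (use C M in auto)
    then show "wnorm \<rho> l ((dx ^^ k) (\<lambda>t x. b x * v t x)) t \<le> C\<^sup>2 * card {..k} * M" by (simp add: mult.assoc)
  qed simp
qed

lemma wnorm_cmult:
  shows "wnorm \<rho> l (\<lambda>t x. c * v t x) t = c\<^sup>2 * wnorm \<rho> l v t"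
proof -
  have "(\<lambda>x. weight \<rho> l t x * (c * v t x)\<^sup>2) = (\<lambda>x. c\<^sup>2 * (weight \<rho> l t x * (v t x)\<^sup>2))"
    by (simp add: power_mult_distrib mult_ac)
  then show ?thesis unfolding wnorm_def by simp
qed

lemma wnorm_cong: "v t = w t \<Longrightarrow> wnorm \<rho> l v t = wnorm \<rho> l w t"
  by (simp add: wnorm_def)

text \<open>
  The conditions on the coefficients that change under differentiation. The symbol has a multiple root where \<open>a\<close> vanishes, and there the
  terms \<open>c2 U1_x\<close> and \<open>c4 U0_x\<close> must vanish to half the order of \<open>a\<close>.
\<close>

definition levi_coeffs :: "real \<Rightarrow> (real \<Rightarrow> real) \<Rightarrow> (real \<Rightarrow> real) \<Rightarrow> (real \<Rightarrow> real) \<Rightarrow> (real \<Rightarrow> real) \<Rightarrow> (real \<Rightarrow> real) \<Rightarrow> bool" where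
  "levi_coeffs T a c2 c4 c5 c6 \<longleftrightarrow>
     strip_smooth True T (\<lambda>t. c2) \<and> strip_smooth True T (\<lambda>t. c4) \<and> strip_smooth True T (\<lambda>t. c5) \<and> strip_smooth True T (\<lambda>t. c6) \<and>
     (\<exists>K. \<forall>x. \<bar>c2 x\<bar> \<le> K * sqrt (a x) \<and> \<bar>c4 x\<bar> \<le> K * sqrt (a x))"

text \<open>
  One constant for all \<open>\<epsilon>\<close> in \<open>[0,1]\<close>: this uniformity allows the limit \<open>\<epsilon> \<rightarrow> 0\<close>.
\<close>

definition energy_bound_const where
  "energy_bound_const T \<rho> l a b1 c2 b3 c4 c5 c6 n C \<longleftrightarrow> (\<forall>\<epsilon>\<in>{0..1}. \<forall>U0 U1 U2 U3 F M.
      third_order_eq T (\<lambda>x. a x + \<epsilon>) b1 c2 b3 c4 c5 c6 U0 U1 U2 U3 F \<longrightarrow>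
      (\<forall>k\<le>n. energy_n \<rho> l a \<epsilon> k U0 U1 U2 0 \<le> M) \<longrightarrow>
      (\<forall>k\<le>n. \<forall>t\<in>{0..T}. wnorm \<rho> l ((dx ^^ k) F) t \<le> M) \<longrightarrow>
      (\<forall>k\<le>n. \<forall>t\<in>{0..T}. energy_n \<rho> l a \<epsilon> k U0 U1 U2 t \<le> C * M))"

lemma energy_bound_constD:
  assumes "energy_bound_const T \<rho> l a b1 c2 b3 c4 c5 c6 n C" "\<epsilon> \<in> {0..1}"
    and "third_order_eq T (\<lambda>x. a x + \<epsilon>) b1 c2 b3 c4 c5 c6 U0 U1 U2 U3 F"
    and "\<And>k. k \<le> n \<Longrightarrow> energy_n \<rho> l a \<epsilon> k U0 U1 U2 0 \<le> M"
    and "\<And>k t. k \<le> n \<Longrightarrow> t \<in> {0..T} \<Longrightarrow> wnorm \<rho> l ((dx ^^ k) F) t \<le> M"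
    and "k \<le> n" "t \<in> {0..T}"
  shows "energy_n \<rho> l a \<epsilon> k U0 U1 U2 t \<le> C * M"
proof -
  note 1 = assms(1)[unfolded energy_bound_const_def, rule_format, OF assms(2,3)]
  show ?thesis by (rule 1[OF assms(4,5,6,7)])
qed

text \<open>
  Induction over the order for all coefficients in the class simultaneously. For order \<open>n + 1\<close> the estimate of order \<open>n\<close> is
  applied twice: to the given solution, which bounds the lower order terms on the right-hand side of the differentiated equation, and
  then to the space derivative of the solution.
\<close>

lemma higher_energy_estimate:
  assumes T: "0 \<le> T" and l: "0 \<le> l" and \<rho>: "0 \<le> \<rho>"
    and a: "strip_smooth True T (\<lambda>t. a)" "\<And>x. 0 \<le> a x" "\<And>x. a x + 1 \<le> l\<^sup>2"
    and b: "strip_smooth True T (\<lambda>t. b1)" "strip_smooth True T (\<lambda>t. b3)"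
    and K: "\<And>x. \<bar>deriv a x\<bar> \<le> K * sqrt (a x)" "\<And>x. \<bar>b1 x\<bar> \<le> K * a x" "\<And>x. \<bar>deriv b1 x\<bar> \<le> K * sqrt (a x)"
    and "levi_coeffs T a c2 c4 c5 c6"
  shows "\<exists>C\<ge>0. energy_bound_const T \<rho> l a b1 c2 b3 c4 c5 c6 n C"
  using assms(12)
proof (induction n arbitrary: c2 c4 c5 c6)
  case 0
  have bnd: "\<exists>N. \<forall>x. \<bar>\<beta> x\<bar> \<le> N" if "strip_smooth True T (\<lambda>t. \<beta>)" for \<beta>
    using strip_smooth_cont[OF that] T by (auto simp: strip_cont_def)
  obtain K2 where K2: "\<And>x. \<bar>c2 x\<bar> \<le> K2 * sqrt (a x)" "\<And>x. \<bar>c4 x\<bar> \<le> K2 * sqrt (a x)"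
    using 0 unfolding levi_coeffs_def by blast
  obtain N3 N5 N6 where N: "\<And>x. \<bar>b3 x\<bar> \<le> N3" "\<And>x. \<bar>c5 x\<bar> \<le> N5" "\<And>x. \<bar>c6 x\<bar> \<le> N6"
    using bnd[OF b(2)] bnd[of c5] bnd[of c6] 0 unfolding levi_coeffs_def by blast
  define L where "L = \<bar>K\<bar> + \<bar>K2\<bar> + \<bar>N3\<bar> + \<bar>N5\<bar> + \<bar>N6\<bar>"
  have L: "0 \<le> L" "K \<le> L" "K2 \<le> L" "N3 \<le> L" "N5 \<le> L" "N6 \<le> L" by (auto simp: L_def)
  show ?case
    unfolding energy_bound_const_def
  proof (intro exI[of _ "exp ((30 * L + 8) * T) * (1 + T)"] conjI ballI allI impI)
    fix \<epsilon> U0 U1 U2 U3 F M k t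
    assume e: "\<epsilon> \<in> {0..1}" and eq: "third_order_eq T (\<lambda>x. a x + \<epsilon>) b1 c2 b3 c4 c5 c6 U0 U1 U2 U3 F"
      and E0: "\<forall>k\<le>0. energy_n \<rho> l a \<epsilon> k U0 U1 U2 0 \<le> M"
      and F: "\<forall>k\<le>0. \<forall>t\<in>{0..T}. wnorm \<rho> l ((dx ^^ k) F) t \<le> M" and k: "k \<le> (0::nat)" and t: "t \<in> {0..T}"
    have up: "g \<le> L * sqrt (a x + \<epsilon>)" if "g \<le> k * sqrt (a x)" "k \<le> L" for g k x
    proof -
      have "k * sqrt (a x) \<le> L * sqrt (a x + \<epsilon>)"
        using that(2) L(1) a(2)[of x] e by (intro mult_mono) auto
      with that show ?thesis by simp
    qed
    have up1: "\<bar>b1 x\<bar> \<le> L * (a x + \<epsilon>)" for x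
    proof -
      have "K * a x \<le> L * (a x + \<epsilon>)" using L a(2)[of x] e by (intro mult_mono) auto
      with K(2)[of x] show ?thesis by simp
    qed
    have "energy \<rho> l (\<lambda>x. a x + \<epsilon>) U0 U1 U2 t \<le> exp ((30 * L + 8) * T) * (1 + T) * M"
    proof (rule energy_estimate[OF l \<rho> L(1), where A' = "deriv a", OF _ _ _ _ _ _ _ _ _ _ _ eq _ _ t])
      show "strip_smooth False T (\<lambda>t x. a x + \<epsilon>)"
        by (intro strip_smooth_intros strip_smooth_unbounded[OF a(1)])
      show "0 \<le> a x + \<epsilon>" "a x + \<epsilon> \<le> l\<^sup>2" for x using a(2,3)[of x] e by auto
      have "(a has_real_derivative deriv a x) (at x)" for x
        using strip_smooth_deriv[OF a(1), of 0] T by (simp add: dx_def)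
      then show "((\<lambda>x. a x + \<epsilon>) has_real_derivative deriv a x) (at x)" for x
        by (auto intro!: derivative_eq_intros)
      show "\<bar>b3 x\<bar> \<le> L" "\<bar>c5 x\<bar> \<le> L" "\<bar>c6 x\<bar> \<le> L" for x
        using N(1)[of x] N(2)[of x] N(3)[of x] L by auto
      show "\<bar>deriv a x\<bar> \<le> L * sqrt (a x + \<epsilon>)" for x by (rule up[OF K(1) L(2)])
      show "\<bar>c2 x\<bar> \<le> L * sqrt (a x + \<epsilon>)" "\<bar>c4 x\<bar> \<le> L * sqrt (a x + \<epsilon>)" for x
        by (rule up[OF K2(1) L(3)], rule up[OF K2(2) L(3)])
    qed (use up1 E0 F in auto)
    then show "energy_n \<rho> l a \<epsilon> k U0 U1 U2 t \<le> exp ((30 * L + 8) * T) * (1 + T) * M"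
      using k by simp
  qed (use T in simp)
next
  case (Suc n)
  note lev = Suc.prems[unfolded levi_coeffs_def]
  obtain K2 where K2: "\<And>x. \<bar>c2 x\<bar> \<le> K2 * sqrt (a x)" "\<And>x. \<bar>c4 x\<bar> \<le> K2 * sqrt (a x)"
    using lev by blast
  have sd: "strip_smooth True T (\<lambda>t. deriv \<beta>)" if "strip_smooth True T (\<lambda>t. \<beta>)" for \<beta>
    using strip_smooth_dx[OF that] by (simp add: dx_def)
  have sm: "smooth \<beta>" if "strip_smooth True T (\<lambda>t. \<beta>)" for \<beta>
    using strip_smooth_smooth[OF that, of 0] T by simp
  have "levi_coeffs T a (\<lambda>x. c2 x - deriv a x) (\<lambda>x. c4 x + deriv b1 x) (\<lambda>x. c5 x + deriv c2 x) (\<lambda>x. c6 x + deriv c4 x)"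
    unfolding levi_coeffs_def
  proof (intro conjI exI[of _ "K2 + K"] allI)
    show "\<bar>c2 x - deriv a x\<bar> \<le> (K2 + K) * sqrt (a x)" for x
      using K2(1)[of x] K(1)[of x] by (simp add: ring_distribs)
    show "\<bar>c4 x + deriv b1 x\<bar> \<le> (K2 + K) * sqrt (a x)" for x
      using K2(2)[of x] K(3)[of x] by (simp add: ring_distribs)
  qed (intro strip_smooth_intros sd a(1) b(1), use lev in auto)+
  from Suc.IH[OF this] obtain D where D: "D \<ge> 0"
    "energy_bound_const T \<rho> l a b1 (\<lambda>x. c2 x - deriv a x) b3 (\<lambda>x. c4 x + deriv b1 x) (\<lambda>x. c5 x + deriv c2 x) (\<lambda>x. c6 x + deriv c4 x) n D"
    by blast
  from Suc.IH[OF Suc.prems] obtain C where C: "C \<ge> 0" "energy_bound_const T \<rho> l a b1 c2 b3 c4 c5 c6 n C"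
    by blast
  have "\<exists>H\<ge>0. \<forall>k\<le>n. \<forall>v t M. strip_smooth False T v \<longrightarrow> t \<in> {0..T} \<longrightarrow> 0 \<le> M \<longrightarrow> (\<forall>j\<le>k. wnorm \<rho> l ((dx ^^ j) v) t \<le> M) \<longrightarrow>
      wnorm \<rho> l ((dx ^^ k) (\<lambda>t x. \<beta> x * v t x)) t \<le> H * M" if \<beta>: "strip_smooth True T (\<lambda>t. \<beta>)" for \<beta>
  proof -
    define Q where "Q k H \<longleftrightarrow> (\<forall>v t M. strip_smooth False T v \<longrightarrow> t \<in> {0..T} \<longrightarrow> 0 \<le> M \<longrightarrow> (\<forall>j\<le>k. wnorm \<rho> l ((dx ^^ j) v) t \<le> M) \<longrightarrow>
      wnorm \<rho> l ((dx ^^ k) (\<lambda>t x. \<beta> x * v t x)) t \<le> H * M)" for k H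
    have "\<exists>H\<ge>0. \<forall>k\<in>{..n}. Q k H"
    proof (rule finite_uniform_constant)
      show "\<exists>H. Q k H" for k using wnorm_dxn_mult_bound[OF \<beta>, of k \<rho> l] unfolding Q_def by blast
      show "Q k H'" if "Q k H" "H \<le> H'" for k H H'
        using that mult_right_mono[OF that(2)] unfolding Q_def by (meson order_trans)
    qed simp
    then show ?thesis unfolding Q_def by (simp only: Ball_def atMost_iff)
  qed
  note H = this
  obtain H3 where H3: "H3 \<ge> 0" "\<And>k v t M. k \<le> n \<Longrightarrow> strip_smooth False T v \<Longrightarrow> t \<in> {0..T} \<Longrightarrow> 0 \<le> M \<Longrightarrow> (\<forall>j\<le>k. wnorm \<rho> l ((dx ^^ j) v) t \<le> M) \<Longrightarrow>
      wnorm \<rho> l ((dx ^^ k) (\<lambda>t x. deriv b3 x * v t x)) t \<le> H3 * M" using H[OF sd[OF b(2)]] by blast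
  obtain H5 where H5: "H5 \<ge> 0" "\<And>k v t M. k \<le> n \<Longrightarrow> strip_smooth False T v \<Longrightarrow> t \<in> {0..T} \<Longrightarrow> 0 \<le> M \<Longrightarrow> (\<forall>j\<le>k. wnorm \<rho> l ((dx ^^ j) v) t \<le> M) \<Longrightarrow>
      wnorm \<rho> l ((dx ^^ k) (\<lambda>t x. deriv c5 x * v t x)) t \<le> H5 * M" using H[OF sd[of c5]] lev by blast
  obtain H6 where H6: "H6 \<ge> 0" "\<And>k v t M. k \<le> n \<Longrightarrow> strip_smooth False T v \<Longrightarrow> t \<in> {0..T} \<Longrightarrow> 0 \<le> M \<Longrightarrow> (\<forall>j\<le>k. wnorm \<rho> l ((dx ^^ j) v) t \<le> M) \<Longrightarrow>
      wnorm \<rho> l ((dx ^^ k) (\<lambda>t x. deriv c6 x * v t x)) t \<le> H6 * M" using H[OF sd[of c6]] lev by blast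
  define H where "H = 1 + H3 * C + H5 * C + H6 * C"
  define G where "G = 4 * (4 * H)"
  have G: "1 \<le> G" unfolding G_def H_def using H3(1) H5(1) H6(1) C(1) by (simp add: add_nonneg_nonneg mult_nonneg_nonneg)
  show ?case
    unfolding energy_bound_const_def
  proof (intro exI[of _ "C + D * G"] conjI ballI allI impI)
    show "0 \<le> C + D * G" using C D G by simp
    fix \<epsilon> U0 U1 U2 U3 F M k t
    assume e: "\<epsilon> \<in> {0..1}" and eq: "third_order_eq T (\<lambda>x. a x + \<epsilon>) b1 c2 b3 c4 c5 c6 U0 U1 U2 U3 F"
      and E0: "\<forall>k\<le>Suc n. energy_n \<rho> l a \<epsilon> k U0 U1 U2 0 \<le> M"
      and F: "\<forall>k\<le>Suc n. \<forall>t\<in>{0..T}. wnorm \<rho> l ((dx ^^ k) F) t \<le> M" and k: "k \<le> Suc n" and t: "t \<in> {0..T}"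
    note U = third_order_eqD(1-3,5)[OF eq]
    have sA: "strip_smooth False T (\<lambda>t x. a x + \<epsilon>)" by (intro strip_smooth_intros strip_smooth_unbounded[OF a(1)])
    have A0: "0 \<le> a x + \<epsilon>" for x using a(2)[of x] e by simp
    have "0 \<le> energy \<rho> l (\<lambda>x. a x + \<epsilon>) U0 U1 U2 0" by (intro energy_nonneg[of T] sA U A0) (use T in auto)
    moreover have "energy \<rho> l (\<lambda>x. a x + \<epsilon>) U0 U1 U2 0 \<le> M" using E0 by (metis funpow_0 le0)
    ultimately have M: "0 \<le> M" by linarith
    have low: "energy_n \<rho> l a \<epsilon> j U0 U1 U2 s \<le> C * M"
      if "j \<le> n" "s \<in> {0..T}" for j s
      by (rule energy_bound_constD[OF C(2) e eq _ _ that]) (use E0 F in auto)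
    have lowN: "wnorm \<rho> l ((dx ^^ j) U0) s \<le> C * M" "wnorm \<rho> l ((dx ^^ j) U1) s \<le> C * M" "wnorm \<rho> l ((dx ^^ j) U2) s \<le> C * M"
      if "j \<le> n" "s \<in> {0..T}" for j s
      using wnorm_le_energy[OF sA strip_smooth_dxn[OF U(1), of j] strip_smooth_dxn[OF U(2), of j] strip_smooth_dxn[OF U(3), of j] that(2) A0, of \<rho> l]
        low[OF that] by (meson order_trans)+
    have CM: "0 \<le> C * M" using C M by simp
    have da: "((\<lambda>x. a x + \<epsilon>) has_real_derivative deriv a x) (at x)" for x
      using strip_smooth_deriv[OF a(1), of 0 x] T by (auto simp: dx_def intro!: derivative_eq_intros)
    define F' where "F' = (\<lambda>t x. dx F t x - (deriv b3 x * U2 t x + deriv c5 x * U1 t x + deriv c6 x * U0 t x))"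
    have eq': "third_order_eq T (\<lambda>x. a x + \<epsilon>) b1 (\<lambda>x. c2 x - deriv a x) b3 (\<lambda>x. c4 x + deriv b1 x) (\<lambda>x. c5 x + deriv c2 x) (\<lambda>x. c6 x + deriv c4 x)
        (dx U0) (dx U1) (dx U2) (dx U3) F'"
      unfolding F'_def by (rule third_order_eq_dx[OF eq da]) (use lev b sm in auto)
    have F': "wnorm \<rho> l ((dx ^^ j) F') s \<le> G * M" if j: "j \<le> n" and s: "s \<in> {0..T}" for j s
    proof -
      define u where "u i = (if i = 0 then (dx ^^ j) (dx F) else if i = 1 then (dx ^^ j) (\<lambda>t x. deriv b3 x * U2 t x)
        else if i = 2 then (dx ^^ j) (\<lambda>t x. deriv c5 x * U1 t x) else (dx ^^ j) (\<lambda>t x. deriv c6 x * U0 t x))" for i :: nat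
      have sB: "strip_smooth False T (\<lambda>t x. deriv b3 x * U2 t x)" "strip_smooth False T (\<lambda>t x. deriv c5 x * U1 t x)"
          "strip_smooth False T (\<lambda>t x. deriv c6 x * U0 t x)" "strip_smooth False T (dx F)"
        using lev by (intro strip_smooth_mult strip_smooth_dx U strip_smooth_unbounded[OF sd] b; blast)+
      have "wnorm \<rho> l ((dx ^^ j) F') s \<le> 4 * (card {..<4::nat} * (H * M))"
      proof (rule wnorm_sum_bound[where u = u, OF _ _ _ s])
        show "strip_smooth False T ((dx ^^ j) F')" using eq' by (intro strip_smooth_dxn) (rule third_order_eqD)
        show "strip_smooth False T (u i)" for i unfolding u_def using sB by (auto intro!: strip_smooth_dxn)
        have "(dx ^^ j) F' s = (\<lambda>x. u 0 s x - (u 1 s x + u 2 s x + u 3 s x))"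
          using dxn_diff[OF sB(4) strip_smooth_add[OF strip_smooth_add[OF sB(1,2)] sB(3)] s, of j]
            dxn_add[OF strip_smooth_add[OF sB(1,2)] sB(3) s, of j] dxn_add[OF sB(1,2) s, of j]
          by (simp add: u_def F'_def)
        moreover have "(p - (q + r + v))\<^sup>2 \<le> 4 * (p\<^sup>2 + q\<^sup>2 + r\<^sup>2 + v\<^sup>2)" for p q r v :: real
        proof -
          have "0 \<le> (p + q)\<^sup>2 + (p + r)\<^sup>2 + (p + v)\<^sup>2 + (q - r)\<^sup>2 + (q - v)\<^sup>2 + (r - v)\<^sup>2" by simp
          then show ?thesis by (simp add: power2_eq_square algebra_simps)
        qed
        ultimately show "((dx ^^ j) F' s x)\<^sup>2 \<le> 4 * (\<Sum>i<4. (u i s x)\<^sup>2)" for x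
          by (simp add: eval_nat_numeral)
        have "H3 * (C * M) \<le> H * M" "H5 * (C * M) \<le> H * M" "H6 * (C * M) \<le> H * M" "M \<le> H * M"
          using H3(1) H5(1) H6(1) CM M C(1) by (simp_all add: H_def ring_distribs mult.assoc)
        moreover have "wnorm \<rho> l (u 0) s \<le> M" using F[rule_format, of "Suc j" s] j s by (simp add: u_def funpow_swap1)
        moreover have "wnorm \<rho> l (u 1) s \<le> H3 * (C * M)" "wnorm \<rho> l (u 2) s \<le> H5 * (C * M)" "wnorm \<rho> l (u 3) s \<le> H6 * (C * M)"
          unfolding u_def using H3(2)[OF j U(3) s CM] H5(2)[OF j U(2) s CM] H6(2)[OF j U(1) s CM] lowN j s by auto
        ultimately show "wnorm \<rho> l (u i) s \<le> H * M" if "i \<in> {..<4}" for i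
          using that by (auto simp: eval_nat_numeral less_Suc_eq)
      qed auto
      then show ?thesis by (simp add: G_def)
    qed
    have MG: "M \<le> G * M" using mult_right_mono[OF G M] by simp
    have high: "energy_n \<rho> l a \<epsilon> j (dx U0) (dx U1) (dx U2) t \<le> D * (G * M)"
      if "j \<le> n" for j
    proof (rule energy_bound_constD[OF D(2) e eq' _ _ that t])
      show "energy_n \<rho> l a \<epsilon> k (dx U0) (dx U1) (dx U2) 0 \<le> G * M" if "k \<le> n" for k
        using E0[rule_format, of "Suc k"] MG that by (simp add: funpow_swap1)
      show "wnorm \<rho> l ((dx ^^ k) F') t \<le> G * M" if "k \<le> n" "t \<in> {0..T}" for k t by (rule F'[OF that])
    qed
    show "energy_n \<rho> l a \<epsilon> k U0 U1 U2 t \<le> (C + D * G) * M"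
    proof (cases k)
      case 0
      have "0 \<le> D * G * M" using D G M by simp
      with low[of 0 t] t 0 show ?thesis by (simp add: ring_distribs)
    next
      case (Suc j)
      with high[of j] k CM show ?thesis by (simp add: ring_distribs funpow_swap1 mult_ac)
    qed
  qed
qed

section \<open>Pointwise bounds\<close>

text \<open>
  A one-dimensional Sobolev inequality. On \<open>[-R,R]\<close> the square of \<open>v\<close> varies by at most the integral of \<open>v\<^sup>2 + v_x\<^sup>2\<close>,
  and its mean is at most the integral of \<open>v\<^sup>2\<close>, as the interval has length at least one.
\<close>

lemma pointwise_bound_by_wnorm:
  assumes R: "1 \<le> R" "R \<le> \<rho>" and v: "strip_smooth False T v" and t: "t \<in> {0..T}"
    and w: "\<And>x. x \<in> {-R..R} \<Longrightarrow> 1 \<le> weight \<rho> l t x"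
    and M: "wnorm \<rho> l v t \<le> M" "wnorm \<rho> l (dx v) t \<le> M" and x: "x \<in> {-R..R}"
  shows "(v t x)\<^sup>2 \<le> 3 * M"
proof -
  have cv: "continuous_on S (v t)" "continuous_on S (dx v t)" for S
    using strip_cont_at[OF strip_smooth_cont t] v strip_smooth_dx[OF v] by blast+
  have int: "g integrable_on {p..q}" if "continuous_on UNIV g" for g :: "real \<Rightarrow> real" and p q
    using that by (intro integrable_continuous_interval) (rule continuous_on_subset, auto)
  have loc: "integral {-R..R} (\<lambda>y. (u t y)\<^sup>2) \<le> M"
    if u: "strip_smooth False T u" "wnorm \<rho> l u t \<le> M" for u
  proof -
    have cu: "continuous_on UNIV (u t)" by (rule strip_cont_at[OF strip_smooth_cont[OF u(1)] t])
    have iw: "(\<lambda>y. weight \<rho> l t y * (u t y)\<^sup>2) integrable_on {p..q}" for p q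
      by (rule integrable_weighted[OF weight_cont(1) strip_smooth_cont[OF strip_smooth_power[OF u(1)]] t])
    have "integral {-R..R} (\<lambda>y. (u t y)\<^sup>2) \<le> integral {-R..R} (\<lambda>y. weight \<rho> l t y * (u t y)\<^sup>2)"
    proof (rule integral_le[OF int iw])
      show "(u t y)\<^sup>2 \<le> weight \<rho> l t y * (u t y)\<^sup>2" if "y \<in> {-R..R}" for y
        using mult_right_mono[OF w[OF that], of "(u t y)\<^sup>2"] by simp
    qed (intro continuous_intros cu)
    also have "\<dots> \<le> wnorm \<rho> l u t"
      unfolding wnorm_def by (rule integral_subset_le[OF _ iw iw]) (use R in \<open>auto intro!: mult_nonneg_nonneg weight_nonneg\<close>)
    finally show ?thesis using u by simp
  qed
  define g where "g y = (v t y)\<^sup>2 + (dx v t y)\<^sup>2" for y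
  have ig: "integral {-R..R} g \<le> 2 * M"
  proof -
    have "integral {-R..R} g = integral {-R..R} (\<lambda>y. (v t y)\<^sup>2) + integral {-R..R} (\<lambda>y. (dx v t y)\<^sup>2)"
      unfolding g_def by (intro integral_add int continuous_intros cv)
    then show ?thesis using loc[OF v M(1)] loc[OF strip_smooth_dx[OF v] M(2)] by simp
  qed
  have cg: "continuous_on UNIV g" unfolding g_def by (intro continuous_intros cv)
  have step: "\<bar>(v t q)\<^sup>2 - (v t p)\<^sup>2\<bar> \<le> 2 * M" if pq: "p \<in> {-R..R}" "q \<in> {-R..R}" "p \<le> q" for p q
  proof -
    have "((\<lambda>y. 2 * v t y * dx v t y) has_integral (v t q)\<^sup>2 - (v t p)\<^sup>2) {p..q}"
    proof (rule fundamental_theorem_of_calculus[OF pq(3)])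
      fix y
      have "((\<lambda>y. (v t y)\<^sup>2) has_real_derivative 2 * v t y * dx v t y) (at y)"
        using strip_smooth_deriv[OF v t] by (auto intro!: derivative_eq_intros)
      then show "((\<lambda>y. (v t y)\<^sup>2) has_vector_derivative 2 * v t y * dx v t y) (at y within {p..q})"
        using has_field_derivative_at_within has_real_derivative_iff_has_vector_derivative by blast
    qed
    then have "\<bar>(v t q)\<^sup>2 - (v t p)\<^sup>2\<bar> = norm (integral {p..q} (\<lambda>y. 2 * v t y * dx v t y))"
      by (simp add: integral_unique)
    also have "\<dots> \<le> integral {p..q} g"
    proof (rule integral_norm_bound_integral)
      show "norm (2 * v t y * dx v t y) \<le> g y" for y
        using sum_squares_bound[of "\<bar>v t y\<bar>" "\<bar>dx v t y\<bar>"] by (simp add: g_def abs_mult)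
    qed (intro int continuous_intros cv cg)+
    also have "\<dots> \<le> integral {-R..R} g"
      by (rule integral_subset_le[OF _ int[OF cg] int[OF cg]]) (use pq in \<open>auto simp: g_def\<close>)
    finally show ?thesis using ig by simp
  qed
  have near: "(v t x)\<^sup>2 - 2 * M \<le> (v t y)\<^sup>2" if "y \<in> {-R..R}" for y
    using step[OF x that] step[OF that x] by (cases "x \<le> y") auto
  have "integral {-R..R} (\<lambda>y. (v t x)\<^sup>2 - 2 * M) \<le> integral {-R..R} (\<lambda>y. (v t y)\<^sup>2)"
    by (rule integral_le) (auto intro!: int continuous_intros cv near)
  then have "2 * R * ((v t x)\<^sup>2 - 2 * M) \<le> M" using loc[OF v M(1)] R by simp
  show ?thesis
  proof (cases "(v t x)\<^sup>2 - 2 * M \<le> 0")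
    case True
    have "0 \<le> wnorm \<rho> l v t" unfolding wnorm_def
      by (intro integral_nonneg integrable_weighted[OF weight_cont(1) strip_smooth_cont[OF strip_smooth_power[OF v]] t])
        (auto intro!: mult_nonneg_nonneg weight_nonneg)
    with M True show ?thesis by simp
  next
    case False
    then have "1 * ((v t x)\<^sup>2 - 2 * M) \<le> 2 * R * ((v t x)\<^sup>2 - 2 * M)" using R by (intro mult_right_mono) auto
    with \<open>2 * R * ((v t x)\<^sup>2 - 2 * M) \<le> M\<close> show ?thesis by simp
  qed
qed

section \<open>The degenerate equation\<close>

text \<open>
  Near \<open>x\<close> the function lies below the parabola \<open>a x + a' h + M h\<^sup>2\<close>; as \<open>a\<close> is nonnegative, so is the minimum of the parabola.
\<close>

lemma glaeser_inequality:
  assumes a: "a \<in> Binf" "\<And>x. 0 \<le> a x"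
  obtains K where "0 \<le> K" "\<And>x. \<bar>deriv a x\<bar> \<le> K * sqrt (a x)"
proof -
  note sa = strip_smooth_Binf[OF a(1), of 1]
  have d1: "(a has_real_derivative deriv a x) (at x)" for x
    using strip_smooth_deriv[OF sa, of 0] by (simp add: dx_def)
  have d2: "(deriv a has_real_derivative deriv (deriv a) x) (at x)" for x
    using strip_smooth_deriv[OF strip_smooth_dx[OF sa], of 0] by (simp add: dx_def)
  obtain N where N: "\<And>x. \<bar>deriv (deriv a) x\<bar> \<le> N"
    using strip_smooth_cont[OF strip_smooth_dx[OF strip_smooth_dx[OF sa]]] by (force simp: strip_cont_def dx_def)
  define M where "M = \<bar>N\<bar> + 1"
  have M: "M > 0" "\<bar>deriv (deriv a) x\<bar> \<le> M" for x using N[of x] by (auto simp: M_def)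
  have lip: "\<bar>deriv a y - deriv a x\<bar> \<le> M * \<bar>y - x\<bar>" for x y
    using field_differentiable_bound[of UNIV "deriv a" "deriv (deriv a)" M y x] d2 M(2) by simp
  have taylor: "a (x + h) \<le> a x + deriv a x * h + M * h\<^sup>2" for x h
  proof -
    have "norm ((a (x + h) - (x + h) * deriv a x) - (a x - x * deriv a x)) \<le> (M * \<bar>h\<bar>) * norm (x + h - x)"
    proof (rule field_differentiable_bound[where S = "closed_segment x (x + h)" and f' = "\<lambda>y. deriv a y - deriv a x"])
      show "((\<lambda>y. a y - y * deriv a x) has_real_derivative deriv a y - deriv a x) (at y within closed_segment x (x + h))" for y
        by (rule has_field_derivative_at_within) (auto intro!: derivative_eq_intros d1)
      show "norm (deriv a y - deriv a x) \<le> M * \<bar>h\<bar>" if "y \<in> closed_segment x (x + h)" for y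
      proof -
        have "\<bar>y - x\<bar> \<le> \<bar>h\<bar>" using that by (auto simp: closed_segment_eq_real_ivl split: if_splits)
        then have "M * \<bar>y - x\<bar> \<le> M * \<bar>h\<bar>" using M(1) by simp
        with lip[of y x] show ?thesis by simp
      qed
    qed auto
    then have "\<bar>a (x + h) - a x - h * deriv a x\<bar> \<le> M * h\<^sup>2"
      by (simp add: algebra_simps power2_eq_square)
    then show ?thesis by (simp add: mult.commute)
  qed
  have "\<bar>deriv a x\<bar> \<le> (2 * sqrt M) * sqrt (a x)" for x
  proof -
    \<comment> \<open>The vertex of the parabola.\<close>
    define h where "h = - deriv a x / (2 * M)"
    have "0 \<le> a x + deriv a x * h + M * h\<^sup>2" using taylor[of x h] a(2)[of "x + h"] by linarith
    also have "\<dots> = a x - (deriv a x)\<^sup>2 / (4 * M)"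
      using M(1) by (simp add: h_def power2_eq_square field_simps)
    finally have "(deriv a x)\<^sup>2 \<le> 4 * M * a x" using M(1) by (simp add: field_simps)
    then have "sqrt ((deriv a x)\<^sup>2) \<le> sqrt (4 * M * a x)" by (rule real_sqrt_le_mono)
    then show ?thesis by (simp add: real_sqrt_mult)
  qed
  then show thesis using M(1) by (intro that[of "2 * sqrt M"]) auto
qed

text \<open>
  Solutions for two different leading coefficients are compared by moving the discrepancy \<open>(A - A') V1_xx\<close> to the right-hand side.
\<close>

lemma third_order_eq_diff:
  assumes "third_order_eq T A b1 c2 b3 c4 c5 c6 U0 U1 U2 U3 F" "third_order_eq T A' b1 c2 b3 c4 c5 c6 V0 V1 V2 V3 G"
    and A: "\<And>x. A x - A' x = d"
  shows "third_order_eq T A b1 c2 b3 c4 c5 c6 (\<lambda>t x. U0 t x - V0 t x) (\<lambda>t x. U1 t x - V1 t x) (\<lambda>t x. U2 t x - V2 t x)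
    (\<lambda>t x. U3 t x - V3 t x) (\<lambda>t x. F t x - G t x + d * dx (dx V1) t x)"
proof -
  note U = third_order_eqD(1-5)[OF assms(1)] and dU = third_order_eqD(6-8)[OF assms(1)] and pU = third_order_eqD(9)[OF assms(1)]
  note V = third_order_eqD(1-5)[OF assms(2)] and dV = third_order_eqD(6-8)[OF assms(2)] and pV = third_order_eqD(9)[OF assms(2)]
  have d1: "dx (\<lambda>t x. v t x - w t x) t x = dx v t x - dx w t x"
    and d2: "dx (dx (\<lambda>t x. v t x - w t x)) t x = dx (dx v) t x - dx (dx w) t x"
    if "strip_smooth False T v" "strip_smooth False T w" "t \<in> {0..T}" for v w t x
    using dxn_diff[OF that, of 1] dxn_diff[OF that, of 2] by (simp_all add: numeral_2_eq_2)
  show ?thesis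
    unfolding third_order_eq_def
  proof (intro conjI ballI allI)
    fix t x assume t: "t \<in> {0..T}"
    have A': "A x = A' x + d" using A[of x] by simp
    show "U3 t x - V3 t x - A x * dx (dx (\<lambda>t x. U1 t x - V1 t x)) t x + b1 x * dx (dx (\<lambda>t x. U0 t x - V0 t x)) t x
       + c2 x * dx (\<lambda>t x. U1 t x - V1 t x) t x + b3 x * (U2 t x - V2 t x) + c4 x * dx (\<lambda>t x. U0 t x - V0 t x) t x
       + c5 x * (U1 t x - V1 t x) + c6 x * (U0 t x - V0 t x) = F t x - G t x + d * dx (dx V1) t x"
      unfolding d1[OF U(1) V(1) t] d1[OF U(2) V(2) t] d2[OF U(1) V(1) t] d2[OF U(2) V(2) t]
        pU[OF t, symmetric] pV[OF t, symmetric] A' by (simp add: algebra_simps)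
  qed (intro strip_smooth_intros has_dt_diff U V dU dV)+
qed

lemma wnorm_bounded:
  assumes v: "strip_smooth True T v" and "0 \<le> l" "0 \<le> \<rho>"
  obtains M where "0 \<le> M" "\<And>t. t \<in> {0..T} \<Longrightarrow> wnorm \<rho> l v t \<le> M"
proof -
  obtain B where B: "\<And>t x. t \<in> {0..T} \<Longrightarrow> \<bar>v t x\<bar> \<le> B"
    using strip_smooth_cont[OF v] unfolding strip_cont_def by blast
  have "wnorm \<rho> l v t \<le> \<rho>\<^sup>2 * B\<^sup>2 * (2 * \<rho>)" if t: "t \<in> {0..T}" for t
  proof -
    have "wnorm \<rho> l v t \<le> integral {-\<rho>..\<rho>} (\<lambda>x. \<rho>\<^sup>2 * B\<^sup>2)"
      unfolding wnorm_def
    proof (rule integral_le)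
      show "(\<lambda>x. weight \<rho> l t x * (v t x)\<^sup>2) integrable_on {- \<rho>..\<rho>}"
        using wnorm_integral[OF strip_smooth_unbounded[OF v] t] by blast
      have "0 \<le> sqrt (1 + x\<^sup>2)" for x :: real by simp
      then have w: "weight \<rho> l t x \<le> \<rho>\<^sup>2" for x
        unfolding weight_def using assms t by (intro power_mono) (auto simp: add_increasing2 diff_le_eq)
      have "(v t x)\<^sup>2 \<le> B\<^sup>2" for x using power_mono[OF B[OF t, of x], of 2] by simp
      with w show "weight \<rho> l t x * (v t x)\<^sup>2 \<le> \<rho>\<^sup>2 * B\<^sup>2" for x by (intro mult_mono) auto
    qed auto
    also have "\<dots> = \<rho>\<^sup>2 * B\<^sup>2 * (2 * \<rho>)" using assms by simp
    finally show ?thesis .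
  qed
  then show thesis using assms by (intro that[of "\<rho>\<^sup>2 * B\<^sup>2 * (2 * \<rho>)"]) auto
qed

lemma initial_energy_bounded:
  assumes a: "strip_smooth False T (\<lambda>t. a)" "\<And>x. 0 \<le> a x" and T: "0 \<le> T"
    and v: "strip_smooth False T V0" "strip_smooth False T V1" "strip_smooth False T V2"
  obtains M where "\<And>\<epsilon>. \<epsilon> \<in> {0..1} \<Longrightarrow> energy \<rho> l (\<lambda>x. a x + \<epsilon>) V0 V1 V2 0 \<le> M"
proof -
  define D where "D = (\<lambda>t x. 4 * (V2 t x)\<^sup>2 + 3 * (a x * dx (dx V0) t x)\<^sup>2 + 3 * (dx (dx V0) t x)\<^sup>2
      + (a x + 1) * (dx V1 t x)\<^sup>2 + (a x + 1) * (dx V0 t x)\<^sup>2 + (V1 t x)\<^sup>2 + (V0 t x)\<^sup>2)"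
  have sD: "strip_smooth False T D" unfolding D_def by (intro strip_smooth_intros strip_smooth_power a v)
  have 0: "0 \<in> {0..T}" using T by simp
  have "energy \<rho> l (\<lambda>x. a x + \<epsilon>) V0 V1 V2 0 \<le> integral {-\<rho>..\<rho>} (\<lambda>x. weight \<rho> l 0 x * D 0 x)" if e: "\<epsilon> \<in> {0..1}" for \<epsilon>
    unfolding energy_def
  proof (rule integral_le)
    have "strip_smooth False T (\<lambda>t x. a x + \<epsilon>)" by (intro strip_smooth_intros a)
    from energy_density_smooth[OF this v]
    show "(\<lambda>x. weight \<rho> l 0 x * energy_density (\<lambda>x. a x + \<epsilon>) V0 V1 V2 0 x) integrable_on {-\<rho>..\<rho>}"
      by (intro integrable_weighted[OF weight_cont(1) strip_smooth_cont 0])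
    show "(\<lambda>x. weight \<rho> l 0 x * D 0 x) integrable_on {-\<rho>..\<rho>}"
      by (intro integrable_weighted[OF weight_cont(1) strip_smooth_cont[OF sD] 0])
    show "weight \<rho> l 0 x * energy_density (\<lambda>x. a x + \<epsilon>) V0 V1 V2 0 x \<le> weight \<rho> l 0 x * D 0 x" for x
    proof (intro mult_left_mono weight_nonneg)
      define y where "y = dx (dx V0) 0 x"
      have sq3: "(p - q - r)\<^sup>2 \<le> 3 * p\<^sup>2 + 3 * q\<^sup>2 + 3 * r\<^sup>2" for p q r :: real
      proof -
        have "0 \<le> (p + q)\<^sup>2 + (p + r)\<^sup>2 + (q - r)\<^sup>2" by simp
        then show ?thesis by (simp add: power2_eq_square algebra_simps)
      qed
      have "(\<epsilon> * y)\<^sup>2 \<le> y\<^sup>2" using e by (simp add: power_mult_distrib mult_left_le_one_le power_le_one)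
      then have "(V2 0 x - (a x + \<epsilon>) * y)\<^sup>2 \<le> 3 * (V2 0 x)\<^sup>2 + 3 * (a x * y)\<^sup>2 + 3 * y\<^sup>2"
        using sq3[of "V2 0 x" "a x * y" "\<epsilon> * y"] by (simp add: algebra_simps)
      moreover have "(a x + \<epsilon>) * (dx V1 0 x)\<^sup>2 \<le> (a x + 1) * (dx V1 0 x)\<^sup>2" "(a x + \<epsilon>) * (dx V0 0 x)\<^sup>2 \<le> (a x + 1) * (dx V0 0 x)\<^sup>2"
        using e by (auto intro!: mult_right_mono)
      ultimately show "energy_density (\<lambda>x. a x + \<epsilon>) V0 V1 V2 0 x \<le> D 0 x"
        unfolding energy_density_def D_def y_def by linarith
    qed
  qed
  then show thesis by (rule that)
qed

lemma energy_cong: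
  assumes "U0 t = V0 t" "U1 t = V1 t" "U2 t = V2 t"
  shows "energy \<rho> l A U0 U1 U2 t = energy \<rho> l A V0 V1 V2 t"
  using assms by (simp add: energy_def energy_density_def dx_def)

lemma uniformly_Cauchy_by_parameter:
  fixes f :: "nat \<Rightarrow> 'a \<Rightarrow> real" and e :: "nat \<Rightarrow> real"
  assumes "\<And>m n x. x \<in> S \<Longrightarrow> \<bar>f m x - f n x\<bar> \<le> B * \<bar>e m - e n\<bar>" and "Cauchy e"
  shows "uniformly_Cauchy_on S f"
  unfolding uniformly_Cauchy_on_def
proof (intro allI impI)
  fix r :: real assume "r > 0"
  define b where "b = \<bar>B\<bar> + 1"
  have "r / b > 0" using \<open>r > 0\<close> by (simp add: b_def)
  then obtain M where M: "\<And>m n. m \<ge> M \<Longrightarrow> n \<ge> M \<Longrightarrow> dist (e m) (e n) < r / b"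
    using assms(2) unfolding Cauchy_def by blast
  have "dist (f m x) (f n x) < r" if "x \<in> S" "m \<ge> M" "n \<ge> M" for x m n
  proof -
    have "\<bar>f m x - f n x\<bar> \<le> b * \<bar>e m - e n\<bar>"
      using assms(1)[OF that(1), of m n] mult_right_mono[of B b "\<bar>e m - e n\<bar>"] unfolding b_def by linarith
    also have "\<dots> < b * (r / b)" using M[OF that(2,3)] by (intro mult_strict_left_mono) (auto simp: b_def dist_real_def)
    finally show ?thesis by (simp add: dist_real_def b_def)
  qed
  then show "\<exists>M. \<forall>x\<in>S. \<forall>m\<ge>M. \<forall>n\<ge>M. dist (f m x) (f n x) < r" by blast
qed

text \<open>
  The number \<open>l\<close> bounds the propagation speed \<open>\<surd>(a + \<epsilon>)\<close> for all \<open>\<epsilon>\<close> in \<open>[0,1]\<close>.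
\<close>

locale weakly_hyperbolic =
  fixes T l K :: real and a b1 b2 b3 g0 g1 g2 :: "real \<Rightarrow> real" and f :: "real \<Rightarrow> real \<Rightarrow> real"
  assumes T: "0 \<le> T" and l: "0 \<le> l" "\<And>x. a x + 1 \<le> l\<^sup>2"
    and a: "a \<in> Binf" "\<And>x. 0 \<le> a x" and b: "b1 \<in> Binf" "b2 \<in> Binf" "b3 \<in> Binf"
    and K: "\<And>x. \<bar>deriv a x\<bar> \<le> K * sqrt (a x)" "\<And>x. \<bar>b1 x\<bar> \<le> K * a x" "\<And>x. \<bar>deriv b1 x\<bar> \<le> K * sqrt (a x)"
      "\<And>x. \<bar>b2 x\<bar> \<le> K * sqrt (a x)"
    and g: "g0 \<in> Binf" "g1 \<in> Binf" "g2 \<in> Binf" and f: "strip_smooth True T f"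
begin

definition regularised where
  "regularised \<epsilon> U0 U1 U2 U3 \<longleftrightarrow> U0 0 = g0 \<and> U1 0 = g1 \<and> U2 0 = g2 \<and>
     third_order_eq T (\<lambda>x. a x + \<epsilon>) b1 b2 b3 (\<lambda>x. 0) (\<lambda>x. 0) (\<lambda>x. 0) U0 U1 U2 U3 f"

lemmas sa = strip_smooth_Binf[OF a(1), of T] and sb = b[THEN strip_smooth_Binf, of T] and sg = g[THEN strip_smooth_Binf, of T]
lemmas ua = strip_smooth_unbounded[OF sa] and ub = sb[THEN strip_smooth_unbounded] and ug = sg[THEN strip_smooth_unbounded]
  and uf = strip_smooth_unbounded[OF f]

text \<open>
  The right-hand side in the equation for the difference is \<open>\<epsilon> - \<delta>\<close> times a third-order derivative of one of the two solutions. Estimates of order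
  \<open>k + 3\<close>, uniform in \<open>\<delta>\<close>, bound that derivative and the estimate of order \<open>k + 1\<close> then bounds the difference; the additional
  order of differentiation is spent on the passage from integrals to pointwise bounds.
\<close>

lemma stability:
  assumes R: "1 \<le> R"
  shows "\<exists>B. \<forall>\<epsilon>\<in>{0..1}. \<forall>\<delta>\<in>{0..1}. \<forall>U0 U1 U2 U3 V0 V1 V2 V3.
     regularised \<epsilon> U0 U1 U2 U3 \<longrightarrow> regularised \<delta> V0 V1 V2 V3 \<longrightarrow>
     (\<forall>t\<in>{0..T}. \<forall>x\<in>{-R..R}. \<forall>(U, V)\<in>{(U0, V0), (U1, V1), (U2, V2)}.
        \<bar>(dx ^^ k) U t x - (dx ^^ k) V t x\<bar> \<le> B * \<bar>\<epsilon> - \<delta>\<bar>)"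
proof -
  define \<rho> where "\<rho> = l * T + sqrt (1 + R\<^sup>2) + 1"
  have "R \<le> sqrt (1 + R\<^sup>2)" by (rule real_le_rsqrt) simp
  moreover have "0 \<le> l * T" using l T by simp
  ultimately have \<rho>: "R \<le> \<rho>" "0 \<le> \<rho>" using R unfolding \<rho>_def by linarith+
  have lev: "levi_coeffs T a b2 (\<lambda>x. 0) (\<lambda>x. 0) (\<lambda>x. 0)"
    unfolding levi_coeffs_def
    by (intro conjI exI[of _ "\<bar>K\<bar>"] allI strip_smooth_const sb)
      (auto intro!: order_trans[OF K(4)] mult_right_mono mult_nonneg_nonneg a)
  note hee = higher_energy_estimate[OF T l(1) \<rho>(2) sa a(2) l(2) sb(1) sb(3) K(1-3) lev]
  obtain C1 where C1: "C1 \<ge> 0" "energy_bound_const T \<rho> l a b1 b2 b3 (\<lambda>x. 0) (\<lambda>x. 0) (\<lambda>x. 0) (k + 3) C1"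
    using hee by blast
  obtain C2 where C2: "C2 \<ge> 0" "energy_bound_const T \<rho> l a b1 b2 b3 (\<lambda>x. 0) (\<lambda>x. 0) (\<lambda>x. 0) (k + 1) C2"
    using hee by blast
  define G where "G j \<epsilon> = energy \<rho> l (\<lambda>x. a x + \<epsilon>) (\<lambda>t. (deriv ^^ j) g0) (\<lambda>t. (deriv ^^ j) g1) (\<lambda>t. (deriv ^^ j) g2) 0" for j \<epsilon>
  have "\<exists>M. \<forall>\<epsilon>\<in>{0..1}. G j \<epsilon> \<le> M" for j
  proof -
    have "strip_smooth False T (\<lambda>t. (deriv ^^ j) \<gamma>)" if "strip_smooth False T (\<lambda>t. \<gamma>)" for \<gamma>
      using strip_smooth_dxn[OF that, of j] by (simp add: funpow_dx[abs_def])
    then show ?thesis unfolding G_def using initial_energy_bounded[OF ua a(2) T] ug by metis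
  qed
  moreover have "\<exists>M\<ge>0. \<forall>t\<in>{0..T}. wnorm \<rho> l ((dx ^^ j) f) t \<le> M" for j
    using wnorm_bounded[OF strip_smooth_dxn[OF f] l(1) \<rho>(2)] by metis
  ultimately have "\<exists>M\<ge>0. \<forall>j\<in>{..k+3}. (\<forall>\<epsilon>\<in>{0..1}. G j \<epsilon> \<le> M) \<and> (\<forall>t\<in>{0..T}. wnorm \<rho> l ((dx ^^ j) f) t \<le> M)"
    by (intro finite_uniform_constant) (auto intro: order_trans, meson max.coboundedI1 max.coboundedI2)
  then obtain M where M: "0 \<le> M" "\<And>j \<epsilon>. j \<le> k + 3 \<Longrightarrow> \<epsilon> \<in> {0..1} \<Longrightarrow> G j \<epsilon> \<le> M"
      "\<And>j t. j \<le> k + 3 \<Longrightarrow> t \<in> {0..T} \<Longrightarrow> wnorm \<rho> l ((dx ^^ j) f) t \<le> M"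
    by auto
  define B where "B = sqrt (3 * (C2 * (C1 * M)))"
  have "\<bar>(dx ^^ k) U t x - (dx ^^ k) V t x\<bar> \<le> B * \<bar>\<epsilon> - \<delta>\<bar>"
    if e: "\<epsilon> \<in> {0..1}" "\<delta> \<in> {0..1}" and regU: "regularised \<epsilon> U0 U1 U2 U3" and regV: "regularised \<delta> V0 V1 V2 V3"
      and t: "t \<in> {0..T}" and x: "x \<in> {-R..R}" and UV: "(U, V) \<in> {(U0, V0), (U1, V1), (U2, V2)}"
    for \<epsilon> \<delta> U0 U1 U2 U3 V0 V1 V2 V3 t x U V
  proof -
    define d where "d = \<epsilon> - \<delta>"
    define W0 where "W0 = (\<lambda>t x. U0 t x - V0 t x)"
    define W1 where "W1 = (\<lambda>t x. U1 t x - V1 t x)"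
    define W2 where "W2 = (\<lambda>t x. U2 t x - V2 t x)"
    define F where "F = (\<lambda>t x. d * dx (dx V1) t x)"
    note eqU = regU[unfolded regularised_def, THEN conjunct2, THEN conjunct2, THEN conjunct2]
      and eqV = regV[unfolded regularised_def, THEN conjunct2, THEN conjunct2, THEN conjunct2]
    note sU = third_order_eqD(1-3)[OF eqU] and sV = third_order_eqD(1-3)[OF eqV]
    have W: "third_order_eq T (\<lambda>x. a x + \<epsilon>) b1 b2 b3 (\<lambda>x. 0) (\<lambda>x. 0) (\<lambda>x. 0) W0 W1 W2 (\<lambda>t x. U3 t x - V3 t x) F"
      using third_order_eq_diff[OF eqU eqV, of d] by (simp add: W0_def W1_def W2_def F_def d_def)
    note sW = third_order_eqD(1-3)[OF W]
    have sA: "strip_smooth False T (\<lambda>t x. a x + \<eta>)" "0 \<le> \<eta> \<Longrightarrow> 0 \<le> a x + \<eta>" for \<eta> x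
      using a(2)[of x] by (auto intro!: strip_smooth_intros ua)
    have nV: "wnorm \<rho> l ((dx ^^ j) V1) s \<le> C1 * M" if "j \<le> k + 3" "s \<in> {0..T}" for j s
    proof -
      have "energy_n \<rho> l a \<delta> j V0 V1 V2 s \<le> C1 * M"
      proof (rule energy_bound_constD[OF C1(2) e(2) eqV _ _ that])
        fix j assume j: "j \<le> k + 3"
        have "energy_n \<rho> l a \<delta> j V0 V1 V2 0 = G j \<delta>"
          unfolding G_def using regV by (intro energy_cong) (simp_all add: funpow_dx regularised_def)
        then show "energy_n \<rho> l a \<delta> j V0 V1 V2 0 \<le> M" using M(2)[OF j e(2)] by linarith
        show "wnorm \<rho> l ((dx ^^ j) f) s \<le> M" if "s \<in> {0..T}" for s
          by (rule M(3)[OF j that])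
      qed
      moreover have "0 \<le> a x + \<delta>" for x using sA(2) e(2) by simp
      ultimately show ?thesis
        using wnorm_le_energy(2)[OF sA(1) strip_smooth_dxn[OF sV(1)] strip_smooth_dxn[OF sV(2)] strip_smooth_dxn[OF sV(3)] that(2),
            of \<delta> \<rho> l j j j] by fastforce
    qed
    have E: "energy_n \<rho> l a \<epsilon> j W0 W1 W2 t \<le> C2 * (d\<^sup>2 * (C1 * M))" if "j \<le> k + 1" for j
    proof (rule energy_bound_constD[OF C2(2) e(1) W _ _ that t])
      have CM: "0 \<le> d\<^sup>2 * (C1 * M)" using C1(1) M(1) by simp
      show "energy_n \<rho> l a \<epsilon> j W0 W1 W2 0 \<le> d\<^sup>2 * (C1 * M)" for j
      proof -
        have "(dx ^^ j) (\<lambda>t x. 0) 0 = (\<lambda>x. 0)"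
          using dxn_cmult[OF strip_smooth_const[of False T 0], of 0 j 0] T by simp
        then have "(dx ^^ j) W0 0 = (\<lambda>x. 0)" "(dx ^^ j) W1 0 = (\<lambda>x. 0)" "(dx ^^ j) W2 0 = (\<lambda>x. 0)"
          using regU regV by (simp_all add: funpow_dx W0_def W1_def W2_def regularised_def)
        then have "energy_n \<rho> l a \<epsilon> j W0 W1 W2 0 = energy \<rho> l (\<lambda>x. a x + \<epsilon>) (\<lambda>t x. 0) (\<lambda>t x. 0) (\<lambda>t x. 0) 0"
          by (intro energy_cong) auto
        also have "\<dots> = 0" by (simp add: energy_def energy_density_def dx_def)
        finally show ?thesis using CM by simp
      qed
      show "wnorm \<rho> l ((dx ^^ j) F) s \<le> d\<^sup>2 * (C1 * M)" if "j \<le> k + 1" "s \<in> {0..T}" for j s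
      proof -
        have "(dx ^^ j) F s = (\<lambda>x. d * (dx ^^ Suc (Suc j)) V1 s x)"
          unfolding F_def using dxn_cmult[OF strip_smooth_dx[OF strip_smooth_dx[OF sV(2)]] that(2), of j d]
          by (simp add: funpow_swap1)
        then have "wnorm \<rho> l ((dx ^^ j) F) s = wnorm \<rho> l (\<lambda>s x. d * (dx ^^ Suc (Suc j)) V1 s x) s" by (rule wnorm_cong)
        also have "\<dots> = d\<^sup>2 * wnorm \<rho> l ((dx ^^ Suc (Suc j)) V1) s" by (rule wnorm_cmult)
        also have "\<dots> \<le> d\<^sup>2 * (C1 * M)" by (intro mult_left_mono nV) (use that in auto)
        finally show ?thesis .
      qed
    qed
    have A0: "0 \<le> a x + \<epsilon>" for x using sA(2) e(1) by simp
    have N: "wnorm \<rho> l ((dx ^^ j) W) t \<le> C2 * (d\<^sup>2 * (C1 * M))" if "j \<le> k + 1" "W \<in> {W0, W1, W2}" for j W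
      using wnorm_le_energy[OF sA(1) strip_smooth_dxn[OF sW(1)] strip_smooth_dxn[OF sW(2)] strip_smooth_dxn[OF sW(3)] t A0, of \<rho> l j j j]
        E[OF that(1)] that(2) by auto
    have pt: "\<bar>(dx ^^ k) W t x\<bar> \<le> B * \<bar>d\<bar>" if "W \<in> {W0, W1, W2}" for W
    proof -
      have sW': "strip_smooth False T W" using that sW by auto
      have "((dx ^^ k) W t x)\<^sup>2 \<le> 3 * (C2 * (d\<^sup>2 * (C1 * M)))"
      proof (rule pointwise_bound_by_wnorm[OF R \<rho>(1) strip_smooth_dxn[OF sW'] t _ _ _ x])
        show "1 \<le> weight \<rho> l t y" if "y \<in> {-R..R}" for y
          by (rule weight_ge_1[OF l(1) t _ \<rho>_def]) (use that in auto)
      qed (use N[of k W] N[of "Suc k" W] that in auto)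
      then have "sqrt (((dx ^^ k) W t x)\<^sup>2) \<le> sqrt (3 * (C2 * (C1 * M)) * d\<^sup>2)"
        by (intro real_sqrt_le_mono) (simp add: mult_ac)
      then show ?thesis by (simp add: B_def real_sqrt_mult)
    qed
    show ?thesis
      using UV pt[of W0] pt[of W1] pt[of W2] dxn_diff[OF sU(1) sV(1) t, of k] dxn_diff[OF sU(2) sV(2) t, of k]
        dxn_diff[OF sU(3) sV(3) t, of k] by (auto simp: W0_def W1_def W2_def d_def)
  qed
  then show ?thesis by blast
qed

lemma uniqueness:
  assumes "regularised 0 U0 U1 U2 U3" "regularised 0 V0 V1 V2 V3" "t \<in> {0..T}"
  shows "U0 t x = V0 t x"
proof -
  obtain B where "\<forall>\<epsilon>\<in>{0..1}. \<forall>\<delta>\<in>{0..1}. \<forall>U0 U1 U2 U3 V0 V1 V2 V3.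
     regularised \<epsilon> U0 U1 U2 U3 \<longrightarrow> regularised \<delta> V0 V1 V2 V3 \<longrightarrow>
     (\<forall>t\<in>{0..T}. \<forall>x\<in>{-max 1 \<bar>x\<bar>..max 1 \<bar>x\<bar>}. \<forall>(U, V)\<in>{(U0, V0), (U1, V1), (U2, V2)}.
        \<bar>(dx ^^ 0) U t x - (dx ^^ 0) V t x\<bar> \<le> B * \<bar>\<epsilon> - \<delta>\<bar>)"
    using stability[of "max 1 \<bar>x\<bar>" 0] by auto
  moreover have "x \<in> {-max 1 \<bar>x\<bar>..max 1 \<bar>x\<bar>}" by (auto simp: max_def)
  ultimately have "\<forall>(U, V)\<in>{(U0, V0), (U1, V1), (U2, V2)}. \<bar>(dx ^^ 0) U t x - (dx ^^ 0) V t x\<bar> \<le> B * \<bar>0 - 0\<bar>"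
    using assms by (meson atLeastAtMost_iff order_refl zero_le_one)
  then show ?thesis by simp
qed

lemma regularised_existence:
  assumes "0 < \<epsilon>"
  shows "\<exists>u0 u1 u2 u3. regularised \<epsilon> u0 u1 u2 u3"
proof -
  have "strip_smooth True 1 (\<lambda>t x. a x + \<epsilon>)" by (intro strip_smooth_intros strip_smooth_Binf a)
  then have A: "(\<lambda>x. a x + \<epsilon>) \<in> Binf" by (simp add: Binf_iff)
  have ge: "a x + \<epsilon> \<ge> \<epsilon>" for x using a(2)[of x] by simp
  obtain u0 u1 u2 u3 where u:
      "strip_smooth False T u0" "strip_smooth False T u1" "strip_smooth False T u2" "strip_smooth False T u3"
      "has_dt T u0 u1" "has_dt T u1 u2" "has_dt T u2 u3" "u0 0 = g0" "u1 0 = g1" "u2 0 = g2"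
    and pde: "\<And>t x. t \<in> {0..T} \<Longrightarrow> u3 t x - (a x + \<epsilon>) * dx (dx u1) t x + b1 x * dx (dx u0) t x + b2 x * dx u1 t x
      + b3 x * u2 t x = f t x"
    by (rule strictly_hyperbolic_existence[OF T A ge assms b g f]) (rule that; assumption)
  have "third_order_eq T (\<lambda>x. a x + \<epsilon>) b1 b2 b3 (\<lambda>x. 0) (\<lambda>x. 0) (\<lambda>x. 0) u0 u1 u2 u3 f"
    unfolding third_order_eq_def by (intro conjI u uf) (simp add: pde)
  then show ?thesis unfolding regularised_def using u(8-10) by blast
qed

text \<open>
  By the stability estimate the solutions for \<open>\<epsilon> = 1 / (m + 1)\<close> form a Cauchy sequence together with their first two time derivatives. The third
  time derivative converges since the equation expresses it by the others.
\<close>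

lemma existence: "\<exists>u0 u1 u2 u3. regularised 0 u0 u1 u2 u3"
proof -
  define \<epsilon> where "\<epsilon> m = inverse (real (Suc m))" for m
  have e: "\<epsilon> m \<in> {0..1}" "0 < \<epsilon> m" for m by (auto simp: \<epsilon>_def inverse_le_1_iff)
  have e0: "\<epsilon> \<longlonglongrightarrow> 0" unfolding \<epsilon>_def[abs_def] by (rule LIMSEQ_inverse_real_of_nat)
  obtain U0 U1 U2 U3 where reg: "\<And>m. regularised (\<epsilon> m) (U0 m) (U1 m) (U2 m) (U3 m)"
    using regularised_existence[OF e(2)] by metis
  have eq: "third_order_eq T (\<lambda>x. a x + \<epsilon> m) b1 b2 b3 (\<lambda>x. 0) (\<lambda>x. 0) (\<lambda>x. 0) (U0 m) (U1 m) (U2 m) (U3 m) f"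
    and init: "U0 m 0 = g0" "U1 m 0 = g1" "U2 m 0 = g2" for m
    using reg[of m] by (auto simp: regularised_def)
  note sU = third_order_eqD(1-3)[OF eq] and dU = third_order_eqD(6-8)[OF eq]
  have cau: "uniformly_Cauchy_on ({0..T} \<times> {-R..R}) (\<lambda>m (t, x). (dx ^^ k) (V m) t x)"
    if V: "V \<in> {U0, U1, U2}" for V k R
  proof -
    obtain B where B: "\<forall>\<epsilon>\<in>{0..1}. \<forall>\<delta>\<in>{0..1}. \<forall>U0 U1 U2 U3 V0 V1 V2 V3.
       regularised \<epsilon> U0 U1 U2 U3 \<longrightarrow> regularised \<delta> V0 V1 V2 V3 \<longrightarrow>
       (\<forall>t\<in>{0..T}. \<forall>x\<in>{-max 1 R..max 1 R}. \<forall>(U, V)\<in>{(U0, V0), (U1, V1), (U2, V2)}.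
          \<bar>(dx ^^ k) U t x - (dx ^^ k) V t x\<bar> \<le> B * \<bar>\<epsilon> - \<delta>\<bar>)"
      using stability[of "max 1 R" k] by auto
    show ?thesis
    proof (rule uniformly_Cauchy_by_parameter[where e = \<epsilon> and B = B])
      show "Cauchy \<epsilon>" using e0 LIMSEQ_imp_Cauchy by blast
      fix m p q assume "q \<in> {0..T} \<times> {-R..R}"
      then obtain t x where q: "q = (t, x)" "t \<in> {0..T}" "x \<in> {-max 1 R..max 1 R}"
        by (auto simp: max_def)
      from B[rule_format, OF e(1) e(1) reg reg q(2,3), of "(V m, V p)" m p] V
      show "\<bar>(case q of (t, x) \<Rightarrow> (dx ^^ k) (V m) t x) - (case q of (t, x) \<Rightarrow> (dx ^^ k) (V p) t x)\<bar> \<le> B * \<bar>\<epsilon> m - \<epsilon> p\<bar>"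
        by (auto simp: q(1))
    qed
  qed
  obtain u0 where u0: "strip_smooth False T u0" "strip_lim T U0 u0" using strip_lim_exists[OF sU(1) cau[of U0]] by auto
  obtain u1 where u1: "strip_smooth False T u1" "strip_lim T U1 u1" using strip_lim_exists[OF sU(2) cau[of U1]] by auto
  obtain u2 where u2: "strip_smooth False T u2" "strip_lim T U2 u2" using strip_lim_exists[OF sU(3) cau[of U2]] by auto
  have unif: "uniform_limit ({0..T} \<times> {-R..R}) (\<lambda>m p. (dx ^^ k) (V m) (fst p) (snd p)) (\<lambda>p. (dx ^^ k) v (fst p) (snd p)) sequentially"
    if "strip_lim T V v" for V v R k
    using that unfolding strip_lim_def split_beta by blast
  have unif0: "uniform_limit ({0..T} \<times> {-R..R}) (\<lambda>m (t, x). V m t x) (\<lambda>(t, x). v t x) sequentially"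
    if "strip_lim T V v" for V v R
    using that[unfolded strip_lim_def, THEN spec, of 0, THEN spec, of R] by simp
  have d01: "has_dt T u0 u1"
    by (rule strip_lim_has_dt[OF u0(2) _ dU(1)]) (rule unif0[OF u1(2)])
  have d12: "has_dt T u1 u2"
    by (rule strip_lim_has_dt[OF u1(2) _ dU(2)]) (rule unif0[OF u2(2)])
  define u3 where "u3 = (\<lambda>t x. f t x + a x * dx (dx u1) t x - b1 x * dx (dx u0) t x - b2 x * dx u1 t x - b3 x * u2 t x)"
  have su3: "strip_smooth False T u3" unfolding u3_def by (intro strip_smooth_intros ua ub uf u0 u1 u2)
  have d23: "has_dt T u2 u3"
  proof (rule strip_lim_has_dt[OF u2(2)])
    show "has_dt T (U2 m) (\<lambda>t x. f t x + (a x * dx (dx (U1 m)) t x + \<epsilon> m * dx (dx (U1 m)) t x) + (- b1 x) * dx (dx (U0 m)) t x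
        + (- b2 x) * dx (U1 m) t x + (- b3 x) * U2 m t x)" for m
    proof (rule has_dt_cong[THEN iffD1, OF _ _ dU(3)])
      fix t assume t: "t \<in> {0..T}"
      have "U3 m t x = f t x + (a x * dx (dx (U1 m)) t x + \<epsilon> m * dx (dx (U1 m)) t x) + (- b1 x) * dx (dx (U0 m)) t x
        + (- b2 x) * dx (U1 m) t x + (- b3 x) * U2 m t x" for x
        using eq[of m, unfolded third_order_eq_def] t by (auto simp: algebra_simps)
      then show "U3 m t = (\<lambda>x. f t x + (a x * dx (dx (U1 m)) t x + \<epsilon> m * dx (dx (U1 m)) t x) + (- b1 x) * dx (dx (U0 m)) t x
        + (- b2 x) * dx (U1 m) t x + (- b3 x) * U2 m t x)" by blast
    qed simp
    fix R :: real
    let ?S = "{0..T} \<times> {-R..R}"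
    have bd: "\<exists>B. \<forall>x. \<bar>\<beta> x\<bar> \<le> B" if "strip_smooth True T (\<lambda>t. \<beta>)" for \<beta>
      using strip_smooth_cont[OF that] T by (auto simp: strip_cont_def)
    have ml: "uniform_limit ?S (\<lambda>m p. \<beta> (snd p) * h m p) (\<lambda>p. \<beta> (snd p) * h' p) sequentially"
      if \<beta>: "strip_smooth True T (\<lambda>t. \<beta>)" and "uniform_limit ?S h h' sequentially"
      for \<beta> and h :: "nat \<Rightarrow> real \<times> real \<Rightarrow> real" and h'
    proof -
      obtain B where "\<forall>x. \<bar>\<beta> x\<bar> \<le> B" using bd[OF \<beta>] by blast
      then show ?thesis by (intro uniform_limit_mult_bounded[OF that(2), of _ B]) auto
    qed
    have l0: "uniform_limit ?S (\<lambda>m p. U2 m (fst p) (snd p)) (\<lambda>p. u2 (fst p) (snd p)) sequentially"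
      using unif[OF u2(2), where k = 0 and R = R] by simp
    have l1: "uniform_limit ?S (\<lambda>m p. dx (U1 m) (fst p) (snd p)) (\<lambda>p. dx u1 (fst p) (snd p)) sequentially"
      using unif[OF u1(2), where k = 1 and R = R] by simp
    have l2: "uniform_limit ?S (\<lambda>m p. dx (dx (U0 m)) (fst p) (snd p)) (\<lambda>p. dx (dx u0) (fst p) (snd p)) sequentially"
      using unif[OF u0(2), where k = 2 and R = R] by (simp add: numeral_2_eq_2)
    have l3: "uniform_limit ?S (\<lambda>m p. dx (dx (U1 m)) (fst p) (snd p)) (\<lambda>p. dx (dx u1) (fst p) (snd p)) sequentially"
      using unif[OF u1(2), where k = 2 and R = R] by (simp add: numeral_2_eq_2)
    have l4: "uniform_limit ?S (\<lambda>m p. \<epsilon> m * dx (dx (U1 m)) (fst p) (snd p)) (\<lambda>p. 0 * dx (dx u1) (fst p) (snd p)) sequentially"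
    proof (rule uniform_lim_mult[OF _ l3])
      show "uniform_limit ?S (\<lambda>m p. \<epsilon> m) (\<lambda>p. 0) sequentially"
        unfolding uniform_limit_iff using e0[THEN tendstoD] by (auto elim: eventually_mono)
      show "bounded ((\<lambda>p. 0::real) ` ?S)" by (rule boundedI[of _ 0]) auto
      have "continuous_on ?S (\<lambda>p. dx (dx u1) (fst p) (snd p))"
        using strip_cont_continuous[OF strip_smooth_cont[OF strip_smooth_dx[OF strip_smooth_dx[OF u1(1)]]]]
        unfolding split_beta by (rule continuous_on_subset) auto
      then show "bounded ((\<lambda>p. dx (dx u1) (fst p) (snd p)) ` ?S)"
        by (intro compact_imp_bounded compact_continuous_image compact_Times compact_Icc)
    qed
    have "uniform_limit ?S (\<lambda>m p. f (fst p) (snd p) + (a (snd p) * dx (dx (U1 m)) (fst p) (snd p) + \<epsilon> m * dx (dx (U1 m)) (fst p) (snd p))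
          + (- b1 (snd p)) * dx (dx (U0 m)) (fst p) (snd p) + (- b2 (snd p)) * dx (U1 m) (fst p) (snd p) + (- b3 (snd p)) * U2 m (fst p) (snd p))
        (\<lambda>p. f (fst p) (snd p) + (a (snd p) * dx (dx u1) (fst p) (snd p) + 0 * dx (dx u1) (fst p) (snd p))
          + (- b1 (snd p)) * dx (dx u0) (fst p) (snd p) + (- b2 (snd p)) * dx u1 (fst p) (snd p) + (- b3 (snd p)) * u2 (fst p) (snd p)) sequentially"
      by (intro uniform_limit_add uniform_limit_const l4 ml[OF sa l3] ml[OF strip_smooth_uminus[OF sb(1)] l2]
          ml[OF strip_smooth_uminus[OF sb(2)] l1] ml[OF strip_smooth_uminus[OF sb(3)] l0])
    then show "uniform_limit ?S (\<lambda>m (t, x). f t x + (a x * dx (dx (U1 m)) t x + \<epsilon> m * dx (dx (U1 m)) t x) + (- b1 x) * dx (dx (U0 m)) t x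
        + (- b2 x) * dx (U1 m) t x + (- b3 x) * U2 m t x) (\<lambda>(t, x). u3 t x) sequentially"
      by (simp add: case_prod_beta' u3_def)
  qed
  have lim0: "v 0 = \<gamma>" if "strip_lim T V v" "\<And>m. V m 0 = \<gamma>" for V v \<gamma>
  proof
    fix x
    have "(\<lambda>m. \<gamma> x) \<longlonglongrightarrow> v 0 x"
      using strip_lim_pointwise[OF that(1), of 0 0 x] T that(2) by simp
    then show "v 0 x = \<gamma> x" using LIMSEQ_unique tendsto_const by blast
  qed
  have "third_order_eq T (\<lambda>x. a x + 0) b1 b2 b3 (\<lambda>x. 0) (\<lambda>x. 0) (\<lambda>x. 0) u0 u1 u2 u3 f"
    unfolding third_order_eq_def by (intro conjI u0 u1 u2 su3 uf d01 d12 d23) (simp add: u3_def)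
  then show ?thesis
    unfolding regularised_def using lim0[OF u0(2) init(1)] lim0[OF u1(2) init(2)] lim0[OF u2(2) init(3)] by blast
qed

end

lemma dt_dx:
  assumes "T > 0" "has_dt T v w" "strip_smooth False T v" "strip_smooth False T w" "t \<in> {0..T}"
  shows "dt T (dx v) t = dx w t" "dt T (dx (dx v)) t = dx (dx w) t"
  using has_dt_imp_dt[OF assms(1) has_dt_dx[OF assms(2-4)] assms(5)]
    has_dt_imp_dt[OF assms(1) has_dt_dx[OF has_dt_dx[OF assms(2-4)] strip_smooth_dx[OF assms(3)] strip_smooth_dx[OF assms(4)]] assms(5)] .

lemma third_order_eq_imp_solves_cauchy:
  assumes T: "T > 0" and eq: "third_order_eq T a b1 b2 b3 (\<lambda>x. 0) (\<lambda>x. 0) (\<lambda>x. 0) u0 u1 u2 u3 f"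
    and "u0 0 = g0" "u1 0 = g1" "u2 0 = g2"
  shows "solves_cauchy T a b1 b2 b3 f g0 g1 g2 u0"
proof -
  note s = third_order_eqD(1-4)[OF eq] and d = third_order_eqD(6-8)[OF eq] and pde = third_order_eqD(9)[OF eq]
  have t1: "dt T u0 t = u1 t" if "t \<in> {0..T}" for t using has_dt_imp_dt[OF T d(1) that] .
  have t2: "dt T (dt T u0) t = u2 t" if "t \<in> {0..T}" for t
    using dt_cong[OF t1 that] has_dt_imp_dt[OF T d(2) that] by simp
  have t3: "dt T (dt T (dt T u0)) t = u3 t" if "t \<in> {0..T}" for t
    using dt_cong[OF t2 that] has_dt_imp_dt[OF T d(3) that] by simp
  have "Ck_Cinf T (Suc (Suc (Suc 0))) u0"
    by (rule Ck_Cinf_SucI[OF T d(1) s(1,2)], rule Ck_Cinf_SucI[OF T d(2) s(2,3)], rule Ck_Cinf_SucI[OF T d(3) s(3,4)],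
        rule strip_smooth_imp_Ck0[OF s(4)])
  then have "Ck_Cinf T 3 u0" by (simp only: numeral_3_eq_3)
  then show "solves_cauchy T a b1 b2 b3 f g0 g1 g2 u0"
    unfolding solves_cauchy_def using T pde assms(3-5) by (auto simp: t1 t2 t3 dt_dx[OF T d(1) s(1,2)])
qed

lemma solves_cauchy_imp_third_order_eq:
  assumes T: "T > 0" and f: "strip_smooth False T f" and v: "solves_cauchy T a b1 b2 b3 f g0 g1 g2 v"
  shows "third_order_eq T a b1 b2 b3 (\<lambda>x. 0) (\<lambda>x. 0) (\<lambda>x. 0) v (dt T v) (dt T (dt T v)) (dt T (dt T (dt T v))) f
      \<and> v 0 = g0 \<and> dt T v 0 = g1 \<and> dt T (dt T v) 0 = g2"
proof -
  have "Ck_Cinf T (Suc (Suc (Suc 0))) v" using v by (simp only: solves_cauchy_def numeral_3_eq_3)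
  note c0 = this
  note c1 = Ck_Cinf_SucD[OF c0]
  note c2 = Ck_Cinf_SucD[OF c1(2)]
  note c3 = Ck_Cinf_SucD[OF c2(2)]
  note s = c0[THEN Ck_Cinf_imp_strip_smooth] c1(2)[THEN Ck_Cinf_imp_strip_smooth] c2(2)[THEN Ck_Cinf_imp_strip_smooth] c3(2)[THEN Ck_Cinf_imp_strip_smooth]
  show "third_order_eq T a b1 b2 b3 (\<lambda>x. 0) (\<lambda>x. 0) (\<lambda>x. 0) v (dt T v) (dt T (dt T v)) (dt T (dt T (dt T v))) f
    \<and> v 0 = g0 \<and> dt T v 0 = g1 \<and> dt T (dt T v) 0 = g2"
    unfolding third_order_eq_def
  proof (intro conjI ballI allI s f c1 c2 c3)
    fix t x assume t: "t \<in> {0..T}"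
    have "dt T (dt T (dt T v)) t x - a x * dt T (dx (dx v)) t x + b1 x * dx (dx v) t x
        + b2 x * dt T (dx v) t x + b3 x * dt T (dt T v) t x = f t x"
      using v t unfolding solves_cauchy_def by blast
    moreover have "dt T (dx v) t x = dx (dt T v) t x" "dt T (dx (dx v)) t x = dx (dx (dt T v)) t x"
      by (simp_all add: dt_dx[OF T c1(1) s(1,2) t])
    ultimately
    show "dt T (dt T (dt T v)) t x - a x * dx (dx (dt T v)) t x + b1 x * dx (dx v) t x + b2 x * dx (dt T v) t x
       + b3 x * dt T (dt T v) t x + 0 * dx v t x + 0 * dt T v t x + 0 * v t x = f t x"
      by simp
  qed (use v in \<open>auto simp: solves_cauchy_def\<close>)
qed

theorem theorem3p2:
  fixes T :: real
    and f :: "real \<Rightarrow> real \<Rightarrow> real"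
    and a b1 b2 b3 :: "real \<Rightarrow> real"
  assumes "T > 0"
    and "Ck_Cinf_c T 3 f"
    and "a \<in> Binf" and "b1 \<in> Binf" and "b2 \<in> Binf" and "b3 \<in> Binf"
    and "\<forall>x. a x \<ge> 0"
    and "(\<lambda>x. \<bar>b1 x\<bar>) \<lessapprox> a"
    and "(\<lambda>x. \<bar>b2 x\<bar>) \<lessapprox> (\<lambda>x. sqrt (a x))"
    and "(\<lambda>x. \<bar>deriv b1 x\<bar>) \<lessapprox> (\<lambda>x. sqrt (a x))"
  shows "Cinf_well_posed T a b1 b2 b3 f"
proof -
  have T: "0 \<le> T" using assms(1) by simp
  have a0: "0 \<le> a x" for x using assms(7) by simp
  have f: "strip_smooth True T f"
  proof -
    obtain Q where "compact Q" "\<forall>t\<in>{0..T}. \<forall>x. x \<notin> Q \<longrightarrow> f t x = 0" and ck: "Ck_Cinf T 3 f"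
      using assms(2) by (auto simp: Ck_Cinf_c_def)
    then show ?thesis by (intro strip_smooth_compact_support[OF Ck_Cinf_imp_strip_smooth[OF ck]]) auto
  qed
  obtain K0 where K0: "\<And>x. \<bar>deriv a x\<bar> \<le> K0 * sqrt (a x)"
    using glaeser_inequality[OF assms(3) a0] by blast
  obtain K1 where K1: "\<And>x. \<bar>b1 x\<bar> \<le> K1 * a x" using assms(8) by (auto simp: dominated_def)
  obtain K2 where K2: "\<And>x. \<bar>b2 x\<bar> \<le> K2 * sqrt (a x)" using assms(9) by (auto simp: dominated_def)
  obtain K3 where K3: "\<And>x. \<bar>deriv b1 x\<bar> \<le> K3 * sqrt (a x)" using assms(10) by (auto simp: dominated_def)
  define K where "K = \<bar>K0\<bar> + \<bar>K1\<bar> + \<bar>K2\<bar> + \<bar>K3\<bar>"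
  have up: "g \<le> K * s" if "g \<le> k * s" "k \<le> K" "0 \<le> s" for g k s
    using that mult_right_mono[of k K s] by linarith
  have "K0 \<le> K" "K1 \<le> K" "K2 \<le> K" "K3 \<le> K" by (auto simp: K_def)
  then have K: "\<bar>deriv a x\<bar> \<le> K * sqrt (a x)" "\<bar>b1 x\<bar> \<le> K * a x" "\<bar>deriv b1 x\<bar> \<le> K * sqrt (a x)" "\<bar>b2 x\<bar> \<le> K * sqrt (a x)" for x
    using up[OF K0] up[OF K1] up[OF K2] up[OF K3] a0 by auto
  note sa = strip_smooth_Binf[OF assms(3), of T]
  obtain N where N: "\<And>x. \<bar>a x\<bar> \<le> N"
    using strip_smooth_cont[OF sa] T by (auto simp: strip_cont_def)
  define l where "l = sqrt (N + 1)"
  have l: "0 \<le> l" "a x + 1 \<le> l\<^sup>2" for x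
  proof -
    have "0 \<le> N" using N[of 0] by linarith
    then show "0 \<le> l" "a x + 1 \<le> l\<^sup>2" using N[of x] by (auto simp: l_def)
  qed
  show ?thesis
    unfolding Cinf_well_posed_def
  proof (intro ballI)
    fix g0 g1 g2 assume "g0 \<in> Cinf_c" "g1 \<in> Cinf_c" "g2 \<in> Cinf_c"
    then have g: "g0 \<in> Binf" "g1 \<in> Binf" "g2 \<in> Binf" using Cinf_c_subset_Binf by auto
    interpret weakly_hyperbolic T l K a b1 b2 b3 g0 g1 g2 f
      by unfold_locales (fact T l assms(3) a0 assms(4-6) K g f)+
    obtain u0 u1 u2 u3 where u: "regularised 0 u0 u1 u2 u3" using existence by blast
    have "v t x = u0 t x" if v: "solves_cauchy T a b1 b2 b3 f g0 g1 g2 v" and t: "t \<in> {0..T}" for v t x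
    proof -
      have "regularised 0 v (dt T v) (dt T (dt T v)) (dt T (dt T (dt T v)))"
        using solves_cauchy_imp_third_order_eq[OF assms(1) strip_smooth_unbounded[OF f] v] by (simp add: regularised_def)
      from uniqueness[OF this u t] show ?thesis .
    qed
    moreover have "solves_cauchy T a b1 b2 b3 f g0 g1 g2 u0"
      using u by (intro third_order_eq_imp_solves_cauchy[OF assms(1), of a b1 b2 b3 u0 u1 u2 u3])
        (auto simp: regularised_def)
    ultimately show "\<exists>u. solves_cauchy T a b1 b2 b3 f g0 g1 g2 u \<and>
            (\<forall>v. solves_cauchy T a b1 b2 b3 f g0 g1 g2 v \<longrightarrow> (\<forall>t\<in>{0..T}. \<forall>x. v t x = u t x))"
      by blast
  qed
qed

end
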